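(* (Oblateness of the surface.) Let $1<\nu<2$, and let $r=\Xi_1(\zeta;\nu,\beta)$ be the vacuum boundary of the distorted Lane–Emden function $\Theta(r,\zeta;\nu,\beta)$. Then, as $\beta\to+0$, $$\Xi_1(\zeta;\nu,\beta)=\xi_1(\nu)+\frac{\xi_1(\nu)^2}{\mu_1(\nu)}\mathfrak h(\xi_1(\nu),\zeta)\,\beta+O(\beta^\nu),$$ and $$\sigma:=\frac{\Xi_1(0;\nu,\beta)-\Xi_1(\pm1;\nu,\beta)}{\xi_1(\nu)}=-\frac32\frac{\xi_1(\nu)}{\mu_1(\nu)}h_2(\xi_1(\nu))\,\beta+O(\beta^\nu),$$ and $\sigma>0$ for all sufficiently small $\beta>0$.
   Context: $a\vee b=\max(a,b)$. Lane–Emden function: $\theta(r)=\theta(r;\nu)$ solves $-\frac1{r^2}\frac{d}{dr}(r^2\frac{d\theta}{dr})=\theta^\nu$, $\theta=1+O(r^2)$ as $r\to+0$; it is positive on $[0,\xi_1)$ and vanishes at a finite $\xi_1=\xi_1(\nu)$; for $r\ge\xi_1$ put $\theta=-\mu_1(\frac1{\xi_1}-\frac1r)$, where $\mu_1=\mu_1(\nu)=\int_0^{\xi_1}\theta^\nu r^2dr$. Fix $r_\infty>\xi_1(\nu)$. Let $\mathfrak E$ be the Banach space (sup norm) of continuous functions $u(r,\zeta)$ on $[0,r_\infty]\times[-1,1]$ with $u(0,\zeta)=u(0,0)$, $u(r,-\zeta)=u(r,\zeta)$. For $f\in\mathfrak E$ let $\mathcal Kf$ be the Newtonian potential: $\mathcal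 Kf(r,\zeta)=\frac1{4\pi}\int_{|x'|\le r_\infty}\frac{f^\flat(x')}{|x-x'|}dx'$ where $r=|x|$, $\zeta=x_3/|x|$ and $f^\flat(x)=f(|x|,x_3/|x|)$. Let $\mathcal G(u)=1+\mathcal K((u\vee0)^\nu)-\mathcal K((u\vee0)^\nu)(0,0)$, with Fréchet derivative $D\mathcal G(u)h=\mathcal K(\nu(u\vee0)^{\nu-1}h)-\mathcal K(\nu(u\vee0)^{\nu-1}h)(0,0)$. Distorted Lane–Emden function: for all sufficiently small $\beta\ge0$, $\Theta(\cdot,\cdot;\nu,\beta)\in\mathfrak E$ is the unique solution near $\theta$ in $\mathfrak E$ of $\Theta=\beta\mathfrak g_1+\mathcal G(\Theta)$, $\mathfrak g_1(r,\zeta)=\frac14r^2(1-\zeta^2)$; it depends continuously on $\beta$, and there is a continuous curve $r=\Xi_1(\zeta;\nu,\beta)$ in $(0,r_\infty)$ such that for $0\le r\le r_\infty$: $\Theta(r,\zeta;\nu,\beta)>0\Leftrightarrow r<\Xi_1(\zeta;\nu,\beta)$. $I-D\mathcal G(\theta)$ has a bounded inverse on $\mathfrak E$; $\mathfrak h:=(I-D\mathcal G(\theta))^{-1}\mathfrak g_1$, and $h_2(r):=\frac52\int_{-1}^1\mathfrak h(r,\zeta)P_2(\zeta)d\zeta$, $P_2(\zeta)=\frac12(3\zeta^2-1)$. *)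

theory Defs
  imports "HOL-Analysis.Analysis" "HOL-Library.Landau_Symbols"
begin

text \<open>
  The Lane--Emden function with its first zero \<open>\<xi>\<close>, continued beyond \<open>\<xi>\<close> by a harmonic
  function. Continuity on \<open>{0..\<xi>}\<close> makes the value 1 at the origin and the zero at \<open>\<xi>\<close> limits
  of the solution on \<open>{0<..<\<xi>}\<close>.
\<close>

definition lane_emden_mass :: "real \<Rightarrow> (real \<Rightarrow> real) \<Rightarrow> real \<Rightarrow> real" where
  "lane_emden_mass \<nu> \<theta> \<xi> = integral {0..\<xi>} (\<lambda>r. \<theta> r powr \<nu> * r\<^sup>2)"

definition lane_emden :: "real \<Rightarrow> (real \<Rightarrow> real) \<Rightarrow> real \<Rightarrow> bool" where
  "lane_emden \<nu> \<theta> \<xi> \<longleftrightarrow>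
     0 < \<xi> \<and> continuous_on {0..\<xi>} \<theta> \<and>
     (\<forall>r\<in>{0<..<\<xi>}.
        \<theta> differentiable (at r) \<and>
        (\<lambda>s. s\<^sup>2 * deriv \<theta> s) differentiable (at r) \<and>
        - (1 / r\<^sup>2) * deriv (\<lambda>s. s\<^sup>2 * deriv \<theta> s) r = \<theta> r powr \<nu>) \<and>
     (\<lambda>r. \<theta> r - 1) \<in> O[at_right 0](\<lambda>r. r\<^sup>2) \<and>
     (\<forall>r\<in>{0..<\<xi>}. 0 < \<theta> r) \<and>
     \<theta> \<xi> = 0 \<and>
     (\<forall>r\<ge>\<xi>. \<theta> r = - lane_emden_mass \<nu> \<theta> \<xi> * (1 / \<xi> - 1 / r))"

text \<open>
  Functions on \<open>[0, R] \<times> [-1, 1]\<close> are represented by total curried functions whose values off that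
  rectangle are irrelevant; \<open>eq_E\<close> is equality on the rectangle and \<open>norm_E\<close> the sup norm there.
\<close>

definition space_E :: "real \<Rightarrow> (real \<Rightarrow> real \<Rightarrow> real) set" where
  "space_E R = {u. continuous_on ({0..R} \<times> {-1..1}) (\<lambda>(r, \<zeta>). u r \<zeta>) \<and>
     (\<forall>\<zeta>\<in>{-1..1}. u 0 \<zeta> = u 0 0) \<and>
     (\<forall>r\<in>{0..R}. \<forall>\<zeta>\<in>{-1..1}. u r (- \<zeta>) = u r \<zeta>)}"

definition eq_E :: "real \<Rightarrow> (real \<Rightarrow> real \<Rightarrow> real) \<Rightarrow> (real \<Rightarrow> real \<Rightarrow> real) \<Rightarrow> bool" where
  "eq_E R u v \<longleftrightarrow> (\<forall>r\<in>{0..R}. \<forall>\<zeta>\<in>{-1..1}. u r \<zeta> = v r \<zeta>)"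

definition norm_E :: "real \<Rightarrow> (real \<Rightarrow> real \<Rightarrow> real) \<Rightarrow> real" where
  "norm_E R u = (SUP (r, \<zeta>)\<in>{0..R} \<times> {-1..1}. \<bar>u r \<zeta>\<bar>)"

definition dist_E :: "real \<Rightarrow> (real \<Rightarrow> real \<Rightarrow> real) \<Rightarrow> (real \<Rightarrow> real \<Rightarrow> real) \<Rightarrow> real" where
  "dist_E R u v = norm_E R (\<lambda>r \<zeta>. u r \<zeta> - v r \<zeta>)"

text \<open>
  \<open>S\<close> is a bounded two-sided inverse of \<open>L\<close>. For linear \<open>L\<close> the norm bound also makes \<open>S\<close>
  independent, up to \<open>eq_E\<close>, of the values of its argument off the rectangle.
\<close>

definition bounded_inverse_E ::
    "real \<Rightarrow> ((real \<Rightarrow> real \<Rightarrow> real) \<Rightarrow> (real \<Rightarrow> real \<Rightarrow> real)) \<Rightarrow>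
     ((real \<Rightarrow> real \<Rightarrow> real) \<Rightarrow> (real \<Rightarrow> real \<Rightarrow> real)) \<Rightarrow> bool" where
  "bounded_inverse_E R L S \<longleftrightarrow>
     (\<forall>f\<in>space_E R. S f \<in> space_E R \<and> eq_E R (L (S f)) f) \<and>
     (\<forall>u\<in>space_E R. L u \<in> space_E R \<and> eq_E R (S (L u)) u) \<and>
     (\<exists>C. \<forall>f\<in>space_E R. norm_E R (S f) \<le> C * norm_E R f)"

text \<open>
  At the origin \<open>x $ 3 / norm x = 0\<close>, which is harmless for elements of \<open>space_E\<close>.
  In \<open>pot_K\<close> the point with \<open>|x| = r\<close> and \<open>x\<^sub>3 = r \<zeta>\<close> is taken in the meridian half plane
  \<open>x\<^sub>1 \<ge> 0, x\<^sub>2 = 0\<close>; by axial symmetry the choice does not matter.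
\<close>

definition axial :: "(real \<Rightarrow> real \<Rightarrow> real) \<Rightarrow> real ^ 3 \<Rightarrow> real" where
  "axial f x = f (norm x) (x $ 3 / norm x)"

definition pot_K :: "real \<Rightarrow> (real \<Rightarrow> real \<Rightarrow> real) \<Rightarrow> real \<Rightarrow> real \<Rightarrow> real" where
  "pot_K R f r \<zeta> =
     1 / (4 * pi) *
     (LINT y : cball 0 R | lborel.
        axial f y / norm (vector [r * sqrt (1 - \<zeta>\<^sup>2), 0, r * \<zeta>] - y))"

definition op_G :: "real \<Rightarrow> real \<Rightarrow> (real \<Rightarrow> real \<Rightarrow> real) \<Rightarrow> real \<Rightarrow> real \<Rightarrow> real" where
  "op_G \<nu> R u r \<zeta> =
     1 + pot_K R (\<lambda>s \<eta>. max (u s \<eta>) 0 powr \<nu>) r \<zeta>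
       - pot_K R (\<lambda>s \<eta>. max (u s \<eta>) 0 powr \<nu>) 0 0"

definition op_DG ::
    "real \<Rightarrow> real \<Rightarrow> (real \<Rightarrow> real \<Rightarrow> real) \<Rightarrow> (real \<Rightarrow> real \<Rightarrow> real) \<Rightarrow> real \<Rightarrow> real \<Rightarrow> real" where
  "op_DG \<nu> R u h r \<zeta> =
     pot_K R (\<lambda>s \<eta>. \<nu> * max (u s \<eta>) 0 powr (\<nu> - 1) * h s \<eta>) r \<zeta>
       - pot_K R (\<lambda>s \<eta>. \<nu> * max (u s \<eta>) 0 powr (\<nu> - 1) * h s \<eta>) 0 0"

definition g1 :: "real \<Rightarrow> real \<Rightarrow> real" where
  "g1 r \<zeta> = 1 / 4 * r\<^sup>2 * (1 - \<zeta>\<^sup>2)"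

definition distorted_eqn :: "real \<Rightarrow> real \<Rightarrow> real \<Rightarrow> (real \<Rightarrow> real \<Rightarrow> real) \<Rightarrow> bool" where
  "distorted_eqn \<nu> R \<beta> u \<longleftrightarrow> eq_E R u (\<lambda>r \<zeta>. \<beta> * g1 r \<zeta> + op_G \<nu> R u r \<zeta>)"

text \<open>
  The family of distorted Lane--Emden functions for \<open>\<beta> \<in> [0, \<beta>\<^sub>0]\<close>: unique solutions in a
  neighbourhood of \<open>\<theta>\<close> (of radius \<open>\<epsilon>\<close> independent of \<open>\<beta>\<close>), continuous in \<open>\<beta>\<close>.
\<close>

definition distorted_lane_emden ::
    "real \<Rightarrow> real \<Rightarrow> (real \<Rightarrow> real) \<Rightarrow> real \<Rightarrow> (real \<Rightarrow> real \<Rightarrow> real \<Rightarrow> real) \<Rightarrow> bool" where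
  "distorted_lane_emden \<nu> R \<theta> \<beta>\<^sub>0 \<Theta> \<longleftrightarrow>
     0 < \<beta>\<^sub>0 \<and>
     (\<exists>\<epsilon>>0. \<forall>\<beta>\<in>{0..\<beta>\<^sub>0}.
        \<Theta> \<beta> \<in> space_E R \<and> dist_E R (\<Theta> \<beta>) (\<lambda>r \<zeta>. \<theta> r) < \<epsilon> \<and> distorted_eqn \<nu> R \<beta> (\<Theta> \<beta>) \<and>
        (\<forall>u\<in>space_E R. dist_E R u (\<lambda>r \<zeta>. \<theta> r) < \<epsilon> \<and> distorted_eqn \<nu> R \<beta> u
            \<longrightarrow> eq_E R u (\<Theta> \<beta>))) \<and>
     (\<forall>\<beta>\<in>{0..\<beta>\<^sub>0}. ((\<lambda>b. dist_E R (\<Theta> b) (\<Theta> \<beta>)) \<longlongrightarrow> 0) (at \<beta> within {0..\<beta>\<^sub>0}))"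

definition vacuum_boundary :: "real \<Rightarrow> (real \<Rightarrow> real \<Rightarrow> real) \<Rightarrow> (real \<Rightarrow> real) \<Rightarrow> bool" where
  "vacuum_boundary R u \<Xi> \<longleftrightarrow>
     continuous_on {-1..1} \<Xi> \<and>
     (\<forall>\<zeta>\<in>{-1..1}. 0 < \<Xi> \<zeta> \<and> \<Xi> \<zeta> < R \<and> (\<forall>r\<in>{0..R}. 0 < u r \<zeta> \<longleftrightarrow> r < \<Xi> \<zeta>))"

definition P2 :: "real \<Rightarrow> real" where
  "P2 \<zeta> = 1 / 2 * (3 * \<zeta>\<^sup>2 - 1)"

definition P2_component :: "(real \<Rightarrow> real \<Rightarrow> real) \<Rightarrow> real \<Rightarrow> real" where
  "P2_component h r = 5 / 2 * integral {-1..1} (\<lambda>\<zeta>. h r \<zeta> * P2 \<zeta>)"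

end

theory Submission imports Defs begin

text \<open>
  Write \<open>\<Theta>\<close> for the distorted profile at \<open>\<beta>\<close> and \<open>w = \<Theta> - \<theta>\<close>. As \<open>\<theta>\<close> itself solves the equation with
  \<open>\<beta> = 0\<close> (\<open>theta_fixed_point\<close>), local uniqueness makes it the member of the family at \<open>\<beta> = 0\<close>, so
  \<open>w\<close> tends to 0 uniformly. The map \<open>t \<mapsto> max t 0 powr \<nu>\<close> has a derivative that is only Hoelder continuous
  with exponent \<open>\<nu> - 1\<close>; hence \<open>(I - DG) w = \<beta> g1 + O(|w| powr \<nu>)\<close>, and the bounded inverse turns this
  into \<open>w = \<beta> h + O(\<beta> powr \<nu>)\<close> (\<open>distorted_expansion\<close>). On the boundary curve
  \<open>\<theta> + \<beta> h = O(\<beta> powr \<nu>)\<close>. Since \<open>\<theta>\<close> has a simple zero at \<open>\<xi>\<close> with slope \<open>- \<mu> / \<xi>\<^sup>2\<close> and a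
  quadratic Taylor remainder, and \<open>h\<close> is Lipschitz in \<open>r\<close>, solving for the radius gives the first
  expansion (\<open>boundary_expansion\<close>).

  The statements about the oblateness need the angular structure of \<open>h\<close>. The potential maps radial
  functions to radial ones and \<open>a(r) P2(\<zeta>)\<close> to functions of the same form (\<open>pot_K_radial\<close>,
  \<open>pot_K_P2\<close>), and \<open>g1 = r\<^sup>2 / 6 - r\<^sup>2 / 6 * P2\<close>. Both parts are inverted by a Neumann series. On radial
  functions \<open>DG\<close> is a Volterra operator, because the value at the origin is subtracted, so the series
  converges factorially. On multiples of \<open>P2\<close> the operator is positive, and \<open>- \<theta>'\<close> is a strict
  supersolution: differentiating the Lane--Emden equation shows that \<open>- \<theta>'\<close> is fixed by the analogous
  operator of degree one, whose kernel dominates the kernel of degree two by the factor \<open>5 / 3\<close>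
  (\<open>quad_slope\<close>). The series therefore converges geometrically, and all its terms are nonnegative.
  This yields \<open>h = v(r) - y(r) P2(\<zeta>)\<close> with \<open>y > 0\<close> (\<open>linear_response_structure\<close>): the
  \<open>P2\<close> component of \<open>h\<close> is \<open>- y\<close>, and \<open>h(\<xi>, 0) - h(\<xi>, 1) = 3 / 2 * y(\<xi>) > 0\<close>.
\<close>

section \<open>Integrals of axisymmetric functions on three-dimensional space\<close>

lemma borel_measurable_vector3:
  "(\<lambda>(p :: real \<times> real, z :: real). vector [fst p, snd p, z] :: real ^ 3)
     \<in> borel_measurable (lborel \<Otimes>\<^sub>M lborel)"
proof -
  have "(\<lambda>x. (\<lambda>(p :: real \<times> real, z :: real). vector [fst p, snd p, z] :: real ^ 3) x $ i)
      \<in> borel_measurable borel" for i :: 3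
    using exhaust_3[of i]
    by (elim disjE) (simp_all add: case_prod_unfold borel_measurable_continuous_onI continuous_intros)
  then have "(\<lambda>(p :: real \<times> real, z :: real). vector [fst p, snd p, z] :: real ^ 3) \<in> borel_measurable borel"
    by (subst borel_measurable_euclidean_space) (auto simp: Basis_vec_def inner_axis)
  then show ?thesis by (simp add: lborel_prod)
qed

lemma lborel_real3:
  "lborel = distr (lborel \<Otimes>\<^sub>M lborel) borel
     (\<lambda>(p :: real \<times> real, z :: real). vector [fst p, snd p, z] :: real ^ 3)"
  (is "_ = distr _ _ ?T")
proof -
  note borel_measurable_vector3 [measurable]
  show ?thesis
  proof (rule lborel_eqI)
    fix l u :: "real ^ 3" assume le: "\<And>b. b \<in> Basis \<Longrightarrow> l \<bullet> b \<le> u \<bullet> b"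
    have le': "l $ i \<le> u $ i" for i
      using le[of "axis i 1"] by (simp add: inner_axis axis_in_Basis_iff)
    have box_pair: "box (a, b) (c, d) = {a<..<c} \<times> {b<..<d}" for a b c d :: real
      by (auto simp: mem_box Basis_prod_def)
    have eq: "?T -` box l u = ({l $ 1<..<u $ 1} \<times> {l $ 2<..<u $ 2}) \<times> {l $ 3<..<u $ 3}"
      by (auto simp: mem_box_cart forall_3)
    have "emeasure (distr (lborel \<Otimes>\<^sub>M lborel) borel ?T) (box l u) =
        emeasure (lborel \<Otimes>\<^sub>M lborel) (?T -` box l u)"
      by (subst emeasure_distr) (auto simp: space_pair_measure)
    also have "\<dots> = emeasure lborel (box (l $ 1, l $ 2) (u $ 1, u $ 2)) * emeasure lborel {l $ 3<..<u $ 3}"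
      unfolding eq box_pair[symmetric] by (rule lborel.emeasure_pair_measure_Times) auto
    also have "emeasure lborel (box (l $ 1, l $ 2) (u $ 1, u $ 2)) = ennreal ((u $ 1 - l $ 1) * (u $ 2 - l $ 2))"
      using le'[of 1] le'[of 2]
      by (simp add: box_pair lborel_prod[symmetric] lborel.emeasure_pair_measure_Times ennreal_mult)
    also have "ennreal ((u $ 1 - l $ 1) * (u $ 2 - l $ 2)) * emeasure lborel {l $ 3<..<u $ 3} =
        ennreal (\<Prod>i\<in>UNIV. u $ i - l $ i)"
    proof -
      have e: "emeasure lborel {l $ 3<..<u $ 3} = ennreal (u $ 3 - l $ 3)"
        using le'[of 3] by simp
      have p: "(\<Prod>i\<in>UNIV. u $ i - l $ i) = (u $ 1 - l $ 1) * (u $ 2 - l $ 2) * (u $ 3 - l $ 3)"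
        unfolding UNIV_3 by (simp add: mult.assoc)
      show ?thesis unfolding e p using le'[of 1] le'[of 2] le'[of 3]
        by (intro ennreal_mult[symmetric] mult_nonneg_nonneg) simp_all
    qed
    also have "(\<Prod>i\<in>UNIV. u $ i - l $ i) = (\<Prod>b\<in>Basis. (u - l) \<bullet> b)"
    proof -
      have B: "Basis = range (\<lambda>i. axis i 1 :: real ^ 3)" by (auto simp: Basis_vec_def)
      show ?thesis unfolding B by (simp add: prod.reindex inj_on_def axis_eq_axis inner_axis)
    qed
    finally show "emeasure (distr (lborel \<Otimes>\<^sub>M lborel) borel ?T) (box l u) = ennreal (\<Prod>b\<in>Basis. (u - l) \<bullet> b)" .
  qed auto
qed

lemma measure_eqI_atMost:
  fixes M N :: "real measure"
  assumes "sets M = sets borel" "sets N = sets borel"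
    and M: "\<And>a. emeasure M {..a} = ennreal (F a)" and N: "\<And>a. emeasure N {..a} = ennreal (F a)"
  shows "M = N"
proof (rule measure_eqI_generator_eq_countable)
  let ?E = "range (\<lambda>a::real. {..a})"
  show "Int_stable ?E" by (auto simp: Int_stable_def)
  show "?E \<subseteq> Pow UNIV" by auto
  show "sets M = sigma_sets UNIV ?E" "sets N = sigma_sets UNIV ?E"
    using assms(1,2) by (simp_all add: borel_eq_atMost sets_measure_of)
  show "emeasure M X = emeasure N X" if "X \<in> ?E" for X using that M N by auto
  show "range (\<lambda>n::nat. {..real n}) \<subseteq> ?E" by auto
  show "(\<Union>(range (\<lambda>n::nat. {..real n}))) = UNIV" by (auto simp: real_arch_simple)
  show "emeasure M a \<noteq> \<infinity>" if "a \<in> range (\<lambda>n::nat. {..real n})" for a using that M by auto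
qed auto

lemma planar_area:
  "distr lborel borel (\<lambda>p :: real \<times> real. (norm p)\<^sup>2) = density lborel (\<lambda>t. ennreal pi * indicator {0..} t)"
  (is "?M = ?N")
proof (rule measure_eqI_atMost)
  show "sets ?M = sets borel" "sets ?N = sets borel" by simp_all
  show "emeasure ?M {..a} = ennreal (pi * max a 0)" for a
  proof -
    have "(\<lambda>p :: real \<times> real. (norm p)\<^sup>2) -` {..a} = (if a < 0 then {} else cball 0 (sqrt a))"
    proof (cases "a < 0")
      case True
      then show ?thesis by (auto simp: not_le) (meson less_le_trans not_less zero_le_power2)
    next
      case False
      then have "(norm p)\<^sup>2 \<le> a \<longleftrightarrow> norm p \<le> sqrt a" for p :: "real \<times> real"
        using real_sqrt_le_iff[of "(norm p)\<^sup>2" a] by simp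
      with False show ?thesis by auto
    qed
    then show ?thesis
      by (auto simp: emeasure_distr emeasure_cball unit_ball_vol_2 )
  qed
  show "emeasure ?N {..a} = ennreal (pi * max a 0)" for a
  proof -
    have "emeasure ?N {..a} = (\<integral>\<^sup>+t. ennreal pi * indicator {0..a} t \<partial>lborel)"
      by (subst emeasure_density) (auto intro!: nn_integral_cong split: split_indicator)
    also have "\<dots> = ennreal (pi * max a 0)"
      by (subst nn_integral_cmult) (auto simp: ennreal_mult max_def emeasure_lborel_Icc_eq)
    finally show ?thesis .
  qed
qed

lemma sqrt_push_forward:
  "distr (density lborel (indicator {0..})) borel sqrt = density lborel (\<lambda>s. ennreal (2 * s) * indicator {0..} s)"
  (is "?M = ?N")
proof (rule measure_eqI_atMost)
  show "sets ?M = sets borel" "sets ?N = sets borel" by simp_all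
  show "emeasure ?M {..a} = ennreal ((max a 0)\<^sup>2)" for a
  proof -
    have "emeasure ?M {..a} = (\<integral>\<^sup>+t. indicator {0..} t * indicator (sqrt -` {..a}) t \<partial>lborel)"
      by (subst emeasure_distr) (auto simp: emeasure_density in_borel_measurable_borel[THEN iffD1, OF borel_measurable_sqrt, simplified])
    also have "\<dots> = (\<integral>\<^sup>+t. (if a < 0 then 0 else indicator {0..a\<^sup>2} t) \<partial>lborel)"
    proof (intro nn_integral_cong)
      fix t :: real
      have "0 \<le> t \<Longrightarrow> sqrt t \<le> a \<longleftrightarrow> 0 \<le> a \<and> t \<le> a\<^sup>2"
        by (metis order_trans real_sqrt_ge_zero real_le_lsqrt sqrt_le_D)
      then show "indicator {0..} t * indicator (sqrt -` {..a}) t = (if a < 0 then 0 else indicator {0..a\<^sup>2} t :: ennreal)"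
        by (auto simp: indicator_def)
    qed
    also have "\<dots> = ennreal ((max a 0)\<^sup>2)" by (cases "a < 0") (auto simp: max_def)
    finally show ?thesis .
  qed
  show "emeasure ?N {..a} = ennreal ((max a 0)\<^sup>2)" for a
  proof -
    have "emeasure ?N {..a} = (\<integral>\<^sup>+s. ennreal (2 * s) * indicator {0..max a 0} s \<partial>lborel)"
      by (subst emeasure_density, simp, simp, intro nn_integral_cong) (auto split: split_indicator)
    also have "\<dots> = ennreal ((max a 0)\<^sup>2 - 0\<^sup>2)"
      by (rule nn_integral_FTC_Icc) (auto intro!: derivative_eq_intros)
    finally show ?thesis by simp
  qed
qed

text \<open>
  Archimedes' observation that the projection of a sphere to an axis is uniform. In the coordinates
  \<open>t = y\<^sub>1\<^sup>2 + y\<^sub>2\<^sup>2\<close> and \<open>z = y\<^sub>3\<close> Lebesgue measure is \<open>pi dt dz\<close>, and for fixed \<open>z\<close> passing from \<open>t\<close> to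
  \<open>s\<^sup>2 = t + z\<^sup>2\<close> is a translation. This replaces spherical coordinates throughout.
\<close>

lemma nn_integral_axisymmetric:
  fixes F :: "real \<Rightarrow> real \<Rightarrow> ennreal"
  assumes F: "(\<lambda>(s, z). F s z) \<in> borel_measurable borel"
  shows "(\<integral>\<^sup>+y. F (norm (y :: real ^ 3)) (y $ 3) \<partial>lborel) =
    (\<integral>\<^sup>+s. \<integral>\<^sup>+z. ennreal (2 * pi * s) * indicator {0..} s * indicator {-s..s} z * F s z \<partial>lborel \<partial>lborel)"
proof -
  have F' [measurable]: "(\<lambda>(s, z). F s z) \<in> borel_measurable (borel \<Otimes>\<^sub>M borel)"
    using F by (simp add: borel_prod)
  have [measurable]: "(\<lambda>y. F (norm (y :: real ^ 3)) (y $ 3)) \<in> borel_measurable borel"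
    by measurable
  note borel_measurable_vector3 [measurable]
  have nrm: "norm (vector [fst p, snd p, z] :: real ^ 3) = sqrt ((norm p)\<^sup>2 + z\<^sup>2)" for p z
    by (simp add: norm_vec_def L2_set_def sum_3 norm_prod_def)
  have "(\<integral>\<^sup>+y. F (norm (y :: real ^ 3)) (y $ 3) \<partial>lborel) =
      (\<integral>\<^sup>+x. (\<lambda>(p, z). F (sqrt ((norm (p :: real \<times> real))\<^sup>2 + z\<^sup>2)) z) x \<partial>(lborel \<Otimes>\<^sub>M lborel))"
    by (subst lborel_real3, subst nn_integral_distr) (auto simp: case_prod_unfold nrm)
  also have "\<dots> = (\<integral>\<^sup>+z. \<integral>\<^sup>+p. F (sqrt ((norm (p :: real \<times> real))\<^sup>2 + z\<^sup>2)) z \<partial>lborel \<partial>lborel)"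
    by (subst lborel_pair.nn_integral_snd[symmetric]) (auto simp: case_prod_unfold)
  also have "\<dots> = (\<integral>\<^sup>+z. \<integral>\<^sup>+t. ennreal pi * indicator {z\<^sup>2..} t * F (sqrt t) z \<partial>lborel \<partial>lborel)"
  proof (rule nn_integral_cong)
    fix z :: real
    have "(\<integral>\<^sup>+p. F (sqrt ((norm (p :: real \<times> real))\<^sup>2 + z\<^sup>2)) z \<partial>lborel) =
        (\<integral>\<^sup>+t. F (sqrt (t + z\<^sup>2)) z \<partial>distr lborel borel (\<lambda>p :: real \<times> real. (norm p)\<^sup>2))"
      by (subst nn_integral_distr) auto
    also have "\<dots> = (\<integral>\<^sup>+t. ennreal pi * indicator {0..} t * F (sqrt (t + z\<^sup>2)) z \<partial>lborel)"
      unfolding planar_area by (subst nn_integral_density) auto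
    also have "\<dots> = (\<integral>\<^sup>+t. ennreal pi * indicator {z\<^sup>2..} t * F (sqrt t) z \<partial>lborel)"
      by (subst nn_integral_real_affine[where c=1 and t="z\<^sup>2" and f="\<lambda>t. ennreal pi * indicator {z\<^sup>2..} t * F (sqrt t) z"])
        (auto intro!: nn_integral_cong simp: add.commute split: split_indicator)
    finally show "(\<integral>\<^sup>+p. F (sqrt ((norm (p :: real \<times> real))\<^sup>2 + z\<^sup>2)) z \<partial>lborel) = \<dots>" .
  qed
  also have "\<dots> = (\<integral>\<^sup>+t. \<integral>\<^sup>+z. ennreal pi * indicator {z\<^sup>2..} t * F (sqrt t) z \<partial>lborel \<partial>lborel)"
    by (subst lborel_pair.Fubini') (auto simp: case_prod_unfold indicator_def)
  also have "\<dots> = (\<integral>\<^sup>+t. indicator {0..} t * (\<integral>\<^sup>+z. ennreal pi * indicator {z\<^sup>2..} ((sqrt t)\<^sup>2) * F (sqrt t) z \<partial>lborel) \<partial>lborel)"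
  proof (intro nn_integral_cong)
    fix t :: real
    show "(\<integral>\<^sup>+z. ennreal pi * indicator {z\<^sup>2..} t * F (sqrt t) z \<partial>lborel) =
      indicator {0..} t * (\<integral>\<^sup>+z. ennreal pi * indicator {z\<^sup>2..} ((sqrt t)\<^sup>2) * F (sqrt t) z \<partial>lborel)"
    proof (cases "t \<ge> 0")
      case False
      then have "indicator {z\<^sup>2..} t = (0::ennreal)" for z
        by (auto simp: indicator_def) (meson order_trans zero_le_power2)
      with False show ?thesis by simp
    qed simp
  qed
  also have "\<dots> = (\<integral>\<^sup>+s. (\<integral>\<^sup>+z. ennreal pi * indicator {z\<^sup>2..} (s\<^sup>2) * F s z \<partial>lborel)
      \<partial>distr (density lborel (indicator {0..})) borel sqrt)"
    by (subst nn_integral_distr, simp, simp add: indicator_def)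
      (subst nn_integral_density, auto simp: indicator_def)
  also have "\<dots> = (\<integral>\<^sup>+s. ennreal (2 * s) * indicator {0..} s * (\<integral>\<^sup>+z. ennreal pi * indicator {z\<^sup>2..} (s\<^sup>2) * F s z \<partial>lborel) \<partial>lborel)"
    unfolding sqrt_push_forward by (subst nn_integral_density) (auto simp: indicator_def)
  also have "\<dots> = (\<integral>\<^sup>+s. \<integral>\<^sup>+z. ennreal (2 * pi * s) * indicator {0..} s * indicator {-s..s} z * F s z \<partial>lborel \<partial>lborel)"
  proof (rule nn_integral_cong)
    fix s :: real
    show "ennreal (2 * s) * indicator {0..} s * (\<integral>\<^sup>+z. ennreal pi * indicator {z\<^sup>2..} (s\<^sup>2) * F s z \<partial>lborel) =
      (\<integral>\<^sup>+z. ennreal (2 * pi * s) * indicator {0..} s * indicator {-s..s} z * F s z \<partial>lborel)"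
    proof (cases "s \<ge> 0")
      case True
      have "(indicator {z\<^sup>2..} (s\<^sup>2) :: ennreal) = indicator {-s..s} z" for z
        using True abs_le_square_iff[of z s] by (auto simp: indicator_def abs_le_iff)
      then show ?thesis using True
        apply (simp add: nn_integral_cmult[symmetric])
        apply (rule nn_integral_cong)
        apply (auto simp: ennreal_mult mult_ac)
        done
    qed simp
  qed
  finally show ?thesis .
qed

lemma distr_axisymmetric:
  "distr lborel borel (\<lambda>y :: real ^ 3. (norm y, y $ 3)) =
   density lborel (\<lambda>(s, z). ennreal (2 * pi * s) * indicator {0..} s * indicator {-s..s} z)"
  (is "?M = density lborel ?d")
proof (rule measure_eqI)
  have d [measurable]: "?d \<in> borel_measurable borel"
    unfolding borel_prod[symmetric] indicator_def of_bool_def atLeastAtMost_iff atLeast_iff by measurable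
  fix A assume "A \<in> sets ?M"
  then have A [measurable]: "A \<in> sets borel" by simp
  have ind: "(\<lambda>(s, z). indicator A (s, z) :: ennreal) \<in> borel_measurable borel"
    by (simp add: case_prod_unfold)
  have m: "(\<lambda>x. ?d x * indicator A x) \<in> borel_measurable (lborel \<Otimes>\<^sub>M lborel)"
    by (simp add: lborel_prod)
  have "emeasure ?M A = (\<integral>\<^sup>+y. indicator A (norm (y :: real ^ 3), y $ 3) \<partial>lborel)"
    by (subst nn_integral_indicator[symmetric], simp, subst nn_integral_distr) auto
  also have "\<dots> = (\<integral>\<^sup>+s. \<integral>\<^sup>+z. ?d (s, z) * indicator A (s, z) \<partial>lborel \<partial>lborel)"
    by (subst nn_integral_axisymmetric[OF ind]) (simp add: mult.assoc)
  also have "\<dots> = (\<integral>\<^sup>+x. ?d x * indicator A x \<partial>(lborel \<Otimes>\<^sub>M lborel))"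
    by (subst lborel.nn_integral_fst[symmetric, OF m]) simp
  also have "\<dots> = emeasure (density lborel ?d) A"
    by (simp add: lborel_prod emeasure_density)
  finally show "emeasure ?M A = emeasure (density lborel ?d) A" .
qed simp

lemma integral_axisymmetric:
  fixes F :: "real \<Rightarrow> real \<Rightarrow> real"
  assumes F: "(\<lambda>(s, z). F s z) \<in> borel_measurable borel"
    and int: "integrable lborel (\<lambda>y :: real ^ 3. F (norm y) (y $ 3))"
  shows "(\<integral>y. F (norm (y :: real ^ 3)) (y $ 3) \<partial>lborel) =
    (\<integral>s. indicator {0..} s * (2 * pi * s * (\<integral>z. indicator {-s..s} z * F s z \<partial>lborel)) \<partial>lborel)"
    and "integrable lborel (\<lambda>s. indicator {0..} s * (2 * pi * s * (\<integral>z. indicator {-s..s} z * F s z \<partial>lborel)))"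
proof -
  let ?d = "\<lambda>(s, z). 2 * pi * s * indicator {0..} s * indicator {-s..s} z :: real"
  have d [measurable]: "?d \<in> borel_measurable borel"
    unfolding borel_prod[symmetric] indicator_def of_bool_def atLeastAtMost_iff atLeast_iff by measurable
  have D: "distr lborel borel (\<lambda>y :: real ^ 3. (norm y, y $ 3)) = density lborel ?d"
    unfolding distr_axisymmetric
    by (rule arg_cong[where f="density lborel"]) (auto simp: fun_eq_iff indicator_def)
  let ?F = "\<lambda>(s, z). F s z"
  note F [measurable]
  have dn: "0 \<le> ?d x" for x by (auto simp: indicator_def split: prod.split)
  have i1: "integrable (density lborel ?d) ?F"
    unfolding D[symmetric] using int by (subst integrable_distr_eq) auto
  then have i2: "integrable lborel (\<lambda>x. ?d x * ?F x)"
    by (subst (asm) integrable_density) (simp_all add: dn d F del: mult_nonneg_nonneg split_paired_All)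
  then have i3: "integrable (lborel \<Otimes>\<^sub>M lborel) (\<lambda>x. ?d x * ?F x)" by (simp add: lborel_prod)
  have inner: "(\<integral>z. ?d (s, z) * ?F (s, z) \<partial>lborel) =
      indicator {0..} s * (2 * pi * s * (\<integral>z. indicator {-s..s} z * F s z \<partial>lborel))" for s
    unfolding integral_mult_right_zero[symmetric] by (intro Bochner_Integration.integral_cong) auto
  have "(\<integral>y. F (norm (y :: real ^ 3)) (y $ 3) \<partial>lborel) = (\<integral>x. ?F x \<partial>distr lborel borel (\<lambda>y :: real ^ 3. (norm y, y $ 3)))"
    by (subst integral_distr) auto
  also have "\<dots> = (\<integral>x. ?d x *\<^sub>R ?F x \<partial>lborel)"
    unfolding D
  proof (rule integral_density)
    show "?F \<in> borel_measurable lborel" "?d \<in> borel_measurable lborel" by (simp_all add: F d)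
    show "AE x in lborel. 0 \<le> ?d x" using dn by (intro AE_I2)
  qed
  also have "\<dots> = (\<integral>x. ?d x * ?F x \<partial>(lborel \<Otimes>\<^sub>M lborel))" by (simp only: lborel_prod real_scaleR_def)
  also have "\<dots> = (\<integral>s. \<integral>z. ?d (s, z) * ?F (s, z) \<partial>lborel \<partial>lborel)"
    by (rule lborel_pair.integral_fst'[symmetric, OF i3])
  finally show "(\<integral>y. F (norm (y :: real ^ 3)) (y $ 3) \<partial>lborel) =
    (\<integral>s. indicator {0..} s * (2 * pi * s * (\<integral>z. indicator {-s..s} z * F s z \<partial>lborel)) \<partial>lborel)"
    unfolding inner .
  show "integrable lborel (\<lambda>s. indicator {0..} s * (2 * pi * s * (\<integral>z. indicator {-s..s} z * F s z \<partial>lborel)))"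
    using lborel_pair.integrable_fst'[OF i3] unfolding inner .
qed

lemma lborel_distr_orthogonal:
  fixes f :: "real ^ 3 \<Rightarrow> real ^ 3"
  assumes f: "orthogonal_transformation f"
  shows "distr lborel borel f = lborel"
proof (rule lborel_eqI[symmetric])
  have lin: "linear f" using f by (rule orthogonal_transformation_linear)
  have [measurable]: "f \<in> borel_measurable borel"
    by (intro borel_measurable_continuous_onI linear_continuous_on linear_conv_bounded_linear[THEN iffD1] lin)
  fix l u :: "real ^ 3" assume le: "\<And>b. b \<in> Basis \<Longrightarrow> l \<bullet> b \<le> u \<bullet> b"
  have bij: "bij f" using f by (rule orthogonal_transformation_bij)
  have eq: "f -` box l u = inv f ` box l u" using bij by (simp add: bij_vimage_eq_inv_image)
  have o: "orthogonal_transformation (inv f)" using f by (rule orthogonal_transformation_inv)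
  have lm: "inv f ` box l u \<in> lmeasurable"
    using measurable_orthogonal_image[OF o, of "box l u"] by simp
  have bm: "f -` box l u \<in> sets borel" using measurable_sets_borel[of f borel "box l u"] by simp
  have "emeasure (distr lborel borel f) (box l u) = emeasure lborel (f -` box l u)"
    by (subst emeasure_distr) auto
  also have "\<dots> = emeasure lebesgue (inv f ` box l u)" unfolding eq[symmetric] using bm by simp
  also have "\<dots> = emeasure lebesgue (box l u)"
  proof -
    have "box l u \<in> lmeasurable" by simp
    then show ?thesis
      by (simp only: emeasure_eq_measure2[OF lm] emeasure_eq_measure2 measure_orthogonal_image[OF o])
  qed
  also have "\<dots> = ennreal (\<Prod>b\<in>Basis. (u - l) \<bullet> b)"
    using le by (simp add: emeasure_lborel_box_eq)
  finally show "emeasure (distr lborel borel f) (box l u) = ennreal (\<Prod>b\<in>Basis. (u - l) \<bullet> b)" .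
qed simp

lemma orthogonal_change_of_variables:
  fixes f :: "real ^ 3 \<Rightarrow> real ^ 3" and g :: "real ^ 3 \<Rightarrow> real"
  assumes f: "orthogonal_transformation f" and g: "integrable lborel g"
  shows "integrable lborel (\<lambda>x. g (f x))" "(\<integral>x. g (f x) \<partial>lborel) = (\<integral>x. g x \<partial>lborel)"
proof -
  have lin: "linear f" using f by (rule orthogonal_transformation_linear)
  have [measurable]: "f \<in> borel_measurable borel"
    by (intro borel_measurable_continuous_onI linear_continuous_on linear_conv_bounded_linear[THEN iffD1] lin)
  have [measurable]: "g \<in> borel_measurable borel" using g by (auto dest: borel_measurable_integrable)
  have "integrable (distr lborel borel f) g" unfolding lborel_distr_orthogonal[OF f] by (rule g)
  then show "integrable lborel (\<lambda>x. g (f x))" by (subst (asm) integrable_distr_eq) auto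
  have "(\<integral>x. g x \<partial>lborel) = (\<integral>x. g x \<partial>distr lborel borel f)" unfolding lborel_distr_orthogonal[OF f] ..
  also have "\<dots> = (\<integral>x. g (f x) \<partial>lborel)" by (subst integral_distr) auto
  finally show "(\<integral>x. g (f x) \<partial>lborel) = (\<integral>x. g x \<partial>lborel)" ..
qed

text \<open>
  After translating \<open>x\<close> to the origin the domain lies in the ball of radius \<open>2 R\<close>, where each sphere
  contributes \<open>4 * pi\<close>. Via \<open>1 / t \<le> 1 + 1 / t\<^sup>2\<close> this one bound controls the Newtonian kernel
  itself as well as its Lipschitz modulus.
\<close>

lemma nn_integral_inverse_square_kernel:
  fixes x :: "real ^ 3"
  assumes x: "norm x \<le> R"
  shows "(\<integral>\<^sup>+y. ennreal (indicator (cball 0 R) y / (norm (x - y))\<^sup>2) \<partial>lborel) \<le> ennreal (8 * pi * R)"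
proof -
  have R: "0 \<le> R" using x norm_ge_zero order_trans by blast
  have m: "(\<lambda>(s, z :: real). ennreal (indicator {..2 * R} s / s\<^sup>2)) \<in> borel_measurable borel"
    unfolding borel_prod[symmetric] by simp
  have "(\<integral>\<^sup>+y. ennreal (indicator (cball 0 R) y / (norm (x - y))\<^sup>2) \<partial>lborel) \<le>
      (\<integral>\<^sup>+y. (\<lambda>z :: real ^ 3. ennreal (indicator {..2 * R} (norm z) / (norm z)\<^sup>2)) (x - y) \<partial>lborel)"
  proof (intro nn_integral_mono ennreal_leI divide_right_mono)
    fix y :: "real ^ 3"
    show "indicator (cball 0 R) y \<le> (indicator {..2 * R} (norm (x - y)) :: real)"
      using x norm_triangle_ineq4[of x y] by (auto simp: indicator_def)
  qed simp
  also have "\<dots> = (\<integral>\<^sup>+z. ennreal (indicator {..2 * R} (norm z) / (norm z)\<^sup>2) \<partial>(lborel :: (real ^ 3) measure))"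
    by (subst (2) lborel_affine[of "-1" x])
      (auto simp: nn_integral_density nn_integral_distr one_ennreal_def[symmetric])
  also have "\<dots> = (\<integral>\<^sup>+s. \<integral>\<^sup>+z. ennreal (2 * pi * s) * indicator {0..} s * indicator {-s..s} z *
      ennreal (indicator {..2 * R} s / s\<^sup>2) \<partial>lborel \<partial>lborel)"
    by (rule nn_integral_axisymmetric[OF m])
  also have "\<dots> \<le> (\<integral>\<^sup>+s. ennreal (4 * pi) * indicator {0..2 * R} s \<partial>lborel)"
  proof (rule nn_integral_mono)
    fix s :: real
    show "(\<integral>\<^sup>+z. ennreal (2 * pi * s) * indicator {0..} s * indicator {-s..s} z *
      ennreal (indicator {..2 * R} s / s\<^sup>2) \<partial>lborel) \<le> ennreal (4 * pi) * indicator {0..2 * R} s"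
    proof (cases "0 \<le> s \<and> s \<le> 2 * R")
      case True
      have "(\<integral>\<^sup>+z. ennreal (2 * pi * s) * indicator {0..} s * indicator {-s..s} z *
          ennreal (indicator {..2 * R} s / s\<^sup>2) \<partial>lborel) =
          (\<integral>\<^sup>+z. ennreal (2 * pi * s * (1 / s\<^sup>2)) * indicator {-s..s} z \<partial>lborel)"
      proof (intro nn_integral_cong)
        fix z :: real
        have "ennreal (2 * pi * s * (1 / s\<^sup>2)) = ennreal (2 * pi * s) * ennreal (1 / s\<^sup>2)"
          using True by (intro ennreal_mult) auto
        then show "ennreal (2 * pi * s) * indicator {0..} s * indicator {-s..s} z *
            ennreal (indicator {..2 * R} s / s\<^sup>2) = ennreal (2 * pi * s * (1 / s\<^sup>2)) * indicator {-s..s} z"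
          using True by (simp add: mult_ac)
      qed
      also have "\<dots> = ennreal (2 * pi * s * (1 / s\<^sup>2)) * ennreal (2 * s)"
        using True by (subst nn_integral_cmult) auto
      also have "\<dots> = ennreal (2 * pi * s * (1 / s\<^sup>2) * (2 * s))"
        using True by (intro ennreal_mult[symmetric]) auto
      also have "\<dots> \<le> ennreal (4 * pi)"
        by (rule ennreal_leI) (cases "s = 0", auto simp: power2_eq_square)
      finally show ?thesis using True by simp
    qed (auto simp: indicator_def)
  qed
  also have "\<dots> = ennreal (8 * pi * R)"
    using R by (subst nn_integral_cmult) (auto simp: ennreal_mult[symmetric] mult_ac)
  finally show ?thesis .
qed

section \<open>Newtonian potentials of functions on the rectangle\<close>

definition cont_rect :: "real \<Rightarrow> (real \<Rightarrow> real \<Rightarrow> real) \<Rightarrow> bool" where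
  "cont_rect R f \<longleftrightarrow> continuous_on ({0..R} \<times> {-1..1}) (\<lambda>(r, \<zeta>). f r \<zeta>)"

text \<open>
  The representative point at which \<open>pot_K\<close> evaluates the potential.
\<close>

definition meridian :: "real \<Rightarrow> real \<Rightarrow> real ^ 3" where
  "meridian r \<zeta> = vector [r * sqrt (1 - \<zeta>\<^sup>2), 0, r * \<zeta>]"

lemma norm_vector3: "norm (vector [a, b, c] :: real ^ 3) = sqrt (a\<^sup>2 + b\<^sup>2 + c\<^sup>2)"
  by (simp add: norm_vec_def L2_set_def sum_3)

lemma norm_real3: "(norm (y :: real ^ 3))\<^sup>2 = (y $ 1)\<^sup>2 + (y $ 2)\<^sup>2 + (y $ 3)\<^sup>2"
  by (simp add: norm_vec_def L2_set_def sum_3)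

lemma vector3_eq_iff: "(x :: real ^ 3) = y \<longleftrightarrow> x $ 1 = y $ 1 \<and> x $ 2 = y $ 2 \<and> x $ 3 = y $ 3"
  by (simp add: vec_eq_iff forall_3)

lemma norm_meridian_diff:
  assumes "\<zeta> \<in> {-1..1}"
  shows "norm (meridian r \<zeta> - meridian r' \<zeta>) = \<bar>r - r'\<bar>"
proof -
  have z: "\<zeta>\<^sup>2 \<le> 1" using assms by (simp add: abs_square_le_1 abs_le_iff)
  have "(norm (meridian r \<zeta> - meridian r' \<zeta>))\<^sup>2 = ((r - r') * sqrt (1 - \<zeta>\<^sup>2))\<^sup>2 + ((r - r') * \<zeta>)\<^sup>2"
    unfolding norm_real3 by (simp add: meridian_def left_diff_distrib)
  also have "\<dots> = (r - r')\<^sup>2" using z by (simp add: power_mult_distrib flip: distrib_left)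
  finally show ?thesis by (metis abs_norm_cancel power2_eq_iff_nonneg abs_ge_zero norm_ge_zero power2_abs)
qed

lemma norm_meridian:
  assumes "\<zeta> \<in> {-1..1}" "0 \<le> r"
  shows "norm (meridian r \<zeta>) = r"
proof -
  have "meridian 0 \<zeta> = 0" by (simp add: vector3_eq_iff meridian_def)
  then show ?thesis using norm_meridian_diff[OF assms(1), of r 0] assms(2) by simp
qed

lemma axial_arg:
  assumes "y \<in> cball 0 R"
  shows "norm y \<in> {0..R}" "(y :: real ^ 3) $ 3 / norm y \<in> {-1..1}"
proof -
  show "norm y \<in> {0..R}" using assms by simp
  have "\<bar>y $ 3\<bar> \<le> norm y" by (rule component_le_norm_cart)
  then have "\<bar>y $ 3 / norm y\<bar> \<le> 1" by (cases "norm y = 0") (simp_all add: abs_divide)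
  then show "y $ 3 / norm y \<in> {-1..1}" unfolding atLeastAtMost_iff by linarith
qed

lemma borel_measurable_axial:
  assumes f: "cont_rect R f"
  shows "(\<lambda>y. indicator (cball 0 R) y * axial f y) \<in> borel_measurable borel"
proof -
  let ?A = "cball 0 R - {0} :: (real ^ 3) set"
  have "continuous_on ?A (\<lambda>y. (\<lambda>(r, \<zeta>). f r \<zeta>) (norm y, y $ 3 / norm y))"
  proof (rule continuous_on_compose2[OF f[unfolded cont_rect_def]])
    show "continuous_on ?A (\<lambda>y. (norm y, y $ 3 / norm y))"
      by (intro continuous_intros) auto
    show "(\<lambda>y. (norm y, y $ 3 / norm y)) ` ?A \<subseteq> {0..R} \<times> {-1..1}"
      using axial_arg by blast
  qed
  then have "continuous_on ?A (axial f)" by (simp add: axial_def)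
  then have m: "(\<lambda>y. indicator ?A y *\<^sub>R axial f y) \<in> borel_measurable borel"
    by (intro borel_measurable_continuous_on_indicator) auto
  define c where "c = indicator (cball 0 R) (0 :: real ^ 3) * axial f 0"
  have eq: "indicator (cball 0 R) y * axial f y = indicator ?A y *\<^sub>R axial f y + indicator {0} y * c" for y
    by (auto simp: indicator_def c_def)
  show ?thesis unfolding eq using m by measurable
qed

lemma cont_rect_bounded:
  assumes "cont_rect R f"
  obtains M where "0 \<le> M" "\<And>r \<zeta>. r \<in> {0..R} \<Longrightarrow> \<zeta> \<in> {-1..1} \<Longrightarrow> \<bar>f r \<zeta>\<bar> \<le> M"
proof -
  have "compact ((\<lambda>(r, \<zeta>). f r \<zeta>) ` ({0..R} \<times> {-1..1}))"
    using assms unfolding cont_rect_def by (intro compact_continuous_image compact_Times) auto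
  then have "bounded ((\<lambda>(r, \<zeta>). f r \<zeta>) ` ({0..R} \<times> {-1..1}))" by (rule compact_imp_bounded)
  then obtain M where M: "\<forall>x \<in> (\<lambda>(r, \<zeta>). f r \<zeta>) ` ({0..R} \<times> {-1..1}). norm x \<le> M"
    unfolding bounded_iff by blast
  have "\<bar>f r \<zeta>\<bar> \<le> max 0 M" if "r \<in> {0..R}" "\<zeta> \<in> {-1..1}" for r \<zeta>
  proof -
    have "f r \<zeta> \<in> (\<lambda>(r, \<zeta>). f r \<zeta>) ` ({0..R} \<times> {-1..1})" using that by force
    then have "norm (f r \<zeta>) \<le> M" using M by blast
    then show ?thesis by simp
  qed
  then show ?thesis by (intro that[of "max 0 M"]) auto
qed

lemma inverse_square_kernel:
  fixes x :: "real ^ 3"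
  assumes x: "norm x \<le> R"
  shows "integrable lborel (\<lambda>y. indicator (cball 0 R) y / (norm (x - y))\<^sup>2)" (is "integrable _ ?k")
    and "(\<integral>y. indicator (cball 0 R) y / (norm (x - y))\<^sup>2 \<partial>lborel) \<le> 8 * pi * R"
proof -
  have R: "0 \<le> R" using x norm_ge_zero order_trans by blast
  have "?k \<in> borel_measurable borel"
    by (intro borel_measurable_divide borel_measurable_indicator borel_measurable_continuous_onI
        continuous_intros) auto
  then have [measurable]: "?k \<in> borel_measurable lborel" by simp
  have nn: "(\<integral>\<^sup>+y. ennreal (?k y) \<partial>lborel) \<le> ennreal (8 * pi * R)"
    by (rule nn_integral_inverse_square_kernel[OF x])
  show i: "integrable lborel ?k"
    using nn by (intro integrableI_nonneg) (auto simp: indicator_def intro: le_less_trans)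
  have "ennreal (\<integral>y. ?k y \<partial>lborel) = (\<integral>\<^sup>+y. ennreal (?k y) \<partial>lborel)"
    by (rule nn_integral_eq_integral[symmetric, OF i]) (auto simp: indicator_def)
  then have "ennreal (\<integral>y. ?k y \<partial>lborel) \<le> ennreal (8 * pi * R)" using nn by (rule ord_eq_le_trans)
  moreover have "0 \<le> 8 * pi * R" using R by simp
  ultimately show "(\<integral>y. ?k y \<partial>lborel) \<le> 8 * pi * R" by (simp only: ennreal_le_iff)
qed

lemma newton_kernel:
  fixes x :: "real ^ 3"
  assumes x: "norm x \<le> R" and f: "cont_rect R f"
    and M: "\<And>r \<zeta>. r \<in> {0..R} \<Longrightarrow> \<zeta> \<in> {-1..1} \<Longrightarrow> \<bar>f r \<zeta>\<bar> \<le> M"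
  shows "integrable lborel (\<lambda>y. indicator (cball 0 R) y * (axial f y / norm (x - y)))" (is "integrable _ ?k")
    and "\<bar>\<integral>y. indicator (cball 0 R) y * (axial f y / norm (x - y)) \<partial>lborel\<bar> \<le> 4 * pi * (R ^ 3 / 3 + 2 * R) * M"
proof -
  have R: "0 \<le> R" using x norm_ge_zero order_trans by blast
  have M0: "0 \<le> M" using M[of 0 0] R by (auto intro: order_trans[OF abs_ge_zero])
  note borel_measurable_axial[OF f, measurable]
  have "(\<lambda>y. (indicator (cball 0 R) y * axial f y) / norm (x - y)) \<in> borel_measurable borel"
    by measurable
  then have km [measurable]: "?k \<in> borel_measurable lborel" by simp
  let ?g = "\<lambda>y :: real ^ 3. M * (indicator (cball 0 R) y + indicator (cball 0 R) y / (norm (x - y))\<^sup>2)"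
  have i1: "integrable lborel (\<lambda>y :: real ^ 3. indicator (cball 0 R) y :: real)"
    using emeasure_lborel_cball_finite[of "0 :: real ^ 3" R] by (simp add: integrable_indicator_iff less_top)
  have gi: "integrable lborel ?g"
    by (intro Bochner_Integration.integrable_mult_right Bochner_Integration.integrable_add
        inverse_square_kernel[OF x] i1)
  have le: "\<bar>?k y\<bar> \<le> ?g y" for y
  proof (cases "y \<in> cball 0 R")
    case True
    have "\<bar>axial f y\<bar> \<le> M" unfolding axial_def using axial_arg[OF True] by (rule M)
    moreover have "1 / t \<le> 1 + 1 / t\<^sup>2" if "0 \<le> t" for t :: real
    proof (cases "t \<le> 1")
      case True
      then have "1 / t \<le> 1 / t\<^sup>2" if "t > 0" using that \<open>0 \<le> t\<close>
        by (intro divide_left_mono) (auto simp: power2_eq_square mult_left_le)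
      then show ?thesis using \<open>0 \<le> t\<close> by (cases "t = 0") auto
    next
      case False
      then have "1 / t \<le> 1" by simp
      then show ?thesis by (rule order_trans) simp
    qed
    ultimately have "\<bar>axial f y\<bar> * (1 / norm (x - y)) \<le> M * (1 + 1 / (norm (x - y))\<^sup>2)"
      using M0 by (intro mult_mono) auto
    then show ?thesis using True by (simp add: abs_mult)
  qed simp
  show ki: "integrable lborel ?k"
    using le M0 by (intro Bochner_Integration.integrable_bound[OF gi km] AE_I2) (smt (verit) real_norm_def)
  have "\<bar>\<integral>y. ?k y \<partial>lborel\<bar> \<le> (\<integral>y. ?g y \<partial>lborel)"
    using integral_abs_bound_integral[OF ki gi] le by simp
  also have "\<dots> = M * (measure lborel (cball 0 R :: (real ^ 3) set) +
      (\<integral>y. indicator (cball 0 R) y / (norm (x - y))\<^sup>2 \<partial>lborel))"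
    using inverse_square_kernel(1)[OF x] i1 by simp
  also have "\<dots> \<le> M * (4 / 3 * pi * R ^ 3 + 8 * pi * R)"
    using M0 inverse_square_kernel(2)[OF x] R
    by (intro mult_left_mono add_mono) (simp_all add: content_cball unit_ball_vol_3)
  also have "\<dots> = 4 * pi * (R ^ 3 / 3 + 2 * R) * M" by (simp add: algebra_simps)
  finally show "\<bar>\<integral>y. ?k y \<partial>lborel\<bar> \<le> 4 * pi * (R ^ 3 / 3 + 2 * R) * M" .
qed

lemma pot_K_meridian:
  "pot_K R f r \<zeta> = 1 / (4 * pi) *
     (\<integral>y. indicator (cball 0 R) y * (axial f y / norm (meridian r \<zeta> - y)) \<partial>lborel)"
  by (simp add: pot_K_def meridian_def set_lebesgue_integral_def)

lemma pot_K_integrable: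
  assumes "cont_rect R f" "r \<in> {0..R}" "\<zeta> \<in> {-1..1}"
  shows "integrable lborel (\<lambda>y. indicator (cball 0 R) y * (axial f y / norm (meridian r \<zeta> - y)))"
proof -
  obtain M where "\<And>r \<zeta>. r \<in> {0..R} \<Longrightarrow> \<zeta> \<in> {-1..1} \<Longrightarrow> \<bar>f r \<zeta>\<bar> \<le> M"
    using cont_rect_bounded[OF assms(1)] by blast
  moreover have "norm (meridian r \<zeta>) \<le> R" using assms norm_meridian by auto
  ultimately show ?thesis using assms(1) by (intro newton_kernel(1))
qed

lemma pot_K_bound:
  assumes "cont_rect R f" "r \<in> {0..R}" "\<zeta> \<in> {-1..1}"
    and M: "\<And>r \<zeta>. r \<in> {0..R} \<Longrightarrow> \<zeta> \<in> {-1..1} \<Longrightarrow> \<bar>f r \<zeta>\<bar> \<le> M"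
  shows "\<bar>pot_K R f r \<zeta>\<bar> \<le> (R ^ 3 / 3 + 2 * R) * M"
proof -
  have "norm (meridian r \<zeta>) \<le> R" using assms norm_meridian by auto
  from newton_kernel(2)[OF this assms(1) M]
  show ?thesis by (simp add: pot_K_meridian abs_mult field_simps)
qed

lemma pot_K_add:
  assumes "cont_rect R f" "cont_rect R g" "r \<in> {0..R}" "\<zeta> \<in> {-1..1}"
  shows "pot_K R (\<lambda>s \<eta>. f s \<eta> + g s \<eta>) r \<zeta> = pot_K R f r \<zeta> + pot_K R g r \<zeta>"
proof -
  have "indicator (cball 0 R) y * (axial (\<lambda>s \<eta>. f s \<eta> + g s \<eta>) y / norm (meridian r \<zeta> - y)) =
      indicator (cball 0 R) y * (axial f y / norm (meridian r \<zeta> - y)) +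
      indicator (cball 0 R) y * (axial g y / norm (meridian r \<zeta> - y))" for y
    by (simp add: axial_def add_divide_distrib ring_distribs)
  then show ?thesis
    using pot_K_integrable[OF assms(1,3,4)] pot_K_integrable[OF assms(2,3,4)]
    by (simp add: pot_K_meridian distrib_left add_divide_distrib)
qed

lemma pot_K_scale: "pot_K R (\<lambda>s \<eta>. c * f s \<eta>) r \<zeta> = c * pot_K R f r \<zeta>"
proof -
  have *: "indicator (cball 0 R) y * (axial (\<lambda>s \<eta>. c * f s \<eta>) y / norm (meridian r \<zeta> - y)) =
      c * (indicator (cball 0 R) y * (axial f y / norm (meridian r \<zeta> - y)))" for y
    by (simp add: axial_def)
  show ?thesis unfolding pot_K_meridian * integral_mult_right_zero by (rule mult.left_commute)
qed

text \<open>
  The difference of two kernels is at most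
  \<open>|x - x'| / (|x - y| |x' - y|) \<le> |x - x'| / 2 * (1 / |x - y|\<^sup>2 + 1 / |x' - y|\<^sup>2)\<close>.
\<close>

lemma pot_K_Lipschitz:
  assumes f: "cont_rect R f" and r: "r \<in> {0..R}" "r' \<in> {0..R}" and z: "\<zeta> \<in> {-1..1}"
    and M: "\<And>r \<zeta>. r \<in> {0..R} \<Longrightarrow> \<zeta> \<in> {-1..1} \<Longrightarrow> \<bar>f r \<zeta>\<bar> \<le> M"
  shows "\<bar>pot_K R f r \<zeta> - pot_K R f r' \<zeta>\<bar> \<le> 2 * R * M * \<bar>r - r'\<bar>"
proof -
  let ?x = "meridian r \<zeta>" and ?x' = "meridian r' \<zeta>"
  let ?k = "\<lambda>x y. indicator (cball 0 R) y * (axial f y / norm (x - y))"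
  let ?q = "\<lambda>x y :: real ^ 3. indicator (cball 0 R) y / (norm (x - y))\<^sup>2 :: real"
  have x: "norm ?x \<le> R" "norm ?x' \<le> R" using r z norm_meridian by auto
  have M0: "0 \<le> M" using M[of r \<zeta>] r z by (auto intro: order_trans[OF abs_ge_zero])
  have R: "0 \<le> R" using r by auto
  have i: "integrable lborel (?k ?x)" "integrable lborel (?k ?x')"
    using pot_K_integrable[OF f _ z] r by auto
  let ?g = "\<lambda>y. M * \<bar>r - r'\<bar> / 2 * (?q ?x y + ?q ?x' y)"
  have gi: "integrable lborel ?g"
    by (intro Bochner_Integration.integrable_mult_right Bochner_Integration.integrable_add
        inverse_square_kernel x)
  have AE: "AE y in lborel. \<bar>?k ?x y - ?k ?x' y\<bar> \<le> ?g y"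
  proof -
    have "AE y in lborel. y \<noteq> ?x \<and> y \<noteq> ?x'"
      by (intro AE_conjI AE_lborel_singleton)
    then show ?thesis
    proof eventually_elim
      case (elim y)
      show ?case
      proof (cases "y \<in> cball 0 R")
        case True
        define a b where "a = norm (?x - y)" and "b = norm (?x' - y)"
        have pos: "a > 0" "b > 0" using elim by (auto simp: a_def b_def)
        have ab: "\<bar>a - b\<bar> \<le> \<bar>r - r'\<bar>"
          using norm_triangle_ineq3[of "?x - y" "?x' - y"] norm_meridian_diff[OF z, of r r']
          by (simp add: a_def b_def)
        have "\<bar>1 / a - 1 / b\<bar> = \<bar>a - b\<bar> * (1 / a * (1 / b))"
          using pos by (simp add: field_simps abs_divide abs_minus_commute flip: abs_mult_pos)
        also have "\<dots> \<le> \<bar>r - r'\<bar> * (1 / a * (1 / b))"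
          using pos ab by (intro mult_right_mono) auto
        also have "\<dots> \<le> \<bar>r - r'\<bar> * ((1 / a\<^sup>2 + 1 / b\<^sup>2) / 2)"
        proof (rule mult_left_mono)
          have "0 \<le> (1 / a - 1 / b)\<^sup>2" by simp
          then show "1 / a * (1 / b) \<le> (1 / a\<^sup>2 + 1 / b\<^sup>2) / 2"
            by (simp add: power2_diff power_divide)
        qed simp
        finally have 1: "\<bar>1 / a - 1 / b\<bar> \<le> \<bar>r - r'\<bar> * ((1 / a\<^sup>2 + 1 / b\<^sup>2) / 2)" .
        have "\<bar>axial f y\<bar> \<le> M" unfolding axial_def using axial_arg[OF True] by (rule M)
        then have "\<bar>axial f y\<bar> * \<bar>1 / a - 1 / b\<bar> \<le> M * (\<bar>r - r'\<bar> * ((1 / a\<^sup>2 + 1 / b\<^sup>2) / 2))"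
          using 1 M0 by (intro mult_mono) auto
        moreover have "?k ?x y - ?k ?x' y = axial f y * (1 / a - 1 / b)"
          using True by (simp add: a_def b_def algebra_simps)
        ultimately show ?thesis using True by (simp add: abs_mult a_def b_def mult_ac)
      qed simp
    qed
  qed
  have "\<bar>(\<integral>y. ?k ?x y \<partial>lborel) - (\<integral>y. ?k ?x' y \<partial>lborel)\<bar> = \<bar>\<integral>y. ?k ?x y - ?k ?x' y \<partial>lborel\<bar>"
    using i by simp
  also have "\<dots> \<le> (\<integral>y. \<bar>?k ?x y - ?k ?x' y\<bar> \<partial>lborel)" by (rule integral_abs_bound)
  also have "\<dots> \<le> (\<integral>y. ?g y \<partial>lborel)"
    using i by (intro integral_mono_AE gi AE) auto
  also have "\<dots> = M * \<bar>r - r'\<bar> / 2 * ((\<integral>y. ?q ?x y \<partial>lborel) + (\<integral>y. ?q ?x' y \<partial>lborel))"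
    using inverse_square_kernel(1)[OF x(1)] inverse_square_kernel(1)[OF x(2)] by simp
  also have "\<dots> \<le> M * \<bar>r - r'\<bar> / 2 * (8 * pi * R + 8 * pi * R)"
    using M0 inverse_square_kernel(2)[OF x(1)] inverse_square_kernel(2)[OF x(2)]
    by (intro mult_left_mono add_mono) auto
  finally have "\<bar>(\<integral>y. ?k ?x y \<partial>lborel) - (\<integral>y. ?k ?x' y \<partial>lborel)\<bar> \<le> 8 * pi * R * M * \<bar>r - r'\<bar>"
    by (simp add: mult_ac)
  then have "1 / (4 * pi) * \<bar>(\<integral>y. ?k ?x y \<partial>lborel) - (\<integral>y. ?k ?x' y \<partial>lborel)\<bar> \<le>
      1 / (4 * pi) * (8 * pi * R * M * \<bar>r - r'\<bar>)"
    by (intro mult_left_mono) auto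
  also have "1 / (4 * pi) * (8 * pi * R * M * \<bar>r - r'\<bar>) = 2 * R * M * \<bar>r - r'\<bar>" by simp
  also have "1 / (4 * pi) * \<bar>(\<integral>y. ?k ?x y \<partial>lborel) - (\<integral>y. ?k ?x' y \<partial>lborel)\<bar> =
      \<bar>pot_K R f r \<zeta> - pot_K R f r' \<zeta>\<bar>"
    by (simp add: pot_K_meridian abs_mult flip: right_diff_distrib diff_divide_distrib)
  finally show ?thesis .
qed

section \<open>Potentials of radial functions and of multiples of the second Legendre polynomial\<close>

lemma cont_rect_zonal:
  assumes "continuous_on {0..R} a" "continuous_on UNIV p"
  shows "cont_rect R (\<lambda>s \<eta>. a s * p \<eta>)"
  unfolding cont_rect_def case_prod_unfold
  by (intro continuous_intros continuous_on_compose2[OF assms(1)] continuous_on_compose2[OF assms(2)]) auto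

text \<open>
  On the axis the Newtonian kernel depends on \<open>|y|\<close> and \<open>y\<^sub>3\<close> only. The angular integral is left as the
  parameter \<open>k\<close>, so that the two Legendre degrees share the argument; the sphere \<open>s = r\<close>, on which
  the integrand is singular, is a null set.
\<close>

lemma pot_K_axis:
  assumes a: "continuous_on {0..R} a" and p: "continuous_on UNIV p" and r: "r \<in> {0..R}"
    and k: "\<And>s. 0 < s \<Longrightarrow> s \<noteq> r \<Longrightarrow>
      (\<integral>z. indicator {-s..s} z * (p (z / s) / sqrt (r\<^sup>2 + s\<^sup>2 - 2 * r * z)) \<partial>lborel) = 2 / s * k s"
  shows "pot_K R (\<lambda>s \<eta>. a s * p \<eta>) r 1 = (\<integral>s. indicator {0..R} s * (a s * k s) \<partial>lborel)"
proof -
  define F where "F s z = indicator {0..R} s * a s * (p (z / s) / sqrt (r\<^sup>2 + s\<^sup>2 - 2 * r * z))" for s z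
  have am: "(\<lambda>s. indicator {0..R} s * a s) \<in> borel_measurable borel"
    using borel_measurable_continuous_on_indicator[OF _ a] by simp
  have pm: "p \<in> borel_measurable borel" using p by (rule borel_measurable_continuous_onI)
  have Fm: "(\<lambda>(s, z). F s z) \<in> borel_measurable borel"
  proof -
    have "(\<lambda>x. indicator {0..R} (fst x) * a (fst x)) \<in> borel_measurable (borel \<Otimes>\<^sub>M borel)"
      using measurable_compose[OF measurable_fst am] .
    moreover have "(\<lambda>x. p (snd x / fst x)) \<in> borel_measurable (borel \<Otimes>\<^sub>M borel)"
      by (rule measurable_compose[OF _ pm]) measurable
    ultimately show ?thesis
      unfolding F_def case_prod_unfold borel_prod[symmetric]
      by (rule borel_measurable_times[OF _ borel_measurable_divide]) measurable
  qed
  have FH: "indicator (cball 0 R) y * (axial (\<lambda>s \<eta>. a s * p \<eta>) y / norm (meridian r 1 - y)) =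
      F (norm y) (y $ 3)" for y
  proof -
    have "(norm (meridian r 1 - y))\<^sup>2 = r\<^sup>2 + (norm y)\<^sup>2 - 2 * r * y $ 3"
      unfolding norm_real3 by (simp add: meridian_def power2_eq_square algebra_simps)
    then have "norm (meridian r 1 - y) = sqrt (r\<^sup>2 + (norm y)\<^sup>2 - 2 * r * y $ 3)"
      by (metis norm_ge_zero real_sqrt_unique)
    then show ?thesis by (simp add: F_def axial_def indicator_def)
  qed
  have int: "integrable lborel (\<lambda>y :: real ^ 3. F (norm y) (y $ 3))"
    using pot_K_integrable[OF cont_rect_zonal[OF a p] r, of 1] unfolding FH by simp
  let ?I = "\<lambda>s. indicator {0..} s * (2 * pi * s * (\<integral>z. indicator {-s..s} z * F s z \<partial>lborel))"
  have I: "?I s = 4 * pi * (indicator {0..R} s * (a s * k s))" if "s \<noteq> 0" "s \<noteq> r" for s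
  proof (cases "0 < s")
    case True
    have "(\<integral>z. indicator {-s..s} z * F s z \<partial>lborel) =
        (\<integral>z. (indicator {0..R} s * a s) * (indicator {-s..s} z * (p (z / s) / sqrt (r\<^sup>2 + s\<^sup>2 - 2 * r * z))) \<partial>lborel)"
      by (intro Bochner_Integration.integral_cong) (simp_all add: F_def)
    also have "\<dots> = indicator {0..R} s * a s * (2 / s * k s)"
      unfolding integral_mult_right_zero k[OF True that(2)] ..
    finally show ?thesis using True by (simp add: indicator_def)
  next
    case False
    with that show ?thesis by (simp add: indicator_def)
  qed
  have "(\<integral>y. F (norm (y :: real ^ 3)) (y $ 3) \<partial>lborel) = (\<integral>s. ?I s \<partial>lborel)"
    by (rule integral_axisymmetric(1)[OF Fm int])
  also have "\<dots> = (\<integral>s. 4 * pi * (indicator {0..R} s * (a s * k s)) \<partial>lborel)"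
    by (rule integral_discrete_difference[of "{0, r}"]) (use I in auto)
  finally show ?thesis unfolding pot_K_meridian FH by simp
qed

lemma zonal_kernel_0:
  assumes "0 \<le> r" "0 < s" "s \<noteq> r"
  shows "(\<integral>z. indicator {-s..s} z * (1 / sqrt (r\<^sup>2 + s\<^sup>2 - 2 * r * z)) \<partial>lborel) = 2 / s * (s\<^sup>2 / max r s)"
proof (cases "r = 0")
  case True
  have "(\<integral>z. indicator {-s..s} z * (1 / sqrt (r\<^sup>2 + s\<^sup>2 - 2 * r * z)) \<partial>lborel) = 2"
    using assms True by simp
  then show ?thesis using assms True by (simp add: power2_eq_square)
next
  case False
  then have r: "0 < r" using assms by simp
  have pos: "0 < r\<^sup>2 + s\<^sup>2 - 2 * r * z" if "z \<le> s" for z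
  proof -
    have "0 < (r - s)\<^sup>2" using assms by simp
    also have "\<dots> \<le> r\<^sup>2 + s\<^sup>2 - 2 * r * z" using that r by (simp add: power2_diff)
    finally show ?thesis .
  qed
  let ?G = "\<lambda>z. - (1 / r) * sqrt (r\<^sup>2 + s\<^sup>2 - 2 * r * z)"
  have "(\<integral>z. (1 / sqrt (r\<^sup>2 + s\<^sup>2 - 2 * r * z)) * indicator {-s..s} z \<partial>lborel) = ?G s - ?G (-s)"
  proof (rule integral_FTC_Icc_real)
    fix z assume z: "- s \<le> z" "z \<le> s"
    show "(?G has_real_derivative 1 / sqrt (r\<^sup>2 + s\<^sup>2 - 2 * r * z)) (at z)"
      using pos[OF z(2)] r by (auto intro!: derivative_eq_intros simp: field_simps)
    show "isCont (\<lambda>z. 1 / sqrt (r\<^sup>2 + s\<^sup>2 - 2 * r * z)) z"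
      using pos[OF z(2)] by (intro continuous_intros) auto
  qed (use assms in simp)
  also have "sqrt (r\<^sup>2 + s\<^sup>2 - 2 * r * s) = \<bar>r - s\<bar>"
    unfolding real_sqrt_abs[symmetric] by (simp add: power2_diff)
  also have "sqrt (r\<^sup>2 + s\<^sup>2 - 2 * r * (- s)) = r + s"
    using r assms by (intro real_sqrt_unique) (simp_all add: power2_sum)
  also have "- (1 / r) * \<bar>r - s\<bar> - (- (1 / r) * (r + s)) = 2 / s * (s\<^sup>2 / max r s)"
    using r assms by (auto simp: max_def field_simps power2_eq_square)
  finally show ?thesis by (simp add: mult.commute)
qed

text \<open>
  In the variable \<open>u = sqrt (r\<^sup>2 + s\<^sup>2 - 2 * r * z)\<close> the integrand becomes a polynomial of degree four
  with the primitive \<open>g\<close>.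
\<close>

lemma zonal_kernel_2:
  assumes "0 \<le> r" "0 < s" "s \<noteq> r"
  shows "(\<integral>z. indicator {-s..s} z * (P2 (z / s) / sqrt (r\<^sup>2 + s\<^sup>2 - 2 * r * z)) \<partial>lborel) =
    2 / s * (s\<^sup>2 * (min r s)\<^sup>2 / (5 * (max r s) ^ 3))"
proof (cases "r = 0")
  case True
  let ?G = "\<lambda>z. (z ^ 3 / s\<^sup>2 - z) / (2 * s)"
  have "(\<integral>z. (P2 (z / s) / sqrt (r\<^sup>2 + s\<^sup>2 - 2 * r * z)) * indicator {-s..s} z \<partial>lborel) = ?G s - ?G (-s)"
  proof (rule integral_FTC_Icc_real)
    fix z assume z: "- s \<le> z" "z \<le> s"
    show "(?G has_real_derivative P2 (z / s) / sqrt (r\<^sup>2 + s\<^sup>2 - 2 * r * z)) (at z)"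
      unfolding True using assms
      by (auto intro!: derivative_eq_intros simp: P2_def field_simps power2_eq_square)
    show "isCont (\<lambda>z. P2 (z / s) / sqrt (r\<^sup>2 + s\<^sup>2 - 2 * r * z)) z"
      unfolding True P2_def using assms by (intro continuous_intros) auto
  qed (use assms in simp)
  also have "\<dots> = 0" using assms by (simp add: power2_eq_square power3_eq_cube)
  finally show ?thesis using True assms by (simp add: mult.commute)
next
  case False
  then have r: "0 < r" using assms by simp
  define A where "A = r\<^sup>2 + s\<^sup>2"
  have pos: "0 < A - 2 * r * z" if "z \<le> s" for z
  proof -
    have "0 < (r - s)\<^sup>2" using assms by simp
    also have "\<dots> \<le> A - 2 * r * z" using that r by (simp add: power2_diff A_def)
    finally show ?thesis .
  qed
  \<comment> \<open>The expanded form of minus \<open>1 / r\<close> times the primitive of \<open>P2 ((A - u\<^sup>2) / (2 * r * s))\<close>.\<close>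
  define g where "g u = - (1 / r) * (3 / (8 * r\<^sup>2 * s\<^sup>2) * (A\<^sup>2 * u - 2 * A * u ^ 3 / 3 + u ^ 5 / 5) - u / 2)" for u
  let ?u = "\<lambda>z. sqrt (A - 2 * r * z)"
  have "(\<integral>z. (P2 (z / s) / ?u z) * indicator {-s..s} z \<partial>lborel) = g (?u s) - g (?u (-s))"
  proof (rule integral_FTC_Icc_real)
    fix z assume z: "- s \<le> z" "z \<le> s"
    have u: "0 < ?u z" "(?u z)\<^sup>2 = A - 2 * r * z" using pos[OF z(2)] by auto
    have dg: "(g has_real_derivative - (1 / r) * (3 / (8 * r\<^sup>2 * s\<^sup>2) * (A - v\<^sup>2)\<^sup>2 - 1 / 2)) (at v)" for v
      unfolding g_def
      by (rule derivative_eq_intros refl | simp)+ (simp add: field_simps power2_eq_square power4_eq_xxxx)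
    have du: "(?u has_real_derivative - (r / ?u z)) (at z)"
      using pos[OF z(2)] by (auto intro!: derivative_eq_intros simp: field_simps)
    have "((\<lambda>z. g (?u z)) has_real_derivative
        - (1 / r) * (3 / (8 * r\<^sup>2 * s\<^sup>2) * (A - (?u z)\<^sup>2)\<^sup>2 - 1 / 2) * - (r / ?u z)) (at z)"
      by (rule DERIV_chain2[OF dg du])
    also have "- (1 / r) * (3 / (8 * r\<^sup>2 * s\<^sup>2) * (A - (?u z)\<^sup>2)\<^sup>2 - 1 / 2) * - (r / ?u z) = P2 (z / s) / ?u z"
    proof -
      have "(A - (?u z)\<^sup>2)\<^sup>2 = 4 * r\<^sup>2 * z\<^sup>2" unfolding u(2) by (simp add: power_mult_distrib)
      then have "3 / (8 * r\<^sup>2 * s\<^sup>2) * (A - (?u z)\<^sup>2)\<^sup>2 - 1 / 2 = P2 (z / s)"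
        using r assms by (simp add: P2_def power_divide)
      then show ?thesis using r u by simp
    qed
    finally show "((\<lambda>z. g (?u z)) has_real_derivative P2 (z / s) / ?u z) (at z)" .
    show "isCont (\<lambda>z. P2 (z / s) / ?u z) z"
      unfolding P2_def using pos[OF z(2)] assms by (intro continuous_intros) auto
  qed (use assms in simp)
  also have "?u s = \<bar>r - s\<bar>"
    unfolding real_sqrt_abs[symmetric] by (simp add: power2_diff A_def)
  also have "?u (- s) = r + s"
    using r assms by (intro real_sqrt_unique) (simp_all add: power2_sum A_def)
  also have "g \<bar>r - s\<bar> - g (r + s) = 2 / s * (s\<^sup>2 * (min r s)\<^sup>2 / (5 * (max r s) ^ 3))"
  proof -
    have s: "0 < s" by fact
    have g: "g u = - u * (3 * (15 * A\<^sup>2 - 10 * A * u\<^sup>2 + 3 * u ^ 4) - 60 * r\<^sup>2 * s\<^sup>2) / (120 * r ^ 3 * s\<^sup>2)" for u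
      unfolding g_def using r s by (simp add: field_simps power2_eq_square power3_eq_cube power4_eq_xxxx power_numeral_reduce)
    have "g (r - s) - g (r + s) = 2 / s * (s\<^sup>2 * s\<^sup>2 / (5 * r ^ 3))"
      unfolding g A_def using r s by (simp add: divide_simps) algebra
    moreover have "g (s - r) - g (r + s) = 2 / s * (s\<^sup>2 * r\<^sup>2 / (5 * s ^ 3))"
      unfolding g A_def using r s by (simp add: divide_simps) algebra
    ultimately show ?thesis using assms by (cases "s < r") (simp_all add: min_def max_def)
  qed
  finally show ?thesis by (simp add: mult.commute A_def)
qed

text \<open>
  The rotation about the second axis that takes the point at radius \<open>r\<close> on the symmetry axis to
  \<open>meridian r \<zeta>\<close>.
\<close>

definition tilt :: "real \<Rightarrow> real ^ 3 \<Rightarrow> real ^ 3" where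
  "tilt \<zeta> y = vector [\<zeta> * y $ 1 + sqrt (1 - \<zeta>\<^sup>2) * y $ 3, y $ 2, - sqrt (1 - \<zeta>\<^sup>2) * y $ 1 + \<zeta> * y $ 3]"

lemma orthogonal_transformation_tilt:
  assumes "\<zeta> \<in> {-1..1}"
  shows "orthogonal_transformation (tilt \<zeta>)"
proof -
  have w: "(sqrt (1 - \<zeta>\<^sup>2))\<^sup>2 = 1 - \<zeta>\<^sup>2" using assms by (simp add: abs_square_le_1 abs_le_iff)
  have "linear (tilt \<zeta>)"
    by (rule linearI) (simp_all add: tilt_def vector3_eq_iff algebra_simps)
  moreover have "norm (tilt \<zeta> y) = norm y" for y
  proof -
    have "(norm (tilt \<zeta> y))\<^sup>2 = (\<zeta>\<^sup>2 + (sqrt (1 - \<zeta>\<^sup>2))\<^sup>2) * ((y $ 1)\<^sup>2 + (y $ 3)\<^sup>2) + (y $ 2)\<^sup>2"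
      unfolding norm_real3 by (simp add: tilt_def power2_eq_square algebra_simps)
    also have "\<dots> = (norm y)\<^sup>2" unfolding norm_real3 w by simp
    finally show ?thesis by simp
  qed
  ultimately show ?thesis by (simp add: orthogonal_transformation)
qed

lemma pot_K_tilt:
  assumes f: "cont_rect R f" and r: "r \<in> {0..R}" and z: "\<zeta> \<in> {-1..1}"
  defines "G \<equiv> \<lambda>y. indicator (cball 0 R) y *
      (f (norm y) ((- sqrt (1 - \<zeta>\<^sup>2) * y $ 1 + \<zeta> * y $ 3) / norm y) / norm (meridian r 1 - y))"
  shows "integrable lborel G" "pot_K R f r \<zeta> = 1 / (4 * pi) * (\<integral>y. G y \<partial>lborel)"
proof -
  let ?H = "\<lambda>y. indicator (cball 0 R) y * (axial f y / norm (meridian r \<zeta> - y))"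
  note o = orthogonal_transformation_tilt[OF z]
  have n: "norm (tilt \<zeta> y) = norm y" for y using o by (simp add: orthogonal_transformation)
  have HG: "?H (tilt \<zeta> y) = G y" for y
  proof -
    have "meridian r \<zeta> = tilt \<zeta> (meridian r 1)"
      by (simp add: meridian_def tilt_def vector3_eq_iff mult.commute)
    then have "meridian r \<zeta> - tilt \<zeta> y = tilt \<zeta> (meridian r 1 - y)"
      using orthogonal_transformation_linear[OF o] by (simp add: linear_diff)
    moreover have "tilt \<zeta> y $ 3 = - sqrt (1 - \<zeta>\<^sup>2) * y $ 1 + \<zeta> * y $ 3" by (simp add: tilt_def)
    ultimately show ?thesis by (simp add: G_def axial_def n indicator_def)
  qed
  note H = pot_K_integrable[OF f r z]
  show "integrable lborel G" "pot_K R f r \<zeta> = 1 / (4 * pi) * (\<integral>y. G y \<partial>lborel)"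
    using orthogonal_change_of_variables[OF o H] unfolding HG pot_K_meridian by simp_all
qed

lemma pot_K_radial:
  assumes a: "continuous_on {0..R} a" and r: "r \<in> {0..R}" and z: "\<zeta> \<in> {-1..1}"
  shows "pot_K R (\<lambda>s \<eta>. a s) r \<zeta> = (\<integral>s. indicator {0..R} s * (a s * (s\<^sup>2 / max r s)) \<partial>lborel)"
proof -
  have c: "cont_rect R (\<lambda>s \<eta>. a s)" using cont_rect_zonal[OF a, of "\<lambda>_. 1"] by simp
  have "pot_K R (\<lambda>s \<eta>. a s) r \<zeta> = pot_K R (\<lambda>s \<eta>. a s) r 1"
    unfolding pot_K_tilt(2)[OF c r z] unfolding pot_K_meridian axial_def ..
  also have "\<dots> = pot_K R (\<lambda>s \<eta>. a s * (\<lambda>_. 1) \<eta>) r 1" by simp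
  also have "\<dots> = (\<integral>s. indicator {0..R} s * (a s * (s\<^sup>2 / max r s)) \<partial>lborel)"
    using r by (intro pot_K_axis a zonal_kernel_0) auto
  finally show ?thesis .
qed

text \<open>
  After rotating the evaluation point onto the axis, \<open>P2\<close> is taken of a tilted coordinate. Averaging over
  the four maps generated by \<open>y\<^sub>1 \<mapsto> - y\<^sub>1\<close> and the exchange of \<open>y\<^sub>1\<close> and \<open>y\<^sub>2\<close>, which preserve the rest
  of the integrand, is enough to recover the addition theorem for a quadratic harmonic, so that only
  the factor \<open>P2 \<zeta>\<close> and the axial case remain.
\<close>

lemma pot_K_P2:
  assumes a: "continuous_on {0..R} a" and r: "r \<in> {0..R}" and z: "\<zeta> \<in> {-1..1}"
  shows "pot_K R (\<lambda>s \<eta>. a s * P2 \<eta>) r \<zeta> =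
    P2 \<zeta> * (\<integral>s. indicator {0..R} s * (a s * (s\<^sup>2 * (min r s)\<^sup>2 / (5 * (max r s) ^ 3))) \<partial>lborel)"
proof -
  have P: "continuous_on UNIV P2" unfolding P2_def by (intro continuous_intros)
  let ?f = "\<lambda>s \<eta>. a s * P2 \<eta>"
  have c: "cont_rect R ?f" by (rule cont_rect_zonal[OF a P])
  define w where "w = sqrt (1 - \<zeta>\<^sup>2)"
  have w: "w\<^sup>2 = 1 - \<zeta>\<^sup>2" using z by (simp add: w_def abs_square_le_1 abs_le_iff)
  define G where "G y = indicator (cball 0 R) y *
      (?f (norm y) ((- w * y $ 1 + \<zeta> * y $ 3) / norm y) / norm (meridian r 1 - y))" for y
  have Gi: "integrable lborel G" and Gp: "pot_K R ?f r \<zeta> = 1 / (4 * pi) * (\<integral>y. G y \<partial>lborel)"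
    using pot_K_tilt[OF c r z] unfolding G_def w_def by auto
  define N T :: "real ^ 3 \<Rightarrow> real ^ 3" where "N y = vector [- y $ 1, y $ 2, y $ 3]"
    and "T y = vector [y $ 2, y $ 1, y $ 3]" for y
  have oN: "orthogonal_transformation N" and oT: "orthogonal_transformation T"
    unfolding orthogonal_transformation N_def T_def
    by (auto intro!: linearI simp: vector3_eq_iff norm_vector3)
      (auto simp: norm_vec_def L2_set_def sum_3 add_ac)
  have oNT: "orthogonal_transformation (\<lambda>y. N (T y))"
    using orthogonal_transformation_compose[OF oN oT] by (simp add: o_def)
  have nN: "norm (N y) = norm y" and nT: "norm (T y) = norm y" for y
    using oN oT by (simp_all add: orthogonal_transformation)
  note iN = orthogonal_change_of_variables[OF oN Gi]
  note iT = orthogonal_change_of_variables[OF oT Gi]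
  note iNT = orthogonal_change_of_variables[OF oNT Gi]
  have ci: "indicator (cball 0 R) (N y) = (indicator (cball 0 R) y :: real)"
    "indicator (cball 0 R) (T y) = (indicator (cball 0 R) y :: real)" for y
    by (simp_all add: indicator_def nN nT)
  have comps: "N y $ 1 = - y $ 1" "N y $ 3 = y $ 3" "T y $ 1 = y $ 2" "T y $ 3 = y $ 3" for y
    by (simp_all add: N_def T_def)
  let ?H = "\<lambda>y. indicator (cball 0 R) y * (axial ?f y / norm (meridian r 1 - y))"
  have nm: "norm (meridian r 1 - N y) = norm (meridian r 1 - y)" "norm (meridian r 1 - T y) = norm (meridian r 1 - y)" for y
    by (simp_all add: norm_vec_def L2_set_def sum_3 meridian_def N_def T_def)
  have sum: "G y + G (N y) + G (T y) + G (N (T y)) = 4 * P2 \<zeta> * ?H y" if "y \<noteq> 0" for y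
  proof -
    define n where "n = norm y"
    have n: "n \<noteq> 0" "n\<^sup>2 = (y $ 1)\<^sup>2 + (y $ 2)\<^sup>2 + (y $ 3)\<^sup>2"
      using that by (auto simp: n_def norm_real3)
    have "P2 ((- w * y $ 1 + \<zeta> * y $ 3) / n) + P2 ((w * y $ 1 + \<zeta> * y $ 3) / n) +
        P2 ((- w * y $ 2 + \<zeta> * y $ 3) / n) + P2 ((w * y $ 2 + \<zeta> * y $ 3) / n) =
        (3 / 2 * (2 * w\<^sup>2 * ((y $ 1)\<^sup>2 + (y $ 2)\<^sup>2) + 4 * \<zeta>\<^sup>2 * (y $ 3)\<^sup>2) - 2 * n\<^sup>2) / n\<^sup>2"
      using n(1) unfolding P2_def by (simp add: field_simps power2_eq_square)
    also have "(y $ 1)\<^sup>2 + (y $ 2)\<^sup>2 = n\<^sup>2 - (y $ 3)\<^sup>2" unfolding n(2) by simp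
    also have "(3 / 2 * (2 * w\<^sup>2 * (n\<^sup>2 - (y $ 3)\<^sup>2) + 4 * \<zeta>\<^sup>2 * (y $ 3)\<^sup>2) - 2 * n\<^sup>2) / n\<^sup>2 =
        4 * P2 \<zeta> * P2 (y $ 3 / n)"
      using n(1) unfolding P2_def w by (simp add: field_simps power2_eq_square)
    finally have P: "P2 ((- w * y $ 1 + \<zeta> * y $ 3) / n) + P2 ((w * y $ 1 + \<zeta> * y $ 3) / n) +
        P2 ((- w * y $ 2 + \<zeta> * y $ 3) / n) + P2 ((w * y $ 2 + \<zeta> * y $ 3) / n) =
        4 * P2 \<zeta> * P2 (y $ 3 / n)" .
    define q where "q = indicator (cball 0 R) y * a n / norm (meridian r 1 - y)"
    have "G y = q * P2 ((- w * y $ 1 + \<zeta> * y $ 3) / n)"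
      "G (N y) = q * P2 ((w * y $ 1 + \<zeta> * y $ 3) / n)"
      "G (T y) = q * P2 ((- w * y $ 2 + \<zeta> * y $ 3) / n)"
      "G (N (T y)) = q * P2 ((w * y $ 2 + \<zeta> * y $ 3) / n)"
      unfolding G_def ci nN nT nm q_def n_def by (simp_all add: comps)
    then have "G y + G (N y) + G (T y) + G (N (T y)) = q * (4 * P2 \<zeta> * P2 (y $ 3 / n))"
      unfolding P[symmetric] by (simp only: distrib_left)
    then show ?thesis by (simp add: q_def axial_def n_def)
  qed
  have "4 * (\<integral>y. G y \<partial>lborel) = (\<integral>y. G y + G (N y) + G (T y) + G (N (T y)) \<partial>lborel)"
    using iN iT iNT Gi by simp
  also have "\<dots> = (\<integral>y. 4 * P2 \<zeta> * ?H y \<partial>lborel)"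
  proof (rule integral_cong_AE)
    have "AE y in lborel. y \<noteq> (0 :: real ^ 3)" by (rule AE_lborel_singleton)
    then show "AE y in lborel. G y + G (N y) + G (T y) + G (N (T y)) = 4 * P2 \<zeta> * ?H y"
      by eventually_elim (rule sum)
    show "(\<lambda>y. G y + G (N y) + G (T y) + G (N (T y))) \<in> borel_measurable lborel"
      using iN(1) iT(1) iNT(1) Gi by (intro borel_measurable_integrable Bochner_Integration.integrable_add)
    show "(\<lambda>y. 4 * P2 \<zeta> * ?H y) \<in> borel_measurable lborel"
      using pot_K_integrable[OF c r, of 1]
      by (intro borel_measurable_integrable Bochner_Integration.integrable_mult_right) simp
  qed
  also have "\<dots> = 4 * P2 \<zeta> * (\<integral>y. ?H y \<partial>lborel)" by (rule integral_mult_right_zero)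
  finally have "(\<integral>y. G y \<partial>lborel) = P2 \<zeta> * (\<integral>y. ?H y \<partial>lborel)" by simp
  then have "pot_K R ?f r \<zeta> = P2 \<zeta> * pot_K R ?f r 1"
    unfolding Gp by (simp add: pot_K_meridian)
  also have "pot_K R ?f r 1 = (\<integral>s. indicator {0..R} s * (a s * (s\<^sup>2 * (min r s)\<^sup>2 / (5 * (max r s) ^ 3))) \<partial>lborel)"
    using r by (intro pot_K_axis a P zonal_kernel_2) auto
  finally show ?thesis .
qed

section \<open>The Lane--Emden profile\<close>

lemma mvt_bound:
  fixes f :: "real \<Rightarrow> real"
  assumes f: "continuous_on {a..b} f"
    and d: "\<And>t. a < t \<Longrightarrow> t < b \<Longrightarrow> (f has_real_derivative f' t) (at t)"
    and B: "\<And>t. a < t \<Longrightarrow> t < b \<Longrightarrow> \<bar>f' t\<bar> \<le> B"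
    and x: "x \<in> {a..b}" and y: "y \<in> {a..b}"
  shows "\<bar>f x - f y\<bar> \<le> B * \<bar>x - y\<bar>"
proof -
  have *: "\<bar>f v - f u\<bar> \<le> B * \<bar>v - u\<bar>" if uv: "a \<le> u" "u < v" "v \<le> b" for u v
  proof -
    obtain t where t: "u < t" "t < v" "f v - f u = (\<lambda>h. f' t * h) (v - u)"
    proof (rule mvt[of u v f "\<lambda>t h. f' t * h"])
      show "continuous_on {u..v} f" by (rule continuous_on_subset[OF f]) (use uv in auto)
      show "(f has_derivative (\<lambda>h. f' x * h)) (at x)" if "u < x" "x < v" for x
        using d[of x] that uv by (simp add: has_field_derivative_def)
    qed (use uv in auto)
    then show ?thesis using B[of t] uv by (simp add: abs_mult mult_right_mono)
  qed
  consider "x < y" | "x = y" | "y < x" by linarith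
  then show ?thesis
    using *[of x y] *[of y x] x y by cases (auto simp: abs_minus_commute)
qed

lemma integral_Icc_lborel:
  fixes f :: "real \<Rightarrow> real"
  assumes "continuous_on {a..b} f"
  shows "(\<integral>s. indicator {a..b} s * f s \<partial>lborel) = integral {a..b} f"
  using set_borel_integral_eq_integral(2)[OF borel_integrable_atLeastAtMost'[OF assms]]
  by (simp add: set_lebesgue_integral_def)

lemma continuous_on_kernel_0:
  assumes "0 \<le> r" shows "continuous_on {0..R} (\<lambda>s::real. s\<^sup>2 / max r s)"
proof (cases "r = 0")
  case True
  have "continuous_on {0..R} (\<lambda>s::real. s)" by (rule continuous_on_id)
  then show ?thesis
    by (rule continuous_on_eq) (simp add: True power2_eq_square max_def)
next
  case False
  then show ?thesis using assms by (intro continuous_intros) (auto simp: max_def)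
qed

text \<open>
  Subtracting the value at the origin cancels the contribution of the shells outside radius \<open>r\<close>.
\<close>

lemma pot_K_radial_difference:
  assumes a: "continuous_on {0..R} a" and r: "0 < r" "r \<le> R" and z: "\<zeta> \<in> {-1..1}"
  shows "pot_K R (\<lambda>s \<eta>. a s) r \<zeta> - pot_K R (\<lambda>s \<eta>. a s) 0 0 =
    integral {0..r} (\<lambda>s. a s * s\<^sup>2) / r - integral {0..r} (\<lambda>s. a s * s)"
proof -
  have c: "continuous_on {0..R} (\<lambda>s. a s * (s\<^sup>2 / max t s))" if "0 \<le> t" for t
    by (intro continuous_on_mult a continuous_on_kernel_0 that)
  have i: "(\<lambda>s. a s * (s\<^sup>2 / max t s)) integrable_on {0..R}" if "0 \<le> t" for t
    using c[OF that] by (rule integrable_continuous_real)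
  have a': "continuous_on {0..r} a" using a r by (auto intro: continuous_on_subset)
  have i1: "(\<lambda>s. a s * s\<^sup>2) integrable_on {0..r}" "(\<lambda>s. a s * s) integrable_on {0..r}"
    by (intro integrable_continuous_real continuous_intros a')+
  have "pot_K R (\<lambda>s \<eta>. a s) r \<zeta> - pot_K R (\<lambda>s \<eta>. a s) 0 0 =
      integral {0..R} (\<lambda>s. a s * (s\<^sup>2 / max r s)) - integral {0..R} (\<lambda>s. a s * (s\<^sup>2 / max 0 s))"
  proof -
    have "pot_K R (\<lambda>s \<eta>. a s) r \<zeta> = integral {0..R} (\<lambda>s. a s * (s\<^sup>2 / max r s))"
      using pot_K_radial[OF a _ z, of r] integral_Icc_lborel[OF c, of r] r by simp
    moreover have "pot_K R (\<lambda>s \<eta>. a s) 0 0 = integral {0..R} (\<lambda>s. a s * (s\<^sup>2 / max 0 s))"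
      using pot_K_radial[OF a, of 0 0] integral_Icc_lborel[OF c, of 0] r by simp
    ultimately show ?thesis by simp
  qed
  also have "\<dots> = integral {0..R} (\<lambda>s. a s * (s\<^sup>2 / max r s) - a s * (s\<^sup>2 / max 0 s))"
    using i r by (simp add: integral_diff)
  also have "\<dots> = integral {0..r} (\<lambda>s. a s * (s\<^sup>2 / max r s) - a s * (s\<^sup>2 / max 0 s)) +
      integral {r..R} (\<lambda>s. a s * (s\<^sup>2 / max r s) - a s * (s\<^sup>2 / max 0 s))"
    by (rule Henstock_Kurzweil_Integration.integral_combine[symmetric]) (use i r in \<open>auto intro: integrable_diff\<close>)
  also have "integral {r..R} (\<lambda>s. a s * (s\<^sup>2 / max r s) - a s * (s\<^sup>2 / max 0 s)) = integral {r..R} (\<lambda>s. 0)"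
    using r by (intro integral_cong) (auto simp: max_def)
  also have "integral {0..r} (\<lambda>s. a s * (s\<^sup>2 / max r s) - a s * (s\<^sup>2 / max 0 s)) =
      integral {0..r} (\<lambda>s. a s * s\<^sup>2 * (1 / r) - a s * s)"
    using r by (intro integral_cong) (auto simp: max_def power2_eq_square)
  also have "\<dots> = integral {0..r} (\<lambda>s. a s * s\<^sup>2) * (1 / r) - integral {0..r} (\<lambda>s. a s * s)"
    unfolding integral_mult_left[symmetric] using i1(2)
    by (intro integral_diff integrable_continuous_real continuous_intros a') (use r in auto)
  finally show ?thesis by simp
qed

locale lane_emden_profile =
  fixes \<nu> R \<xi> :: real and \<theta> :: "real \<Rightarrow> real"
  assumes nu: "1 < \<nu>" and R: "\<xi> < R" and theta: "lane_emden \<nu> \<theta> \<xi>"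
begin

definition source :: "real \<Rightarrow> real" where "source s = max (\<theta> s) 0 powr \<nu>"

definition mass :: "real \<Rightarrow> real" where "mass r = integral {0..r} (\<lambda>s. source s * s\<^sup>2)"

definition slope :: "real \<Rightarrow> real" where "slope r = mass r / r\<^sup>2"

definition mu :: real where "mu = lane_emden_mass \<nu> \<theta> \<xi>"

lemma xi_pos: "0 < \<xi>" and theta_cont_inside: "continuous_on {0..\<xi>} \<theta>"
  and theta_pos: "0 \<le> r \<Longrightarrow> r < \<xi> \<Longrightarrow> 0 < \<theta> r" and theta_xi: "\<theta> \<xi> = 0"
  and theta_outside: "\<xi> \<le> r \<Longrightarrow> \<theta> r = - mu * (1 / \<xi> - 1 / r)"
  using theta by (auto simp: lane_emden_def mu_def)

lemma R_pos: "0 < R" using xi_pos R by simp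

lemma theta_0: "\<theta> 0 = 1"
proof -
  have "(\<lambda>r. \<theta> r - 1) \<in> O[at_right 0](\<lambda>r. r\<^sup>2)" using theta by (simp add: lane_emden_def)
  then obtain c where "\<forall>\<^sub>F r in at_right 0. norm (\<theta> r - 1) \<le> c * norm (r\<^sup>2)"
    by (elim landau_o.bigE)
  moreover have "((\<lambda>r::real. c * norm (r\<^sup>2)) \<longlongrightarrow> 0) (at_right 0)" by (auto intro!: tendsto_eq_intros)
  ultimately have "((\<lambda>r. \<theta> r - 1) \<longlongrightarrow> 0) (at_right 0)" by (rule Lim_null_comparison)
  then have 1: "(\<theta> \<longlongrightarrow> 1) (at_right 0)" by (simp add: LIM_zero_iff)
  have "(\<theta> \<longlongrightarrow> \<theta> 0) (at 0 within {0..\<xi>})"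
    using theta_cont_inside xi_pos by (simp add: continuous_on)
  then have "(\<theta> \<longlongrightarrow> \<theta> 0) (at_right 0)"
    using at_within_Icc_at_right[OF xi_pos] by simp
  with 1 show ?thesis using tendsto_unique[of "at_right (0::real)" \<theta> 1 "\<theta> 0"] by simp
qed

lemma theta_cont: "continuous_on {0..R} \<theta>"
proof -
  have "continuous_on {\<xi>..R} (\<lambda>r. - mu * (1 / \<xi> - 1 / r))"
    using xi_pos by (intro continuous_intros) auto
  then have "continuous_on {\<xi>..R} \<theta>" by (rule continuous_on_eq) (simp add: theta_outside)
  then have "continuous_on ({0..\<xi>} \<union> {\<xi>..R}) \<theta>"
    by (intro continuous_on_closed_Un theta_cont_inside) auto
  then show ?thesis using xi_pos R by (simp add: ivl_disj_un)
qed

lemma source_cont: "continuous_on {0..R} source"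
  unfolding source_def using nu
  by (intro continuous_on_powr' continuous_intros theta_cont) auto

lemma source_nonneg: "0 \<le> source s" by (simp add: source_def)

lemma source_moment_cont: "r \<le> R \<Longrightarrow> continuous_on {0..r} (\<lambda>s. source s * s ^ n)"
  by (intro continuous_intros continuous_on_subset[OF source_cont]) auto

lemma mass_deriv: "0 < r \<Longrightarrow> r < R \<Longrightarrow> (mass has_real_derivative source r * r\<^sup>2) (at r)"
  using integral_has_real_derivative[OF source_moment_cont[of R 2], of r]
  by (simp add: mass_def[abs_def] at_within_Icc_at)

lemma mass_cont: "continuous_on {0..R} mass"
  unfolding mass_def[abs_def]
  by (intro indefinite_integral_continuous_1 integrable_continuous_real source_moment_cont order_refl)

lemma mass_nonneg: "r \<le> R \<Longrightarrow> 0 \<le> mass r"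
  unfolding mass_def by (intro integral_nonneg integrable_continuous_real source_moment_cont) (auto simp: source_nonneg)

lemma mass_mono: assumes "0 \<le> r" "r \<le> s" "s \<le> R" shows "mass r \<le> mass s"
  unfolding mass_def using assms
  by (intro integral_subset_le integrable_continuous_real source_moment_cont) (auto simp: source_nonneg)

lemma mass_0 [simp]: "mass 0 = 0" by (simp add: mass_def)

lemma source_bounded: obtains M where "0 < M" "\<And>s. s \<in> {0..R} \<Longrightarrow> source s \<le> M"
proof -
  have "bounded (source ` {0..R})"
    using source_cont by (intro compact_imp_bounded compact_continuous_image) auto
  then obtain M where "0 < M" "\<And>s. s \<in> {0..R} \<Longrightarrow> \<bar>source s\<bar> \<le> M"
    unfolding bounded_pos by auto
  then show ?thesis by (intro that[of M]) (auto simp: abs_le_iff)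
qed

lemma mass_le: obtains M where "0 < M" "\<And>r. r \<in> {0..R} \<Longrightarrow> mass r \<le> M * r ^ 3"
proof -
  obtain M where M: "0 < M" "\<And>s. s \<in> {0..R} \<Longrightarrow> source s \<le> M" using source_bounded by metis
  have "mass r \<le> M * r ^ 3" if r: "r \<in> {0..R}" for r
  proof -
    have "mass r \<le> integral {0..r} (\<lambda>s. M * r\<^sup>2)"
      unfolding mass_def using r M source_nonneg
      by (intro integral_le integrable_continuous_real source_moment_cont mult_mono power_mono continuous_intros) auto
    also have "\<dots> = M * r ^ 3" using r by (simp add: power3_eq_cube power2_eq_square)
    finally show ?thesis .
  qed
  with M show ?thesis using that by blast
qed

lemma source_inside: "s \<in> {0..\<xi>} \<Longrightarrow> source s = \<theta> s powr \<nu>"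
  using theta_pos[of s] theta_xi by (cases "s = \<xi>") (auto simp: source_def max_def)

lemma mu_eq: "mu = mass \<xi>"
  unfolding mu_def lane_emden_mass_def mass_def by (intro integral_cong) (simp add: source_inside)

lemma mu_nonneg: "0 \<le> mu" using mass_nonneg[of \<xi>] R by (simp add: mu_eq)

lemma theta_outside_nonpos: assumes "\<xi> \<le> r" shows "\<theta> r \<le> 0"
proof -
  have "1 / r \<le> 1 / \<xi>" using assms xi_pos by (intro divide_left_mono) auto
  then show ?thesis using theta_outside[OF assms] mu_nonneg by (simp add: mult_nonneg_nonneg)
qed

lemma source_outside: "\<xi> \<le> r \<Longrightarrow> source r = 0"
  using theta_outside_nonpos[of r] by (simp add: source_def max_def)

lemma integral_source_outside:
  assumes "\<xi> \<le> r" "r \<le> R" shows "integral {0..r} (\<lambda>s. source s * s ^ n) = integral {0..\<xi>} (\<lambda>s. source s * s ^ n)"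
proof -
  have "integral {0..r} (\<lambda>s. source s * s ^ n) =
      integral {0..\<xi>} (\<lambda>s. source s * s ^ n) + integral {\<xi>..r} (\<lambda>s. source s * s ^ n)"
    by (rule Henstock_Kurzweil_Integration.integral_combine[symmetric])
      (use assms xi_pos in \<open>auto intro: integrable_continuous_real source_moment_cont\<close>)
  also have "integral {\<xi>..r} (\<lambda>s. source s * s ^ n) = integral {\<xi>..r} (\<lambda>s. 0)"
    by (intro integral_cong) (simp add: source_outside)
  finally show ?thesis by simp
qed

lemma mass_outside: "\<xi> \<le> r \<Longrightarrow> r \<le> R \<Longrightarrow> mass r = mu"
  unfolding mu_eq unfolding mass_def by (rule integral_source_outside)

text \<open>
  The value of \<open>op_G\<close> at a radial profile, by \<open>pot_K_radial_difference\<close>.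
\<close>

definition potential :: "real \<Rightarrow> real" where
  "potential r = 1 + mass r / r - integral {0..r} (\<lambda>s. source s * s)"

lemma potential_deriv:
  assumes "0 < r" "r < R" shows "(potential has_real_derivative - slope r) (at r)"
proof -
  have i: "((\<lambda>r. integral {0..r} (\<lambda>s. source s * s)) has_real_derivative source r * r) (at r)"
    using integral_has_real_derivative[OF source_moment_cont[of R 1], of r] assms
    by (simp add: at_within_Icc_at)
  have "(potential has_real_derivative
      (source r * r\<^sup>2 * r - mass r * 1) / (r * r) - source r * r) (at r)"
    unfolding potential_def[abs_def] using assms
    by (auto intro!: derivative_eq_intros mass_deriv i)
  also have "(source r * r\<^sup>2 * r - mass r * 1) / (r * r) - source r * r = - slope r"
    using assms by (simp add: slope_def field_simps power2_eq_square)
  finally show ?thesis .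
qed

lemma mass_div_tendsto: "((\<lambda>r. mass r / r) \<longlongrightarrow> 0) (at_right 0)"
proof -
  obtain M where M: "0 < M" "\<And>r. r \<in> {0..R} \<Longrightarrow> mass r \<le> M * r ^ 3" using mass_le by metis
  show ?thesis
  proof (rule Lim_null_comparison)
    show "((\<lambda>r. M * r\<^sup>2) \<longlongrightarrow> 0) (at_right 0)" by (auto intro!: tendsto_eq_intros)
    have "\<forall>\<^sub>F r in at_right 0. r \<in> {0<..<R}" using R_pos eventually_at_right_real by blast
    then show "\<forall>\<^sub>F r in at_right 0. norm (mass r / r) \<le> M * r\<^sup>2"
    proof eventually_elim
      case (elim r)
      then have "mass r / r \<le> M * r ^ 3 / r" using M(2)[of r] by (intro divide_right_mono) auto
      then show ?case using elim mass_nonneg[of r] by (simp add: power2_eq_square power3_eq_cube)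
    qed
  qed
qed

lemma tendsto_integral_0:
  "((\<lambda>r. integral {0..r} (\<lambda>s. source s * s)) \<longlongrightarrow> 0) (at_right 0)"
proof -
  have "continuous_on {0..R} (\<lambda>r. integral {0..r} (\<lambda>s. source s * s ^ 1))"
    by (intro indefinite_integral_continuous_1 integrable_continuous_real source_moment_cont order_refl)
  then have "((\<lambda>r. integral {0..r} (\<lambda>s. source s * s ^ 1)) \<longlongrightarrow> integral {0..0} (\<lambda>s. source s * s ^ 1)) (at 0 within {0..R})"
    using R_pos unfolding continuous_on by (intro bspec[of _ _ 0]) auto
  then show ?thesis using at_within_Icc_at_right[OF R_pos] by simp
qed

lemma potential_tendsto: "(potential \<longlongrightarrow> 1) (at_right 0)"
  unfolding potential_def[abs_def]
  using tendsto_diff[OF tendsto_add[OF tendsto_const mass_div_tendsto] tendsto_integral_0, of 1] by simp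

lemma potential_cont: "continuous_on {0<..R} potential"
proof -
  have "continuous_on {0..R} (\<lambda>r. integral {0..r} (\<lambda>s. source s * s ^ 1))"
    by (intro indefinite_integral_continuous_1 integrable_continuous_real source_moment_cont order_refl)
  then have 1: "continuous_on {0<..R} (\<lambda>r. integral {0..r} (\<lambda>s. source s * s))"
    by (auto intro: continuous_on_subset)
  show ?thesis unfolding potential_def[abs_def]
    by (intro continuous_intros 1 continuous_on_subset[OF mass_cont]) auto
qed

lemma theta_tendsto: "(\<theta> \<longlongrightarrow> 1) (at_right 0)"
proof -
  have "(\<theta> \<longlongrightarrow> \<theta> 0) (at 0 within {0..R})"
    using theta_cont R_pos by (simp add: continuous_on)
  then show ?thesis using at_within_Icc_at_right[OF R_pos] theta_0 by simp
qed

text \<open>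
  Both sides satisfy the same equation, so they differ by \<open>d - c / r\<close>; boundedness at the origin
  forces \<open>c = 0\<close>, and the common value 1 there forces \<open>d = 0\<close>.
\<close>

lemma theta_eq_potential_inside:
  assumes r: "0 < r" "r < \<xi>" shows "\<theta> r = potential r"
proof -
  have ode: "\<theta> differentiable (at s)" "((\<lambda>s. s\<^sup>2 * deriv \<theta> s) has_real_derivative - (source s * s\<^sup>2)) (at s)"
    if s: "0 < s" "s < \<xi>" for s
  proof -
    have d: "(\<lambda>s. s\<^sup>2 * deriv \<theta> s) differentiable (at s)"
      and e: "- (1 / s\<^sup>2) * deriv (\<lambda>s. s\<^sup>2 * deriv \<theta> s) s = \<theta> s powr \<nu>"
      using theta s by (auto simp: lane_emden_def)
    show "\<theta> differentiable (at s)" using theta s by (auto simp: lane_emden_def)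
    have "deriv (\<lambda>s. s\<^sup>2 * deriv \<theta> s) s = - (source s * s\<^sup>2)"
      using e s source_inside[of s] by (simp add: field_simps)
    then show "((\<lambda>s. s\<^sup>2 * deriv \<theta> s) has_real_derivative - (source s * s\<^sup>2)) (at s)"
      using DERIV_deriv_iff_real_differentiable[THEN iffD2, OF d] by (simp only:)
  qed
  have conv: "convex {0<..<\<xi>}" by simp
  have "\<exists>c. \<forall>s\<in>{0<..<\<xi>}. s\<^sup>2 * deriv \<theta> s + mass s = c"
  proof (rule has_field_derivative_zero_constant[OF conv])
    fix s assume s: "s \<in> {0<..<\<xi>}"
    have "((\<lambda>s. s\<^sup>2 * deriv \<theta> s + mass s) has_real_derivative - (source s * s\<^sup>2) + source s * s\<^sup>2) (at s)"
      using s R by (intro derivative_intros ode mass_deriv) auto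
    then show "((\<lambda>s. s\<^sup>2 * deriv \<theta> s + mass s) has_field_derivative 0) (at s within {0<..<\<xi>})"
      by (simp add: has_field_derivative_at_within)
  qed
  then obtain c where c: "\<And>s. 0 < s \<Longrightarrow> s < \<xi> \<Longrightarrow> s\<^sup>2 * deriv \<theta> s + mass s = c" by auto
  have "\<exists>d. \<forall>s\<in>{0<..<\<xi>}. \<theta> s - potential s + c / s = d"
  proof (rule has_field_derivative_zero_constant[OF conv])
    fix s assume s: "s \<in> {0<..<\<xi>}"
    have t: "(\<theta> has_real_derivative deriv \<theta> s) (at s)"
      using ode(1)[of s] s by (simp add: DERIV_deriv_iff_real_differentiable)
    have "((\<lambda>s. \<theta> s - potential s + c / s) has_real_derivative deriv \<theta> s - - slope s + - (c / s\<^sup>2)) (at s)"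
      using s R by (auto intro!: derivative_eq_intros t potential_deriv simp: power2_eq_square)
    moreover have "deriv \<theta> s - - slope s + - (c / s\<^sup>2) = 0"
      using c[of s] s by (simp add: slope_def field_simps)
    ultimately show "((\<lambda>s. \<theta> s - potential s + c / s) has_field_derivative 0) (at s within {0<..<\<xi>})"
      by (simp add: has_field_derivative_at_within)
  qed
  then obtain d where d: "\<And>s. 0 < s \<Longrightarrow> s < \<xi> \<Longrightarrow> \<theta> s - potential s + c / s = d" by auto
  have near: "\<forall>\<^sub>F s in at_right 0. s \<in> {0<..<\<xi>}" using xi_pos eventually_at_right_real by blast
  have c0: "c = 0"
  proof -
    have "((\<lambda>s. s * d - s * (\<theta> s - potential s)) \<longlongrightarrow> 0 * d - 0 * (1 - 1)) (at_right 0)"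
      by (intro tendsto_intros theta_tendsto potential_tendsto)
    moreover have "\<forall>\<^sub>F s in at_right 0. s * d - s * (\<theta> s - potential s) = c"
      using near by eventually_elim (use d in \<open>force simp: field_simps\<close>)
    ultimately have "((\<lambda>s::real. c) \<longlongrightarrow> 0 * d - 0 * (1 - 1)) (at_right 0)"
      by (rule Lim_transform_eventually)
    then show ?thesis by (simp add: tendsto_const_iff)
  qed
  have "d = 0"
  proof -
    have "((\<lambda>s. \<theta> s - potential s) \<longlongrightarrow> 1 - 1) (at_right 0)"
      by (intro tendsto_intros theta_tendsto potential_tendsto)
    moreover have "\<forall>\<^sub>F s in at_right 0. \<theta> s - potential s = d"
      using near by eventually_elim (use d c0 in force)
    ultimately have "((\<lambda>s::real. d) \<longlongrightarrow> 1 - 1) (at_right 0)"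
      by (rule Lim_transform_eventually)
    then show ?thesis by (simp add: tendsto_const_iff)
  qed
  then show ?thesis using d[OF r] c0 by simp
qed

lemma theta_eq_potential:
  assumes r: "0 < r" "r \<le> R" shows "\<theta> r = potential r"
proof -
  have c: "continuous_on {\<xi> / 2..\<xi>} (\<lambda>s. \<theta> s - potential s)"
    using R xi_pos by (intro continuous_intros continuous_on_subset[OF theta_cont] continuous_on_subset[OF potential_cont]) auto
  have xi: "potential \<xi> = 0"
  proof -
    have "((\<lambda>s. \<theta> s - potential s) \<longlongrightarrow> \<theta> \<xi> - potential \<xi>) (at \<xi> within {\<xi> / 2..\<xi>})"
      using c xi_pos by (simp add: continuous_on)
    then have "((\<lambda>s. \<theta> s - potential s) \<longlongrightarrow> \<theta> \<xi> - potential \<xi>) (at_left \<xi>)"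
      using xi_pos by (simp add: at_within_Icc_at_left)
    moreover have "\<forall>\<^sub>F s in at_left \<xi>. \<theta> s - potential s = 0"
      using eventually_at_left_real[OF xi_pos] by eventually_elim (simp add: theta_eq_potential_inside)
    ultimately have "((\<lambda>s::real. 0) \<longlongrightarrow> \<theta> \<xi> - potential \<xi>) (at_left \<xi>)"
      by (rule Lim_transform_eventually)
    then show ?thesis using theta_xi by (simp add: tendsto_const_iff)
  qed
  show ?thesis
  proof (cases "r < \<xi>")
    case True
    then show ?thesis using r by (intro theta_eq_potential_inside)
  next
    case False
    have "integral {0..r} (\<lambda>s. source s * s) = integral {0..\<xi>} (\<lambda>s. source s * s)"
      using integral_source_outside[of r 1] False r by simp
    then have "potential r - potential \<xi> = mu / r - mu / \<xi>"
      using False r R by (simp add: potential_def mass_outside)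
    then show ?thesis using xi theta_outside[of r] False by (simp add: algebra_simps)
  qed
qed

lemma theta_fixed_point:
  assumes "r \<in> {0..R}" "\<zeta> \<in> {-1..1}" shows "op_G \<nu> R (\<lambda>r \<zeta>. \<theta> r) r \<zeta> = \<theta> r"
proof (cases "r = 0")
  case True
  have "pot_K R (\<lambda>s \<eta>. source s) 0 \<zeta> = pot_K R (\<lambda>s \<eta>. source s) 0 0"
    using assms R_pos by (simp add: pot_K_radial[OF source_cont])
  then show ?thesis by (simp add: op_G_def True theta_0 flip: source_def)
next
  case False
  then have r: "0 < r" "r \<le> R" using assms by auto
  have "op_G \<nu> R (\<lambda>r \<zeta>. \<theta> r) r \<zeta> = potential r"
    using pot_K_radial_difference[OF source_cont r assms(2)]
    by (simp add: op_G_def potential_def mass_def flip: source_def)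
  then show ?thesis using theta_eq_potential[OF r] by simp
qed

lemma theta_deriv:
  assumes "0 < r" "r < R" shows "(\<theta> has_real_derivative - slope r) (at r)"
proof (rule has_field_derivative_transform_within_open[OF potential_deriv[OF assms]])
  show "open {0<..<R}" "r \<in> {0<..<R}" using assms by auto
  show "potential s = \<theta> s" if "s \<in> {0<..<R}" for s using that theta_eq_potential[of s] by simp
qed

end

section \<open>Quantitative bounds for the profile\<close>

lemma powr_pos_part_deriv:
  fixes p t :: real
  assumes "1 < p"
  shows "((\<lambda>t. max t 0 powr p) has_real_derivative p * max t 0 powr (p - 1)) (at t)"
proof -
  consider "t < 0" | "t = 0" | "0 < t" by linarith
  then show ?thesis
  proof cases
    case 1
    have "((\<lambda>t::real. 0) has_real_derivative 0) (at t)" by simp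
    then have "((\<lambda>t. max t 0 powr p) has_real_derivative 0) (at t)"
      by (rule has_field_derivative_transform_within_open[of _ _ _ "{..<0}"]) (use 1 in \<open>auto simp: max_def\<close>)
    then show ?thesis using 1 by (simp add: max_def)
  next
    case 2
    have "((\<lambda>h. (max h 0 powr p) / h) \<longlongrightarrow> 0) (at 0)"
    proof (rule Lim_null_comparison)
      show "((\<lambda>h::real. \<bar>h\<bar> powr (p - 1)) \<longlongrightarrow> 0) (at 0)"
        using assms by (auto intro!: tendsto_eq_intros)
      have "norm (max h 0 powr p / h) \<le> \<bar>h\<bar> powr (p - 1)" if "h \<noteq> 0" for h :: real
      proof (cases "0 < h")
        case True
        then show ?thesis by (simp add: max_def powr_diff)
      qed (use that in \<open>simp add: max_def\<close>)
      then show "\<forall>\<^sub>F h in at 0. norm (max h 0 powr p / h) \<le> \<bar>h\<bar> powr (p - 1)"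
        by (simp add: eventually_at_filter)
    qed
    then show ?thesis using 2 by (simp add: DERIV_def)
  next
    case 3
    have "((\<lambda>t. t powr p) has_real_derivative p * t powr (p - 1)) (at t)"
      using has_real_derivative_powr[OF 3] .
    then have "((\<lambda>t. max t 0 powr p) has_real_derivative p * t powr (p - 1)) (at t)"
      by (rule has_field_derivative_transform_within_open[of _ _ _ "{0<..}"]) (use 3 in \<open>auto simp: max_def\<close>)
    then show ?thesis using 3 by (simp add: max_def)
  qed
qed

context lane_emden_profile
begin

lemma theta_antimono:
  assumes "0 < r" "r \<le> s" "s \<le> R" shows "\<theta> s \<le> \<theta> r"
proof (rule DERIV_nonpos_imp_decreasing_open[OF assms(2)])
  fix x assume "r < x" "x < s"
  then show "\<exists>y. (\<theta> has_real_derivative y) (at x) \<and> y \<le> 0"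
    using assms theta_deriv[of x] mass_nonneg[of x]
    by (intro exI[of _ "- slope x"]) (auto simp: slope_def)
qed (use assms in \<open>auto intro: continuous_on_subset[OF theta_cont]\<close>)

lemma mass_lower:
  assumes r: "r \<in> {0..\<xi> / 2}" shows "source (\<xi> / 2) * r ^ 3 / 3 \<le> mass r"
proof -
  have "source (\<xi> / 2) * r ^ 3 / 3 = integral {0..r} (\<lambda>s. source (\<xi> / 2) * s\<^sup>2)"
  proof -
    have "((\<lambda>s. source (\<xi> / 2) * s\<^sup>2) has_integral source (\<xi> / 2) * r ^ 3 / 3 - source (\<xi> / 2) * 0 ^ 3 / 3) {0..r}"
      using r by (intro fundamental_theorem_of_calculus)
        (auto intro!: derivative_eq_intros simp flip: has_real_derivative_iff_has_vector_derivative)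
    from integral_unique[OF this, symmetric] show ?thesis by simp
  qed
  also have "\<dots> \<le> mass r" unfolding mass_def
  proof (rule integral_le)
    show "(\<lambda>s. source (\<xi> / 2) * s\<^sup>2) integrable_on {0..r}"
      by (intro integrable_continuous_real continuous_intros)
    show "(\<lambda>s. source s * s\<^sup>2) integrable_on {0..r}"
      using r R by (intro integrable_continuous_real source_moment_cont) auto
    fix s assume s: "s \<in> {0..r}"
    show "source (\<xi> / 2) * s\<^sup>2 \<le> source s * s\<^sup>2"
    proof (cases "s = 0")
      case False
      then have "\<theta> (\<xi> / 2) \<le> \<theta> s" using s r R by (intro theta_antimono) auto
      then have "source (\<xi> / 2) \<le> source s"
        unfolding source_def using nu by (intro powr_mono2) auto
      then show ?thesis by (rule mult_right_mono) simp
    qed simp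
  qed
  finally show ?thesis .
qed

lemma source_half_pos: "0 < source (\<xi> / 2)"
  using theta_pos[of "\<xi> / 2"] xi_pos by (simp add: source_def)

lemma mass_pos: assumes "0 < r" "r \<le> R" shows "0 < mass r"
proof -
  have "0 < source (\<xi> / 2) * (min r (\<xi> / 2)) ^ 3 / 3"
    using source_half_pos assms xi_pos by simp
  also have "\<dots> \<le> mass (min r (\<xi> / 2))" using assms xi_pos by (intro mass_lower) auto
  also have "\<dots> \<le> mass r" using assms xi_pos by (intro mass_mono) auto
  finally show ?thesis .
qed

lemma mu_pos: "0 < mu" using mass_pos[of \<xi>] xi_pos R by (simp add: mu_eq)

lemma slope_nonneg: "r \<le> R \<Longrightarrow> 0 \<le> slope r" using mass_nonneg[of r] by (simp add: slope_def)

lemma slope_0 [simp]: "slope 0 = 0" by (simp add: slope_def)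

lemma slope_xi: "slope \<xi> = mu / \<xi>\<^sup>2" by (simp add: slope_def mu_eq)

text \<open>
  The zero at \<open>\<xi>\<close> is simple and there is no other one. The slope is bounded below near \<open>\<xi>\<close>;
  farther inside, monotonicity suffices.
\<close>

lemma theta_coercive:
  obtains c where "0 < c" "\<And>r. r \<in> {0..R} \<Longrightarrow> c * \<bar>r - \<xi>\<bar> \<le> \<bar>\<theta> r\<bar>"
proof -
  define k where "k = mass (\<xi> / 2) / \<xi>\<^sup>2"
  have k: "0 < k" using mass_pos[of "\<xi> / 2"] xi_pos R by (simp add: k_def)
  define c where "c = min (k / 2) (mu / (\<xi> * R))"
  have c: "0 < c" using k mu_pos xi_pos R_pos by (simp add: c_def)
  have ck: "c \<le> k / 2" "c \<le> mu / (\<xi> * R)" unfolding c_def by (rule min.cobounded1, rule min.cobounded2)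
  have near: "k * (\<xi> - r) \<le> \<theta> r" if r: "r \<in> {\<xi> / 2..\<xi>}" for r
  proof (cases "r = \<xi>")
    case False
    then have "r < \<xi>" using r by simp
    moreover have "continuous_on {r..\<xi>} \<theta>" using r R xi_pos by (auto intro: continuous_on_subset[OF theta_cont])
    ultimately obtain t where t: "r < t" "t < \<xi>" "\<theta> \<xi> - \<theta> r = (\<lambda>h. - slope t * h) (\<xi> - r)"
    proof (rule mvt[of r \<xi> \<theta> "\<lambda>t h. - slope t * h"])
      show "(\<theta> has_derivative (\<lambda>h. - slope x * h)) (at x)" if "r < x" "x < \<xi>" for x
        by (rule has_field_derivative_imp_has_derivative[OF theta_deriv]) (use that r xi_pos R in auto)
    qed auto
    have "k \<le> slope t" unfolding k_def slope_def
      using t r xi_pos R mass_nonneg[of t]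
      by (intro frac_le mass_mono power_mono) (auto simp: mass_nonneg)
    then have "k * (\<xi> - r) \<le> slope t * (\<xi> - r)" using r by (intro mult_right_mono) auto
    then show ?thesis using t theta_xi by simp
  qed (simp add: theta_xi)
  have "c * \<bar>r - \<xi>\<bar> \<le> \<bar>\<theta> r\<bar>" if r: "r \<in> {0..R}" for r
  proof -
    consider "r = 0" | "0 < r" "r < \<xi> / 2" | "\<xi> / 2 \<le> r" "r \<le> \<xi>" | "\<xi> < r" using r by force
    then show ?thesis
    proof cases
      case 1
      have "k * (\<xi> - \<xi> / 2) \<le> \<theta> (\<xi> / 2)" using xi_pos by (intro near) auto
      also have "\<dots> \<le> 1"
      proof (rule tendsto_lowerbound[OF theta_tendsto])
        have "\<forall>\<^sub>F r in at_right 0. r \<in> {0<..<\<xi> / 2}"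
          using xi_pos by (intro eventually_at_right_real) simp
        then show "\<forall>\<^sub>F r in at_right 0. \<theta> (\<xi> / 2) \<le> \<theta> r"
          by eventually_elim (use R xi_pos in \<open>auto intro!: theta_antimono\<close>)
      qed simp
      finally have k1: "k / 2 * \<xi> \<le> 1" by (simp add: algebra_simps)
      have "c * \<xi> \<le> k / 2 * \<xi>" using xi_pos ck by (intro mult_right_mono) auto
      then have "c * \<xi> \<le> 1" using k1 by (rule order_trans)
      then show ?thesis using 1 theta_0 xi_pos by simp
    next
      case 2
      have "c * \<bar>r - \<xi>\<bar> \<le> k / 2 * \<xi>"
        using 2 c k ck xi_pos by (intro mult_mono) auto
      also have "\<dots> = k * (\<xi> - \<xi> / 2)" by (simp add: algebra_simps)
      also have "\<dots> \<le> \<theta> (\<xi> / 2)" using xi_pos by (intro near) auto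
      also have "\<dots> \<le> \<theta> r" using 2 R xi_pos by (intro theta_antimono) auto
      finally show ?thesis by simp
    next
      case 3
      have "c * \<bar>r - \<xi>\<bar> \<le> k * (\<xi> - r)"
        using 3 c k ck by (intro mult_mono) auto
      also have "\<dots> \<le> \<theta> r" using 3 by (intro near) auto
      finally show ?thesis by simp
    next
      case 4
      have "c * \<bar>r - \<xi>\<bar> \<le> mu / (\<xi> * R) * (r - \<xi>)"
        using 4 by (intro mult_mono) (auto simp: ck mu_nonneg xi_pos R_pos less_imp_le)
      also have "\<dots> \<le> mu / (\<xi> * r) * (r - \<xi>)"
        using 4 r xi_pos mu_pos by (intro mult_right_mono divide_left_mono) auto
      also have "\<dots> = - \<theta> r" using 4 xi_pos theta_outside[of r] by (simp add: field_simps)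
      finally show ?thesis by simp
    qed
  qed
  with c show ?thesis using that by blast
qed

lemma slope_deriv:
  assumes "0 < r" "r < R"
  shows "(slope has_real_derivative source r - 2 * mass r / r ^ 3) (at r)"
proof -
  have "(slope has_real_derivative (source r * r\<^sup>2 * r\<^sup>2 - mass r * (2 * r)) / (r\<^sup>2 * r\<^sup>2)) (at r)"
    unfolding slope_def[abs_def] using assms by (auto intro!: derivative_eq_intros mass_deriv)
  also have "(source r * r\<^sup>2 * r\<^sup>2 - mass r * (2 * r)) / (r\<^sup>2 * r\<^sup>2) = source r - 2 * mass r / r ^ 3"
    using assms by (simp add: field_simps power2_eq_square power3_eq_cube)
  finally show ?thesis .
qed

lemma theta_taylor:
  obtains C where "0 \<le> C" "\<And>r. r \<in> {\<xi> / 2..R} \<Longrightarrow> \<bar>\<theta> r + mu / \<xi>\<^sup>2 * (r - \<xi>)\<bar> \<le> C * (r - \<xi>)\<^sup>2"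
proof -
  have sc: "continuous_on {\<xi> / 2..R} slope"
    unfolding slope_def[abs_def] using xi_pos
    by (intro continuous_intros continuous_on_subset[OF mass_cont]) auto
  have dc: "continuous_on {\<xi> / 2..R} (\<lambda>r. source r - 2 * mass r / r ^ 3)"
    using xi_pos by (intro continuous_intros continuous_on_subset[OF mass_cont] continuous_on_subset[OF source_cont]) auto
  then have "bounded ((\<lambda>r. source r - 2 * mass r / r ^ 3) ` {\<xi> / 2..R})"
    by (intro compact_imp_bounded compact_continuous_image) auto
  then obtain C where C: "0 < C" "\<And>r. r \<in> {\<xi> / 2..R} \<Longrightarrow> \<bar>source r - 2 * mass r / r ^ 3\<bar> \<le> C"
    unfolding bounded_pos by auto
  have lip: "\<bar>slope t - slope \<xi>\<bar> \<le> C * \<bar>t - \<xi>\<bar>" if "t \<in> {\<xi> / 2..R}" for t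
    using that R xi_pos C by (intro mvt_bound[OF sc slope_deriv]) auto
  have "\<bar>\<theta> r + mu / \<xi>\<^sup>2 * (r - \<xi>)\<bar> \<le> C * (r - \<xi>)\<^sup>2" if r: "r \<in> {\<xi> / 2..R}" for r
  proof -
    let ?f = "\<lambda>r. \<theta> r + mu / \<xi>\<^sup>2 * (r - \<xi>)"
    have "\<bar>?f r - ?f \<xi>\<bar> \<le> (C * \<bar>r - \<xi>\<bar>) * \<bar>r - \<xi>\<bar>"
    proof (rule mvt_bound[where a="min r \<xi>" and b="max r \<xi>" and f'="\<lambda>t. - slope t + mu / \<xi>\<^sup>2"])
      show "continuous_on {min r \<xi>..max r \<xi>} ?f"
        using r R xi_pos by (intro continuous_intros continuous_on_subset[OF theta_cont]) auto
      fix t assume t: "min r \<xi> < t" "t < max r \<xi>"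
      show "(?f has_real_derivative - slope t + mu / \<xi>\<^sup>2) (at t)"
      proof -
        have "(\<theta> has_real_derivative - slope t) (at t)" using t r R xi_pos by (intro theta_deriv) auto
        moreover have "((\<lambda>r. mu / \<xi>\<^sup>2 * (r - \<xi>)) has_real_derivative mu / \<xi>\<^sup>2 * (1 - 0)) (at t)"
          by (intro DERIV_cmult DERIV_diff DERIV_ident DERIV_const)
        ultimately show ?thesis using DERIV_add by fastforce
      qed
      have "\<bar>- slope t + mu / \<xi>\<^sup>2\<bar> = \<bar>slope t - slope \<xi>\<bar>" by (simp add: slope_xi)
      also have "\<dots> \<le> C * \<bar>t - \<xi>\<bar>" using t r R xi_pos by (intro lip) (auto simp: min_def max_def split: if_splits)
      also have "\<dots> \<le> C * \<bar>r - \<xi>\<bar>" using t C by (intro mult_left_mono) auto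
      finally show "\<bar>- slope t + mu / \<xi>\<^sup>2\<bar> \<le> C * \<bar>r - \<xi>\<bar>" .
    qed auto
    then show ?thesis using theta_xi by (simp add: power2_eq_square)
  qed
  with C show ?thesis using that[of C] by simp
qed

text \<open>
  The derivative of \<open>max t 0 powr \<nu>\<close> at \<open>\<theta>\<close>: the radial coefficient in \<open>op_DG\<close>.
\<close>

definition stiffness :: "real \<Rightarrow> real" where "stiffness s = \<nu> * max (\<theta> s) 0 powr (\<nu> - 1)"

lemma stiffness_nonneg: "0 \<le> stiffness s" using nu by (simp add: stiffness_def)

lemma stiffness_cont: "continuous_on {0..R} stiffness"
  unfolding stiffness_def[abs_def] using nu
  by (intro continuous_on_powr' continuous_intros theta_cont) auto

lemma source_deriv:
  assumes "0 < r" "r < R" shows "(source has_real_derivative - (stiffness r * slope r)) (at r)"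
  using DERIV_chain2[OF powr_pos_part_deriv[OF nu] theta_deriv[OF assms]]
  by (simp add: source_def[abs_def] stiffness_def)

lemma slope_cont: "continuous_on {0..R} slope"
proof -
  obtain M where M: "0 < M" "\<And>r. r \<in> {0..R} \<Longrightarrow> mass r \<le> M * r ^ 3" using mass_le by metis
  have "continuous (at r within {0..R}) slope" if r: "r \<in> {0..R}" for r
  proof (cases "r = 0")
    case True
    have "(slope \<longlongrightarrow> 0) (at 0 within {0..R})"
    proof (rule Lim_null_comparison)
      show "((\<lambda>r. M * r) \<longlongrightarrow> 0) (at 0 within {0..R})" by (auto intro!: tendsto_eq_intros)
      have "norm (slope t) \<le> M * t" if "t \<in> {0..R}" for t
      proof (cases "t = 0")
        case False
        then have "mass t / t\<^sup>2 \<le> M * t ^ 3 / t\<^sup>2" using M(2)[OF that] by (intro divide_right_mono) auto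
        then show ?thesis using slope_nonneg[of t] that False
          by (simp add: slope_def power2_eq_square power3_eq_cube)
      qed simp
      then show "\<forall>\<^sub>F r in at 0 within {0..R}. norm (slope r) \<le> M * r"
        by (auto simp: eventually_at_filter)
    qed
    then show ?thesis using True by (simp add: continuous_within)
  next
    case False
    have "continuous (at r within {0..R}) mass"
      using mass_cont r by (simp add: continuous_on_eq_continuous_within)
    then show ?thesis unfolding slope_def[abs_def] using False by (intro continuous_intros) auto
  qed
  then show ?thesis by (simp add: continuous_on_eq_continuous_within)
qed

text \<open>
  The operator \<open>DG\<close> on the radial factor of \<open>a(r) P2(\<zeta>)\<close>, for \<open>r > 0\<close>.
\<close>

definition quad :: "(real \<Rightarrow> real) \<Rightarrow> real \<Rightarrow> real" where
  "quad a r = integral {0..R} (\<lambda>s. stiffness s * a s * (s\<^sup>2 * (min r s)\<^sup>2 / (5 * (max r s) ^ 3)))"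

lemma quad_kernel_cont: "0 < r \<Longrightarrow> continuous_on A (\<lambda>s::real. s\<^sup>2 * (min r s)\<^sup>2 / (5 * (max r s) ^ 3))"
  by (intro continuous_intros) (auto simp: max_def)

lemma quad_kernel_nonneg: "0 < r \<Longrightarrow> 0 \<le> s\<^sup>2 * (min r s)\<^sup>2 / (5 * (max r s) ^ 3 :: real)"
  by (intro divide_nonneg_nonneg mult_nonneg_nonneg) (auto simp: max_def)

lemma quad_mono:
  assumes "0 < r" "continuous_on {0..R} a" "continuous_on {0..R} b" "\<And>s. s \<in> {0..R} \<Longrightarrow> a s \<le> b s"
  shows "quad a r \<le> quad b r"
  unfolding quad_def using assms
  by (intro integral_le integrable_continuous_real continuous_intros stiffness_cont quad_kernel_cont
      mult_right_mono mult_left_mono quad_kernel_nonneg stiffness_nonneg) auto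

lemma quad_scale: "quad (\<lambda>s. c * a s) r = c * quad a r"
  unfolding quad_def integral_mult_right[symmetric] by (intro integral_cong) simp

text \<open>
  The kernel of degree two, \<open>min\<^sup>2 / (5 * max\<^sup>3)\<close>, is at most \<open>3 / 5\<close> of the kernel of degree one,
  \<open>min / (3 * max\<^sup>2)\<close>. The latter reproduces the slope: \<open>stiffness * slope\<close> is minus the
  derivative of \<open>source\<close>, so the two resulting integrals are elementary.
\<close>

lemma quad_slope:
  assumes r: "0 < r" "r \<le> R" shows "quad slope r \<le> 3 / 5 * slope r"
proof -
  let ?k = "\<lambda>s. s\<^sup>2 * (min r s)\<^sup>2 / (5 * (max r s) ^ 3)"
  let ?g = "\<lambda>s. stiffness s * slope s"
  have gc: "continuous_on {0..R} ?g" by (intro continuous_intros stiffness_cont slope_cont)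
  have kc: "continuous_on {0..R} (\<lambda>s. ?g s * ?k s)"
    by (intro continuous_on_mult gc quad_kernel_cont r)
  have g0: "0 \<le> ?g s" if "s \<le> R" for s using stiffness_nonneg slope_nonneg that by simp
  have "quad slope r = integral {0..r} (\<lambda>s. ?g s * ?k s) + integral {r..R} (\<lambda>s. ?g s * ?k s)"
    unfolding quad_def
    by (rule Henstock_Kurzweil_Integration.integral_combine[symmetric])
      (use r kc in \<open>auto intro: integrable_continuous_real\<close>)
  also have "integral {0..r} (\<lambda>s. ?g s * ?k s) \<le> (3 * mass r - source r * r ^ 3) * (1 / (5 * r\<^sup>2))"
  proof (rule integral_le[OF _ _, THEN order_trans])
    show "(\<lambda>s. ?g s * ?k s) integrable_on {0..r}"
      using r by (intro integrable_continuous_real continuous_on_subset[OF kc]) auto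
    have "((\<lambda>s. ?g s * s ^ 3) has_integral
        (3 * mass r - source r * r ^ 3) - (3 * mass 0 - source 0 * 0 ^ 3)) {0..r}"
    proof (rule fundamental_theorem_of_calculus_interior)
      show "continuous_on {0..r} (\<lambda>s. 3 * mass s - source s * s ^ 3)"
        using r by (intro continuous_intros continuous_on_subset[OF mass_cont] continuous_on_subset[OF source_cont]) auto
      fix s assume "s \<in> {0<..<r}"
      then have s: "0 < s" "s < R" using r by auto
      have "((\<lambda>s. 3 * mass s - source s * s ^ 3) has_real_derivative
          3 * (source s * s\<^sup>2) - (- (stiffness s * slope s) * s ^ 3 + (3 * s\<^sup>2) * source s)) (at s)"
        by (auto intro!: derivative_eq_intros mass_deriv source_deriv s)
      then show "((\<lambda>s. 3 * mass s - source s * s ^ 3) has_vector_derivative ?g s * s ^ 3) (at s)"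
        by (simp add: has_real_derivative_iff_has_vector_derivative algebra_simps)
    qed (use r in simp)
    then have *: "((\<lambda>s. ?g s * s ^ 3 * (1 / (5 * r\<^sup>2))) has_integral
        (3 * mass r - source r * r ^ 3) * (1 / (5 * r\<^sup>2))) {0..r}"
      by (intro has_integral_mult_left) simp
    then show "(\<lambda>s. ?g s * s ^ 3 * (1 / (5 * r\<^sup>2))) integrable_on {0..r}" by (rule has_integral_integrable)
    show "integral {0..r} (\<lambda>s. ?g s * s ^ 3 * (1 / (5 * r\<^sup>2))) \<le> (3 * mass r - source r * r ^ 3) * (1 / (5 * r\<^sup>2))"
      using integral_unique[OF *] by (rule eq_refl)
    fix s assume s: "s \<in> {0..r}"
    have "?k s = s ^ 3 * (1 / (5 * r\<^sup>2)) * (s / r)"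
      using s r by (simp add: max_absorb1 min_absorb2 field_simps power2_eq_square power3_eq_cube)
    also have "\<dots> \<le> s ^ 3 * (1 / (5 * r\<^sup>2))" using s r by (intro mult_right_le_one_le) auto
    finally have "?g s * ?k s \<le> ?g s * (s ^ 3 * (1 / (5 * r\<^sup>2)))"
      using g0[of s] s r by (intro mult_left_mono) auto
    then show "?g s * ?k s \<le> ?g s * s ^ 3 * (1 / (5 * r\<^sup>2))" by (simp only: mult.assoc)
  qed
  also have "integral {r..R} (\<lambda>s. ?g s * ?k s) \<le> source r * (r / 5)"
  proof (rule integral_le[OF _ _, THEN order_trans])
    show "(\<lambda>s. ?g s * ?k s) integrable_on {r..R}"
      using r by (intro integrable_continuous_real continuous_on_subset[OF kc]) auto
    have "(?g has_integral (- source R) - (- source r)) {r..R}"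
    proof (rule fundamental_theorem_of_calculus_interior)
      show "continuous_on {r..R} (\<lambda>s. - source s)"
        using r by (intro continuous_intros continuous_on_subset[OF source_cont]) auto
      fix s assume "s \<in> {r<..<R}"
      then have s: "0 < s" "s < R" using r by auto
      have "((\<lambda>s. - source s) has_real_derivative - (- (stiffness s * slope s))) (at s)"
        by (intro DERIV_minus source_deriv s)
      then show "((\<lambda>s. - source s) has_vector_derivative ?g s) (at s)"
        by (simp add: has_real_derivative_iff_has_vector_derivative)
    qed (use r in simp)
    then have *: "((\<lambda>s. ?g s * (r / 5)) has_integral source r * (r / 5)) {r..R}"
      using R by (intro has_integral_mult_left) (simp add: source_outside)
    then show "(\<lambda>s. ?g s * (r / 5)) integrable_on {r..R}" by (rule has_integral_integrable)
    show "integral {r..R} (\<lambda>s. ?g s * (r / 5)) \<le> source r * (r / 5)"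
      using integral_unique[OF *] by (rule eq_refl)
    fix s assume s: "s \<in> {r..R}"
    have "?k s = r / 5 * (r / s)"
      using s r by (simp add: max_absorb2 min_absorb1 field_simps power2_eq_square power3_eq_cube)
    also have "\<dots> \<le> r / 5" using s r by (intro mult_right_le_one_le) auto
    finally show "?g s * ?k s \<le> ?g s * (r / 5)"
      using g0[of s] s r by (intro mult_left_mono) auto
  qed
  finally have "quad slope r \<le> (3 * mass r - source r * r ^ 3) * (1 / (5 * r\<^sup>2)) + source r * (r / 5)" by simp
  also have "\<dots> = 3 / 5 * slope r"
    using r by (simp add: slope_def field_simps power2_eq_square power3_eq_cube)
  finally show ?thesis .
qed

text \<open>
  Both sides vanish at the origin, where \<open>slope r\<close> is of order \<open>r\<close>; this dominates the initial term of
  the Neumann series by the supersolution.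
\<close>

lemma square_le_slope:
  obtains C where "0 < C" "\<And>r. r \<in> {0..R} \<Longrightarrow> r\<^sup>2 \<le> C * slope r"
proof -
  define F where "F = source (\<xi> / 2)"
  have F: "0 < F" unfolding F_def by (rule source_half_pos)
  have m: "0 < mass (\<xi> / 2)" using xi_pos R by (intro mass_pos) auto
  define C where "C = 3 * \<xi> / (2 * F) + R ^ 4 / mass (\<xi> / 2)"
  have C: "0 < C" "3 * \<xi> / (2 * F) \<le> C" "R ^ 4 / mass (\<xi> / 2) \<le> C"
    using F m xi_pos R_pos by (auto simp: C_def intro!: add_pos_pos)
  have "r\<^sup>2 \<le> C * slope r" if r: "r \<in> {0..R}" for r
  proof (cases "r = 0")
    case False
    then have r0: "0 < r" using r by simp
    have "r ^ 4 \<le> C * mass r"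
    proof (cases "r \<le> \<xi> / 2")
      case True
      have "r ^ 4 = r * r ^ 3" by (simp add: power3_eq_cube power4_eq_xxxx)
      also have "\<dots> \<le> \<xi> / 2 * r ^ 3" using True r0 by (intro mult_right_mono) auto
      also have "\<dots> = 3 * \<xi> / (2 * F) * (F * r ^ 3 / 3)" using F by simp
      also have "\<dots> \<le> C * mass r"
        using C mass_lower[of r] True r0 F by (intro mult_mono) (auto simp: F_def)
      finally show ?thesis .
    next
      case False
      have "r ^ 4 \<le> R ^ 4" using r r0 by (intro power_mono) auto
      also have "\<dots> = R ^ 4 / mass (\<xi> / 2) * mass (\<xi> / 2)" using m by simp
      also have "\<dots> \<le> C * mass r"
        using C mass_mono[of "\<xi> / 2" r] False r m xi_pos by (intro mult_mono) auto
      finally show ?thesis .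
    qed
    then show ?thesis using r0 by (simp add: slope_def field_simps power2_eq_square power4_eq_xxxx)
  qed simp
  with C show ?thesis using that by blast
qed

end

section \<open>The function space and the linearized operator\<close>

lemma space_E_cont_rect: "u \<in> space_E R \<Longrightarrow> cont_rect R u"
  and space_E_origin: "u \<in> space_E R \<Longrightarrow> \<zeta> \<in> {-1..1} \<Longrightarrow> u 0 \<zeta> = u 0 0"
  and space_E_even: "u \<in> space_E R \<Longrightarrow> r \<in> {0..R} \<Longrightarrow> \<zeta> \<in> {-1..1} \<Longrightarrow> u r (- \<zeta>) = u r \<zeta>"
  unfolding space_E_def cont_rect_def by blast+

lemma space_EI:
  assumes "cont_rect R u" "\<And>\<zeta>. \<zeta> \<in> {-1..1} \<Longrightarrow> u 0 \<zeta> = u 0 0"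
    "\<And>r \<zeta>. r \<in> {0..R} \<Longrightarrow> \<zeta> \<in> {-1..1} \<Longrightarrow> u r (- \<zeta>) = u r \<zeta>"
  shows "u \<in> space_E R"
  using assms unfolding space_E_def cont_rect_def by blast

lemma abs_le_norm_E:
  assumes u: "cont_rect R u" and r: "r \<in> {0..R}" and z: "\<zeta> \<in> {-1..1}"
  shows "\<bar>u r \<zeta>\<bar> \<le> norm_E R u"
proof -
  obtain M where M: "\<And>r \<zeta>. r \<in> {0..R} \<Longrightarrow> \<zeta> \<in> {-1..1} \<Longrightarrow> \<bar>u r \<zeta>\<bar> \<le> M"
    using cont_rect_bounded[OF u] by metis
  have "bdd_above ((\<lambda>(r, \<zeta>). \<bar>u r \<zeta>\<bar>) ` ({0..R} \<times> {-1..1}))"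
    by (rule bdd_aboveI[of _ M]) (use M in auto)
  moreover have "(r, \<zeta>) \<in> {0..R} \<times> {-1..1}" using r z by simp
  ultimately have "(\<lambda>(r, \<zeta>). \<bar>u r \<zeta>\<bar>) (r, \<zeta>) \<le> norm_E R u"
    unfolding norm_E_def by (rule cSUP_upper2) simp
  then show ?thesis by simp
qed

lemma norm_E_le:
  assumes "0 \<le> R" and "\<And>r \<zeta>. r \<in> {0..R} \<Longrightarrow> \<zeta> \<in> {-1..1} \<Longrightarrow> \<bar>u r \<zeta>\<bar> \<le> M"
  shows "norm_E R u \<le> M"
  unfolding norm_E_def by (rule cSUP_least) (use assms in auto)

lemma norm_E_nonneg: "cont_rect R u \<Longrightarrow> 0 \<le> R \<Longrightarrow> 0 \<le> norm_E R u"
  using abs_le_norm_E[of R u 0 0] by (auto intro: order_trans[OF abs_ge_zero])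

lemma space_E_combine:
  assumes "u \<in> space_E R" "v \<in> space_E R"
  shows "(\<lambda>r \<zeta>. u r \<zeta> + c * v r \<zeta>) \<in> space_E R"
proof (rule space_EI)
  show "cont_rect R (\<lambda>r \<zeta>. u r \<zeta> + c * v r \<zeta>)"
    using assms[THEN space_E_cont_rect] unfolding cont_rect_def case_prod_unfold
    by (intro continuous_intros)
  show "u 0 \<zeta> + c * v 0 \<zeta> = u 0 0 + c * v 0 0" if "\<zeta> \<in> {-1..1}" for \<zeta>
    unfolding assms[THEN space_E_origin, OF that] ..
  show "u r (- \<zeta>) + c * v r (- \<zeta>) = u r \<zeta> + c * v r \<zeta>" if "r \<in> {0..R}" "\<zeta> \<in> {-1..1}" for r \<zeta>
    unfolding assms[THEN space_E_even, OF that] ..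
qed

lemma space_E_cong:
  assumes "u \<in> space_E R" "eq_E R u v" "0 \<le> R" shows "v \<in> space_E R"
proof (rule space_EI)
  have e: "u r \<zeta> = v r \<zeta>" if "r \<in> {0..R}" "\<zeta> \<in> {-1..1}" for r \<zeta>
    using assms(2) that by (simp add: eq_E_def)
  show "cont_rect R v"
    using space_E_cont_rect[OF assms(1)] unfolding cont_rect_def
    by (rule continuous_on_eq) (use e in auto)
  show "v 0 \<zeta> = v 0 0" if "\<zeta> \<in> {-1..1}" for \<zeta>
    using e[of 0 \<zeta>] e[of 0 0] that assms(3) space_E_origin[OF assms(1) that] by simp
  show "v r (- \<zeta>) = v r \<zeta>" if "r \<in> {0..R}" "\<zeta> \<in> {-1..1}" for r \<zeta>
    using e[of r \<zeta>] e[of r "- \<zeta>"] that space_E_even[OF assms(1) that] by simp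
qed

lemma space_E_radial:
  assumes "continuous_on {0..R} a" shows "(\<lambda>r \<zeta>. a r) \<in> space_E R"
  using cont_rect_zonal[OF assms, of "\<lambda>_. 1"] by (simp add: space_E_def cont_rect_def)

lemma cont_rect_slice: "cont_rect R u \<Longrightarrow> \<zeta> \<in> {-1..1} \<Longrightarrow> continuous_on {0..R} (\<lambda>r. u r \<zeta>)"
  unfolding cont_rect_def
  by (rule continuous_on_compose2[of _ "\<lambda>(r, \<zeta>). u r \<zeta>" _ "\<lambda>r. (r, \<zeta>)", simplified]) (auto intro!: continuous_intros)

lemma abs_P2_le: assumes "\<zeta> \<in> {-1..1}" shows "\<bar>P2 \<zeta>\<bar> \<le> 1"
proof -
  have "\<zeta>\<^sup>2 \<le> 1" using assms by (simp add: abs_square_le_1 abs_le_iff)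
  moreover have "0 \<le> \<zeta>\<^sup>2" by simp
  moreover have "P2 \<zeta> = 3 / 2 * \<zeta>\<^sup>2 - 1 / 2" by (simp add: P2_def)
  ultimately show ?thesis by linarith
qed

locale lane_emden_inverse = lane_emden_profile +
  fixes S :: "(real \<Rightarrow> real \<Rightarrow> real) \<Rightarrow> (real \<Rightarrow> real \<Rightarrow> real)"
  assumes inv: "bounded_inverse_E R (\<lambda>u r \<zeta>. u r \<zeta> - op_DG \<nu> R (\<lambda>r \<zeta>. \<theta> r) u r \<zeta>) S"
begin

abbreviation DG :: "(real \<Rightarrow> real \<Rightarrow> real) \<Rightarrow> real \<Rightarrow> real \<Rightarrow> real" where
  "DG \<equiv> op_DG \<nu> R (\<lambda>r \<zeta>. \<theta> r)"

abbreviation lin :: "(real \<Rightarrow> real \<Rightarrow> real) \<Rightarrow> real \<Rightarrow> real \<Rightarrow> real" where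
  "lin u \<equiv> \<lambda>r \<zeta>. u r \<zeta> - DG u r \<zeta>"

lemma DG_eq: "DG u r \<zeta> = pot_K R (\<lambda>s \<eta>. stiffness s * u s \<eta>) r \<zeta> - pot_K R (\<lambda>s \<eta>. stiffness s * u s \<eta>) 0 0"
  by (simp add: op_DG_def stiffness_def)

lemma cont_rect_stiffness: assumes "cont_rect R u" shows "cont_rect R (\<lambda>s \<eta>. stiffness s * u s \<eta>)"
  using assms unfolding cont_rect_def case_prod_unfold
  by (intro continuous_intros continuous_on_compose2[OF stiffness_cont]) auto

lemma lin_space_E: "u \<in> space_E R \<Longrightarrow> lin u \<in> space_E R"
  using inv by (simp add: bounded_inverse_E_def)

text \<open>
  That \<open>DG\<close> preserves the space, and with it the continuity of potentials in both variables, is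
  contained in the invertibility hypothesis.
\<close>

lemma DG_space_E: assumes "u \<in> space_E R" shows "DG u \<in> space_E R"
  using space_E_combine[OF assms lin_space_E[OF assms], of "-1"] by simp

lemma DG_combine:
  assumes "cont_rect R u" "cont_rect R v" "r \<in> {0..R}" "\<zeta> \<in> {-1..1}"
  shows "DG (\<lambda>r \<zeta>. u r \<zeta> + c * v r \<zeta>) r \<zeta> = DG u r \<zeta> + c * DG v r \<zeta>"
proof -
  have "cont_rect R (\<lambda>s \<eta>. c * (stiffness s * v s \<eta>))"
    using cont_rect_stiffness[OF assms(2)] unfolding cont_rect_def case_prod_unfold
    by (rule continuous_on_mult_left)
  note add = pot_K_add[OF cont_rect_stiffness[OF assms(1)] this]
  have eq: "(\<lambda>s \<eta>. stiffness s * (u s \<eta> + c * v s \<eta>)) = (\<lambda>s \<eta>. stiffness s * u s \<eta> + c * (stiffness s * v s \<eta>))"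
    by (auto simp: fun_eq_iff algebra_simps)
  have "pot_K R (\<lambda>s \<eta>. stiffness s * u s \<eta> + c * (stiffness s * v s \<eta>)) t \<eta> =
      pot_K R (\<lambda>s \<eta>. stiffness s * u s \<eta>) t \<eta> + c * pot_K R (\<lambda>s \<eta>. stiffness s * v s \<eta>) t \<eta>"
    if "t \<in> {0..R}" "\<eta> \<in> {-1..1}" for t \<eta>
    using add[OF that] unfolding pot_K_scale .
  from this[OF assms(3,4)] this[of 0 0] show ?thesis
    unfolding DG_eq eq using R_pos by (simp add: right_diff_distrib)
qed

lemma lin_combine:
  assumes "cont_rect R u" "cont_rect R v" "r \<in> {0..R}" "\<zeta> \<in> {-1..1}"
  shows "lin (\<lambda>r \<zeta>. u r \<zeta> + c * v r \<zeta>) r \<zeta> = lin u r \<zeta> + c * lin v r \<zeta>"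
  using DG_combine[OF assms] by (simp add: algebra_simps)

lemma pot_K_difference_bound:
  assumes "cont_rect R f" "r \<in> {0..R}" "\<zeta> \<in> {-1..1}"
    and "\<And>r \<zeta>. r \<in> {0..R} \<Longrightarrow> \<zeta> \<in> {-1..1} \<Longrightarrow> \<bar>f r \<zeta>\<bar> \<le> M"
  shows "\<bar>pot_K R f r \<zeta> - pot_K R f 0 0\<bar> \<le> 2 * (R ^ 3 / 3 + 2 * R) * M"
proof -
  have "\<bar>pot_K R f r \<zeta>\<bar> \<le> (R ^ 3 / 3 + 2 * R) * M" by (rule pot_K_bound[OF assms])
  moreover have "\<bar>pot_K R f 0 0\<bar> \<le> (R ^ 3 / 3 + 2 * R) * M"
    by (rule pot_K_bound[OF assms(1) _ _ assms(4)]) (use R_pos in auto)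
  ultimately show ?thesis by linarith
qed

lemma stiffness_bounded: obtains A where "0 < A" "\<And>s. s \<in> {0..R} \<Longrightarrow> stiffness s \<le> A"
proof -
  have "bounded (stiffness ` {0..R})"
    using stiffness_cont by (intro compact_imp_bounded compact_continuous_image) auto
  then obtain M where "0 < M" "\<And>s. s \<in> {0..R} \<Longrightarrow> \<bar>stiffness s\<bar> \<le> M"
    unfolding bounded_pos by auto
  then show ?thesis by (intro that[of M]) (auto simp: abs_le_iff)
qed

lemma DG_bound:
  obtains K where "0 \<le> K" "\<And>u M r \<zeta>. cont_rect R u \<Longrightarrow> r \<in> {0..R} \<Longrightarrow> \<zeta> \<in> {-1..1} \<Longrightarrow>
    (\<And>r \<zeta>. r \<in> {0..R} \<Longrightarrow> \<zeta> \<in> {-1..1} \<Longrightarrow> \<bar>u r \<zeta>\<bar> \<le> M) \<Longrightarrow> \<bar>DG u r \<zeta>\<bar> \<le> K * M"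
proof -
  obtain A where A: "0 < A" "\<And>s. s \<in> {0..R} \<Longrightarrow> stiffness s \<le> A" using stiffness_bounded by metis
  show ?thesis
  proof (rule that[of "2 * (R ^ 3 / 3 + 2 * R) * A"])
    show "0 \<le> 2 * (R ^ 3 / 3 + 2 * R) * A" using A R_pos by simp
    fix u :: "real \<Rightarrow> real \<Rightarrow> real" and M r \<zeta> :: real
    assume u: "cont_rect R u" "r \<in> {0..R}" "\<zeta> \<in> {-1..1}"
      and M: "\<And>r \<zeta>. r \<in> {0..R} \<Longrightarrow> \<zeta> \<in> {-1..1} \<Longrightarrow> \<bar>u r \<zeta>\<bar> \<le> M"
    have "\<bar>stiffness s * u s \<eta>\<bar> \<le> A * M" if "s \<in> {0..R}" "\<eta> \<in> {-1..1}" for s \<eta>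
      unfolding abs_mult using A M[OF that] that stiffness_nonneg[of s] by (intro mult_mono) auto
    then have "\<bar>pot_K R (\<lambda>s \<eta>. stiffness s * u s \<eta>) r \<zeta> - pot_K R (\<lambda>s \<eta>. stiffness s * u s \<eta>) 0 0\<bar>
        \<le> 2 * (R ^ 3 / 3 + 2 * R) * (A * M)"
      by (rule pot_K_difference_bound[OF cont_rect_stiffness[OF u(1)] u(2,3)])
    then show "\<bar>DG u r \<zeta>\<bar> \<le> 2 * (R ^ 3 / 3 + 2 * R) * A * M" unfolding DG_eq by (simp add: mult.assoc)
  qed
qed

lemma lin_bounded_below:
  obtains C where "0 \<le> C" "\<And>u. u \<in> space_E R \<Longrightarrow> norm_E R u \<le> C * norm_E R (lin u)"
proof -
  obtain C where C: "\<And>f. f \<in> space_E R \<Longrightarrow> norm_E R (S f) \<le> C * norm_E R f"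
    using inv by (auto simp: bounded_inverse_E_def)
  have "norm_E R u \<le> max C 0 * norm_E R (lin u)" if u: "u \<in> space_E R" for u
  proof -
    have e: "eq_E R (S (lin u)) u" using inv u by (simp add: bounded_inverse_E_def)
    have "S (lin u) \<in> space_E R" using inv lin_space_E[OF u] by (simp add: bounded_inverse_E_def)
    then have "norm_E R u \<le> norm_E R (S (lin u))"
      using e R_pos by (intro norm_E_le) (auto simp: eq_E_def intro: abs_le_norm_E[OF space_E_cont_rect, THEN order_trans[rotated]])
    also have "\<dots> \<le> C * norm_E R (lin u)" by (rule C[OF lin_space_E[OF u]])
    also have "\<dots> \<le> max C 0 * norm_E R (lin u)"
      using norm_E_nonneg[OF space_E_cont_rect[OF lin_space_E[OF u]]] R_pos by (intro mult_right_mono) auto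
    finally show ?thesis .
  qed
  then show ?thesis using that[of "max C 0"] by simp
qed

lemma lin_injective:
  assumes "u \<in> space_E R" "v \<in> space_E R" "eq_E R (lin u) (lin v)"
  shows "eq_E R u v"
proof -
  obtain C where C: "0 \<le> C" "\<And>u. u \<in> space_E R \<Longrightarrow> norm_E R u \<le> C * norm_E R (lin u)"
    using lin_bounded_below by metis
  let ?w = "\<lambda>r \<zeta>. u r \<zeta> + (-1) * v r \<zeta>"
  have w: "?w \<in> space_E R" by (rule space_E_combine[OF assms(1,2)])
  have "norm_E R (lin ?w) \<le> 0"
  proof (rule norm_E_le)
    fix r \<zeta> assume rz: "r \<in> {0..R}" "\<zeta> \<in> {-1..1::real}"
    have "lin ?w r \<zeta> = lin u r \<zeta> + (-1) * lin v r \<zeta>"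
      by (rule lin_combine[OF space_E_cont_rect[OF assms(1)] space_E_cont_rect[OF assms(2)] rz])
    also have "\<dots> = 0" using assms(3) rz by (simp only: eq_E_def) simp
    finally show "\<bar>lin ?w r \<zeta>\<bar> \<le> 0" by simp
  qed (use R_pos in simp)
  then have "C * norm_E R (lin ?w) \<le> 0" using C(1) by (simp add: mult_nonneg_nonpos)
  then have "norm_E R ?w \<le> 0" using C(2)[OF w] by linarith
  then show ?thesis
    using abs_le_norm_E[OF space_E_cont_rect[OF w]] unfolding eq_E_def by force
qed

text \<open>
  The operator norm of \<open>DG\<close> may exceed 1. A summable bound on its iterates at one starting function
  takes its place, since boundedness of \<open>DG\<close> alone lets it pass through the uniform limit.
\<close>

lemma neumann_series:
  assumes u: "\<And>n. u n \<in> space_E R" and step: "\<And>n. eq_E R (u (Suc n)) (DG (u n))"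
    and b: "\<And>n r \<zeta>. r \<in> {0..R} \<Longrightarrow> \<zeta> \<in> {-1..1} \<Longrightarrow> \<bar>u n r \<zeta>\<bar> \<le> b n" and sb: "summable b"
  defines "U \<equiv> \<lambda>r \<zeta>. \<Sum>n. u n r \<zeta>"
  shows "U \<in> space_E R" "eq_E R (lin U) (u 0)"
    "\<And>r \<zeta>. r \<in> {0..R} \<Longrightarrow> \<zeta> \<in> {-1..1} \<Longrightarrow> summable (\<lambda>n. u n r \<zeta>)"
proof -
  let ?D = "{0..R} \<times> {-1..1::real}"
  define P where "P n r \<zeta> = (\<Sum>k<n. u k r \<zeta>)" for n r \<zeta>
  show sm: "summable (\<lambda>n. u n r \<zeta>)" if "r \<in> {0..R}" "\<zeta> \<in> {-1..1}" for r \<zeta>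
    by (rule summable_comparison_test'[OF sb]) (use b that in simp)
  have ul: "uniform_limit ?D (\<lambda>n x. \<Sum>k<n. (\<lambda>(r, \<zeta>). u k r \<zeta>) x) (\<lambda>x. \<Sum>k. (\<lambda>(r, \<zeta>). u k r \<zeta>) x) sequentially"
    by (rule Weierstrass_m_test[OF _ sb]) (use b in auto)
  have ul': "uniform_limit ?D (\<lambda>n (r, \<zeta>). P n r \<zeta>) (\<lambda>(r, \<zeta>). U r \<zeta>) sequentially"
    using ul by (simp add: P_def U_def case_prod_unfold)
  have P0: "P n \<in> space_E R" for n
  proof (induction n)
    case 0
    show ?case using space_E_radial[of R "\<lambda>_. 0"] by (simp add: P_def[abs_def])
  next
    case (Suc n)
    show ?case using space_E_combine[OF Suc u[of n], of 1] by (simp add: P_def[abs_def])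
  qed
  have "cont_rect R U" unfolding cont_rect_def
  proof (rule uniform_limit_theorem[OF _ ul'])
    show "\<forall>\<^sub>F n in sequentially. continuous_on ?D (\<lambda>(r, \<zeta>). P n r \<zeta>)"
      using space_E_cont_rect[OF P0] by (simp add: cont_rect_def)
  qed simp
  moreover have "U 0 \<zeta> = U 0 0" if "\<zeta> \<in> {-1..1}" for \<zeta>
    unfolding U_def space_E_origin[OF u that] ..
  moreover have "U r (- \<zeta>) = U r \<zeta>" if "r \<in> {0..R}" "\<zeta> \<in> {-1..1}" for r \<zeta>
    unfolding U_def space_E_even[OF u that] ..
  ultimately show UE: "U \<in> space_E R" by (rule space_EI)
  show "eq_E R (lin U) (u 0)"
    unfolding eq_E_def
  proof (intro ballI)
    fix r \<zeta> assume rz: "r \<in> {0..R}" "\<zeta> \<in> {-1..1::real}"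
    have DP: "DG (P n) r \<zeta> = P (Suc n) r \<zeta> - u 0 r \<zeta>" for n
    proof (induction n)
      case 0
      have "P 0 = (\<lambda>r \<zeta>. 0)" by (simp add: P_def[abs_def])
      moreover have "DG (\<lambda>r \<zeta>. 0) r \<zeta> = 0" by (simp add: DG_eq pot_K_def axial_def)
      ultimately show ?case by (simp add: P_def)
    next
      case (Suc n)
      have "P (Suc n) = (\<lambda>r \<zeta>. P n r \<zeta> + 1 * u n r \<zeta>)" by (simp add: P_def[abs_def])
      then have "DG (P (Suc n)) r \<zeta> = DG (P n) r \<zeta> + DG (u n) r \<zeta>"
        using DG_combine[OF space_E_cont_rect[OF P0] space_E_cont_rect[OF u] rz, of n 1 n] by simp
      also have "DG (u n) r \<zeta> = u (Suc n) r \<zeta>" using step[of n] rz by (simp add: eq_E_def)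
      finally show ?case using Suc by (simp add: P_def)
    qed
    obtain K where K: "0 \<le> K" "\<And>u M r \<zeta>. cont_rect R u \<Longrightarrow> r \<in> {0..R} \<Longrightarrow> \<zeta> \<in> {-1..1} \<Longrightarrow>
      (\<And>r \<zeta>. r \<in> {0..R} \<Longrightarrow> \<zeta> \<in> {-1..1} \<Longrightarrow> \<bar>u r \<zeta>\<bar> \<le> M) \<Longrightarrow> \<bar>DG u r \<zeta>\<bar> \<le> K * M"
      using DG_bound by metis
    have lim1: "(\<lambda>n. DG (P n) r \<zeta>) \<longlonglongrightarrow> DG U r \<zeta>"
    proof (rule LIMSEQ_I)
      fix e :: real assume e: "0 < e"
      define d where "d = e / (K + 1)"
      have d: "0 < d" using e K by (simp add: d_def)
      have "\<forall>\<^sub>F n in sequentially. \<forall>x\<in>?D. dist ((\<lambda>(r, \<zeta>). P n r \<zeta>) x) ((\<lambda>(r, \<zeta>). U r \<zeta>) x) < d"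
        using uniform_limitD[OF ul' d] .
      then obtain N where N: "\<And>n x. n \<ge> N \<Longrightarrow> x \<in> ?D \<Longrightarrow> dist ((\<lambda>(r, \<zeta>). P n r \<zeta>) x) ((\<lambda>(r, \<zeta>). U r \<zeta>) x) < d"
        unfolding eventually_sequentially by blast
      show "\<exists>N. \<forall>n\<ge>N. norm (DG (P n) r \<zeta> - DG U r \<zeta>) < e"
      proof (intro exI[of _ N] allI impI)
        fix n assume n: "n \<ge> N"
        let ?w = "\<lambda>r \<zeta>. P n r \<zeta> + (-1) * U r \<zeta>"
        have "\<bar>DG ?w r \<zeta>\<bar> \<le> K * d"
        proof (rule K(2)[OF space_E_cont_rect[OF space_E_combine[OF P0 UE]] rz])
          show "\<bar>?w r \<zeta>\<bar> \<le> d" if "r \<in> {0..R}" "\<zeta> \<in> {-1..1}" for r \<zeta>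
            using N[OF n, of "(r, \<zeta>)"] that by (simp add: dist_real_def)
        qed
        also have "\<dots> < e"
        proof -
          have "K * d < (K + 1) * d" using d by simp
          also have "\<dots> = e" using K by (simp add: d_def)
          finally show ?thesis .
        qed
        finally show "norm (DG (P n) r \<zeta> - DG U r \<zeta>) < e"
          using DG_combine[OF space_E_cont_rect[OF P0] space_E_cont_rect[OF UE] rz, of n "-1"] by simp
      qed
    qed
    have "(\<lambda>n. P (Suc n) r \<zeta> - u 0 r \<zeta>) \<longlonglongrightarrow> U r \<zeta> - u 0 r \<zeta>"
      unfolding P_def U_def using summable_LIMSEQ[OF sm[OF rz]]
      by (intro tendsto_diff tendsto_const LIMSEQ_Suc)
    with lim1 have "DG U r \<zeta> = U r \<zeta> - u 0 r \<zeta>"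
      unfolding DP by (rule LIMSEQ_unique)
    then show "lin U r \<zeta> = u 0 r \<zeta>" by simp
  qed
qed

end

section \<open>Structure and sign of the linear response\<close>

lemma P2_component_zonal:
  assumes "\<And>\<zeta>. \<zeta> \<in> {-1..1} \<Longrightarrow> h r \<zeta> = v - y * P2 \<zeta>"
  shows "P2_component h r = - y"
proof -
  let ?G = "\<lambda>\<zeta>. v * (\<zeta> ^ 3 / 2 - \<zeta> / 2) - y * (9 * \<zeta> ^ 5 / 20 - \<zeta> ^ 3 / 2 + \<zeta> / 4)"
  have "((\<lambda>\<zeta>. (v - y * P2 \<zeta>) * P2 \<zeta>) has_integral ?G 1 - ?G (-1)) {-1..1}"
  proof (rule fundamental_theorem_of_calculus)
    fix \<zeta> :: real
    have "(?G has_real_derivative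
        v * (3 * \<zeta>\<^sup>2 / 2 - 1 / 2) - y * (9 * (5 * \<zeta> ^ 4) / 20 - 3 * \<zeta>\<^sup>2 / 2 + 1 / 4)) (at \<zeta> within {-1..1})"
      by (auto intro!: derivative_eq_intros)
    also have "v * (3 * \<zeta>\<^sup>2 / 2 - 1 / 2) - y * (9 * (5 * \<zeta> ^ 4) / 20 - 3 * \<zeta>\<^sup>2 / 2 + 1 / 4) = (v - y * P2 \<zeta>) * P2 \<zeta>"
      by (simp add: P2_def field_simps power2_eq_square power4_eq_xxxx)
    finally show "(?G has_vector_derivative (v - y * P2 \<zeta>) * P2 \<zeta>) (at \<zeta> within {-1..1})"
      by (simp only: has_real_derivative_iff_has_vector_derivative)
  qed simp
  then have "integral {-1..1} (\<lambda>\<zeta>. (v - y * P2 \<zeta>) * P2 \<zeta>) = - (2 / 5) * y"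
    by (simp add: integral_unique field_simps)
  moreover have "integral {-1..1} (\<lambda>\<zeta>. h r \<zeta> * P2 \<zeta>) = integral {-1..1} (\<lambda>\<zeta>. (v - y * P2 \<zeta>) * P2 \<zeta>)"
    by (intro integral_cong) (simp add: assms)
  ultimately show ?thesis by (simp add: P2_component_def)
qed

context lane_emden_inverse
begin

text \<open>
  The operator \<open>DG\<close> on radial functions.
\<close>

definition volterra :: "(real \<Rightarrow> real) \<Rightarrow> real \<Rightarrow> real" where
  "volterra a r = integral {0..r} (\<lambda>s. stiffness s * a s * s\<^sup>2) / r - integral {0..r} (\<lambda>s. stiffness s * a s * s)"

lemma DG_radial:
  assumes a: "continuous_on {0..R} a" and r: "r \<in> {0..R}" and z: "\<zeta> \<in> {-1..1}"
  shows "DG (\<lambda>r \<zeta>. a r) r \<zeta> = volterra a r"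
proof (cases "r = 0")
  case True
  have c: "continuous_on {0..R} (\<lambda>s. stiffness s * a s)" by (intro continuous_intros stiffness_cont a)
  have "pot_K R (\<lambda>s \<eta>. stiffness s * a s) 0 \<zeta> = pot_K R (\<lambda>s \<eta>. stiffness s * a s) 0 0"
    using pot_K_radial[OF c _ z, of 0] pot_K_radial[OF c, of 0 0] R_pos by simp
  then show ?thesis unfolding DG_eq True by (simp add: volterra_def)
next
  case False
  have c: "continuous_on {0..R} (\<lambda>s. stiffness s * a s)" by (intro continuous_intros stiffness_cont a)
  show ?thesis unfolding DG_eq volterra_def
    by (rule pot_K_radial_difference[OF c _ _ z]) (use False r in auto)
qed

text \<open>
  The kernel \<open>s - s\<^sup>2 / r\<close> lies between 0 and \<open>s\<close> for \<open>s \<le> r\<close>, so every application gains a factor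
  \<open>A r\<^sup>2 / (2 n + 2)\<close>, which produces the factorial in \<open>radial_iter_bound\<close>.
\<close>

lemma volterra_bound:
  assumes a: "continuous_on {0..R} a" and r: "r \<in> {0..R}"
    and A: "\<And>s. s \<in> {0..R} \<Longrightarrow> stiffness s \<le> A"
    and B: "\<And>s. s \<in> {0..R} \<Longrightarrow> \<bar>a s\<bar> \<le> B * s ^ (2 * n)"
  shows "\<bar>volterra a r\<bar> \<le> A * B / (2 * real n + 2) * r ^ (2 * Suc n)"
proof (cases "r = 0")
  case False
  then have r0: "0 < r" "r \<le> R" using r by auto
  have ac: "continuous_on {0..r} a" "continuous_on {0..r} stiffness"
    using a stiffness_cont r0 by (auto intro: continuous_on_subset)
  have B0: "0 \<le> B" using order_trans[OF abs_ge_zero B[of R]] zero_less_power[OF R_pos, of "2 * n"] R_pos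
    by (auto simp: zero_le_mult_iff)
  have A0: "0 \<le> A" using A[of 0] stiffness_nonneg[of 0] R_pos by auto
  have i: "(\<lambda>s. stiffness s * a s * s\<^sup>2 / r) integrable_on {0..r}" "(\<lambda>s. stiffness s * a s * s) integrable_on {0..r}"
    using r0 by (intro integrable_continuous_real continuous_intros ac; simp)+
  have "volterra a r = integral {0..r} (\<lambda>s. stiffness s * a s * s\<^sup>2 / r - stiffness s * a s * s)"
    using i by (simp add: volterra_def integral_diff)
  also have "\<bar>\<dots>\<bar> \<le> integral {0..r} (\<lambda>s. A * B * s ^ (2 * n + 1))"
    unfolding real_norm_def[symmetric]
  proof (rule integral_norm_bound_integral)
    show "(\<lambda>s. stiffness s * a s * s\<^sup>2 / r - stiffness s * a s * s) integrable_on {0..r}"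
      using i by (rule integrable_diff)
    show "(\<lambda>s. A * B * s ^ (2 * n + 1)) integrable_on {0..r}"
      by (intro integrable_continuous_real continuous_intros)
    fix s assume s: "s \<in> {0..r}"
    have "stiffness s * a s * s\<^sup>2 / r - stiffness s * a s * s = - (stiffness s * a s * (s * (1 - s / r)))"
      using r0 by (simp add: field_simps power2_eq_square)
    then have "\<bar>stiffness s * a s * s\<^sup>2 / r - stiffness s * a s * s\<bar> = stiffness s * \<bar>a s\<bar> * \<bar>s * (1 - s / r)\<bar>"
      using stiffness_nonneg[of s] by (simp add: abs_mult)
    also have "\<bar>s * (1 - s / r)\<bar> = s * (1 - s / r)" using s r0 by (intro abs_of_nonneg mult_nonneg_nonneg) auto
    also have "stiffness s * \<bar>a s\<bar> * (s * (1 - s / r)) \<le> A * (B * s ^ (2 * n)) * (s * 1)"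
      using s r0 A[of s] B[of s] A0 B0 stiffness_nonneg[of s]
      by (intro mult_mono mult_nonneg_nonneg) auto
    finally show "norm (stiffness s * a s * s\<^sup>2 / r - stiffness s * a s * s) \<le> A * B * s ^ (2 * n + 1)"
      by (simp add: mult_ac)
  qed
  also have "\<dots> = A * B / (2 * real n + 2) * r ^ (2 * Suc n)"
  proof -
    have "((\<lambda>s. A * B * s ^ (2 * n + 1)) has_integral
        A * B / (2 * real n + 2) * r ^ (2 * n + 2) - A * B / (2 * real n + 2) * 0 ^ (2 * n + 2)) {0..r}"
    proof (rule fundamental_theorem_of_calculus)
      fix s assume "s \<in> {0..r}"
      have "((\<lambda>s. A * B / (2 * real n + 2) * s ^ (2 * n + 2)) has_real_derivative
          A * B / (2 * real n + 2) * (real (2 * n + 2) * s ^ (2 * n + 2 - Suc 0))) (at s within {0..r})"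
        by (intro DERIV_cmult DERIV_pow)
      moreover have "A * B / (2 * real n + 2) * (real (2 * n + 2) * s ^ (2 * n + 2 - Suc 0)) = A * B * s ^ (2 * n + 1)"
      proof -
        have cancel: "X / q * (q * t) = X * t" if "q \<noteq> 0" for X q t :: real using that by simp
        have q: "real (2 * n + 2) = 2 * real n + 2" "2 * real n + 2 \<noteq> 0" "2 * n + 2 - Suc 0 = 2 * n + 1"
          by linarith+
        show ?thesis unfolding q(1) q(3) by (rule cancel[OF q(2)])
      qed
      ultimately show "((\<lambda>s. A * B / (2 * real n + 2) * s ^ (2 * n + 2)) has_vector_derivative A * B * s ^ (2 * n + 1))
          (at s within {0..r})"
        by (simp only: has_real_derivative_iff_has_vector_derivative)
    qed (use r0 in simp)
    from integral_unique[OF this] show ?thesis by simp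
  qed
  finally show ?thesis .
qed (simp add: volterra_def)

lemma DG_P2:
  assumes a: "continuous_on {0..R} a" and r: "r \<in> {0..R}" and z: "\<zeta> \<in> {-1..1}"
  shows "DG (\<lambda>r \<zeta>. a r * P2 \<zeta>) r \<zeta> = (if r = 0 then 0 else quad a r) * P2 \<zeta>"
proof -
  have c: "continuous_on {0..R} (\<lambda>s. stiffness s * a s)" by (intro continuous_intros stiffness_cont a)
  have 0: "pot_K R (\<lambda>s \<eta>. stiffness s * a s * P2 \<eta>) 0 \<eta> = 0" if "\<eta> \<in> {-1..1}" for \<eta>
  proof -
    have "(\<integral>s. indicator {0..R} s * (stiffness s * a s * (s\<^sup>2 * (min 0 s)\<^sup>2 / (5 * (max 0 s) ^ 3))) \<partial>lborel) =
        (\<integral>s. 0 \<partial>(lborel :: real measure))"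
      by (intro Bochner_Integration.integral_cong) (auto simp: indicator_def)
    then show ?thesis using pot_K_P2[OF c _ that, of 0] R_pos by simp
  qed
  have eq: "(\<lambda>s \<eta>. stiffness s * (a s * P2 \<eta>)) = (\<lambda>s \<eta>. stiffness s * a s * P2 \<eta>)"
    by (simp add: mult.assoc)
  show ?thesis
  proof (cases "r = 0")
    case True
    then show ?thesis unfolding DG_eq eq using 0[OF z] 0[of 0] by simp
  next
    case False
    then have r0: "0 < r" using r by simp
    have kc: "continuous_on {0..R} (\<lambda>s. stiffness s * a s * (s\<^sup>2 * (min r s)\<^sup>2 / (5 * (max r s) ^ 3)))"
      by (intro continuous_on_mult c quad_kernel_cont[OF r0])
    have "pot_K R (\<lambda>s \<eta>. stiffness s * a s * P2 \<eta>) r \<zeta> = P2 \<zeta> * quad a r"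
      unfolding pot_K_P2[OF c r z] quad_def integral_Icc_lborel[OF kc] ..
    then show ?thesis unfolding DG_eq eq using 0[of 0] False by simp
  qed
qed

primrec radial_iter :: "nat \<Rightarrow> real \<Rightarrow> real" where
  "radial_iter 0 r = r\<^sup>2 / 6"
| "radial_iter (Suc n) r = volterra (radial_iter n) r"

primrec quad_iter :: "nat \<Rightarrow> real \<Rightarrow> real" where
  "quad_iter 0 r = r\<^sup>2 / 6"
| "quad_iter (Suc n) r = (if r = 0 then 0 else quad (quad_iter n) r)"

lemma radial_iter_space_E: "(\<lambda>r \<zeta>. radial_iter n r) \<in> space_E R"
  and radial_iter_cont: "continuous_on {0..R} (radial_iter n)"
  and radial_iter_step: "eq_E R (\<lambda>r \<zeta>. radial_iter (Suc n) r) (DG (\<lambda>r \<zeta>. radial_iter n r))"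
proof -
  have step: "eq_E R (DG (\<lambda>r \<zeta>. radial_iter n r)) (\<lambda>r \<zeta>. radial_iter (Suc n) r)"
    if "continuous_on {0..R} (radial_iter n)" for n
    using DG_radial[OF that] by (simp add: eq_E_def)
  have E: "(\<lambda>r \<zeta>. radial_iter n r) \<in> space_E R \<and> continuous_on {0..R} (radial_iter n)" for n
  proof (induction n)
    case 0
    have "continuous_on {0..R} (radial_iter 0)"
      by (simp add: continuous_intros)
    then show ?case using space_E_radial by blast
  next
    case (Suc n)
    then have "(\<lambda>r \<zeta>. radial_iter (Suc n) r) \<in> space_E R"
      using space_E_cong[OF DG_space_E step] R_pos by simp
    then show ?case using cont_rect_slice[OF space_E_cont_rect, of "\<lambda>r \<zeta>. radial_iter (Suc n) r" R 0] by simp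
  qed
  then show "(\<lambda>r \<zeta>. radial_iter n r) \<in> space_E R" "continuous_on {0..R} (radial_iter n)" by auto
  then show "eq_E R (\<lambda>r \<zeta>. radial_iter (Suc n) r) (DG (\<lambda>r \<zeta>. radial_iter n r))"
    using step[of n] by (simp add: eq_E_def)
qed

lemma quad_iter_space_E: "(\<lambda>r \<zeta>. quad_iter n r * P2 \<zeta>) \<in> space_E R"
  and quad_iter_cont: "continuous_on {0..R} (quad_iter n)"
  and quad_iter_step: "eq_E R (\<lambda>r \<zeta>. quad_iter (Suc n) r * P2 \<zeta>) (DG (\<lambda>r \<zeta>. quad_iter n r * P2 \<zeta>))"
proof -
  have step: "eq_E R (DG (\<lambda>r \<zeta>. quad_iter n r * P2 \<zeta>)) (\<lambda>r \<zeta>. quad_iter (Suc n) r * P2 \<zeta>)"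
    if "continuous_on {0..R} (quad_iter n)" for n
    using DG_P2[OF that] by (simp add: eq_E_def)
  have P: "continuous_on UNIV P2" unfolding P2_def by (intro continuous_intros)
  have E: "(\<lambda>r \<zeta>. quad_iter n r * P2 \<zeta>) \<in> space_E R \<and> continuous_on {0..R} (quad_iter n)" for n
  proof (induction n)
    case 0
    have c: "continuous_on {0..R} (quad_iter 0)"
      by (simp add: continuous_intros)
    have "(\<lambda>r \<zeta>. quad_iter 0 r * P2 \<zeta>) \<in> space_E R"
      by (rule space_EI[OF cont_rect_zonal[OF c P]]) (simp_all add: P2_def)
    with c show ?case by blast
  next
    case (Suc n)
    then have E: "(\<lambda>r \<zeta>. quad_iter (Suc n) r * P2 \<zeta>) \<in> space_E R"
      using space_E_cong[OF DG_space_E step] R_pos by simp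
    have "continuous_on {0..R} (\<lambda>r. quad_iter (Suc n) r * P2 1)"
      using cont_rect_slice[OF space_E_cont_rect[OF E], of 1] by simp
    then have "continuous_on {0..R} (quad_iter (Suc n))" by (simp add: P2_def)
    with E show ?case by blast
  qed
  then show "(\<lambda>r \<zeta>. quad_iter n r * P2 \<zeta>) \<in> space_E R" "continuous_on {0..R} (quad_iter n)" by auto
  then show "eq_E R (\<lambda>r \<zeta>. quad_iter (Suc n) r * P2 \<zeta>) (DG (\<lambda>r \<zeta>. quad_iter n r * P2 \<zeta>))"
    using step[of n] by (simp add: eq_E_def)
qed

lemma radial_iter_bound:
  obtains A where "0 < A" "\<And>n r. r \<in> {0..R} \<Longrightarrow> \<bar>radial_iter n r\<bar> \<le> R\<^sup>2 * ((A * R\<^sup>2) ^ n / fact n)"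
proof -
  obtain A where A: "0 < A" "\<And>s. s \<in> {0..R} \<Longrightarrow> stiffness s \<le> A" using stiffness_bounded by metis
  have b: "\<bar>radial_iter n r\<bar> \<le> R\<^sup>2 * A ^ n / fact n * r ^ (2 * n)" if "r \<in> {0..R}" for n r
    using that
  proof (induction n arbitrary: r)
    case 0
    have "r\<^sup>2 \<le> R\<^sup>2" using 0 by (intro power_mono) auto
    then have "r\<^sup>2 / 6 \<le> R\<^sup>2" using zero_le_power2[of R] by linarith
    then show ?case by simp
  next
    case (Suc n)
    have "\<bar>volterra (radial_iter n) r\<bar> \<le> A * (R\<^sup>2 * A ^ n / fact n) / (2 * real n + 2) * r ^ (2 * Suc n)"
      by (rule volterra_bound[OF radial_iter_cont Suc.prems A(2) Suc.IH])
    also have "\<dots> \<le> R\<^sup>2 * A ^ Suc n / fact (Suc n) * r ^ (2 * Suc n)"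
    proof (rule mult_right_mono)
      have "A * (R\<^sup>2 * A ^ n / fact n) / (2 * real n + 2) \<le> A * (R\<^sup>2 * A ^ n / fact n) / (real n + 1)"
        using A by (intro divide_left_mono) auto
      also have "\<dots> = R\<^sup>2 * A ^ Suc n / fact (Suc n)" by (simp add: field_simps)
      finally show "A * (R\<^sup>2 * A ^ n / fact n) / (2 * real n + 2) \<le> R\<^sup>2 * A ^ Suc n / fact (Suc n)" .
    qed (use Suc.prems in simp)
    finally show ?case by simp
  qed
  have "\<bar>radial_iter n r\<bar> \<le> R\<^sup>2 * ((A * R\<^sup>2) ^ n / fact n)" if r: "r \<in> {0..R}" for n r
  proof -
    have "R\<^sup>2 * A ^ n / fact n * r ^ (2 * n) \<le> R\<^sup>2 * A ^ n / fact n * R ^ (2 * n)"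
      using r A by (intro mult_left_mono power_mono) auto
    also have "\<dots> = R\<^sup>2 * ((A * R\<^sup>2) ^ n / fact n)" by (simp add: power_mult_distrib power_mult)
    finally show ?thesis using b[OF r, of n] by linarith
  qed
  with A show ?thesis using that by blast
qed

text \<open>
  Comparison with the supersolution: \<open>quad_iter n \<le> C * (3 / 5) ^ n * slope\<close>, and the kernel is
  nonnegative.
\<close>

lemma quad_iter_bound:
  obtains C where "0 < C" "\<And>n r. r \<in> {0..R} \<Longrightarrow> 0 \<le> quad_iter n r \<and> quad_iter n r \<le> C * (3 / 5) ^ n"
proof -
  obtain C where C: "0 < C" "\<And>r. r \<in> {0..R} \<Longrightarrow> r\<^sup>2 \<le> C * slope r" using square_le_slope by metis
  have b: "0 \<le> quad_iter n r \<and> quad_iter n r \<le> C * (3 / 5) ^ n * slope r" if "r \<in> {0..R}" for n r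
    using that
  proof (induction n arbitrary: r)
    case 0
    then have "r\<^sup>2 / 6 \<le> C * slope r" using C(2)[OF 0] zero_le_power2[of r] by linarith
    then show ?case by simp
  next
    case (Suc n)
    show ?case
    proof (cases "r = 0")
      case False
      then have r: "0 < r" "r \<le> R" using Suc.prems by auto
      have "quad (\<lambda>s. 0) r \<le> quad (quad_iter n) r"
        by (rule quad_mono[OF r(1) _ quad_iter_cont]) (use Suc.IH in auto)
      then have 1: "0 \<le> quad (quad_iter n) r" by (simp add: quad_def)
      have "quad (quad_iter n) r \<le> quad (\<lambda>s. C * (3 / 5) ^ n * slope s) r"
        by (rule quad_mono[OF r(1) quad_iter_cont]) (use Suc.IH in \<open>auto intro!: continuous_intros slope_cont\<close>)
      also have "\<dots> = C * (3 / 5) ^ n * quad slope r" by (rule quad_scale)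
      also have "\<dots> \<le> C * (3 / 5) ^ n * (3 / 5 * slope r)"
        using C by (intro mult_left_mono quad_slope r) auto
      finally show ?thesis using 1 False by simp
    qed simp
  qed
  have "bounded (slope ` {0..R})"
    using slope_cont by (intro compact_imp_bounded compact_continuous_image) auto
  then obtain B where B: "0 < B" "\<And>s. s \<in> {0..R} \<Longrightarrow> \<bar>slope s\<bar> \<le> B"
    unfolding bounded_pos by auto
  have "0 \<le> quad_iter n r \<and> quad_iter n r \<le> C * B * (3 / 5) ^ n" if r: "r \<in> {0..R}" for n r
  proof -
    have "C * (3 / 5) ^ n * slope r \<le> C * (3 / 5) ^ n * B"
      using C B(2)[OF r] by (intro mult_left_mono) auto
    then show ?thesis using b[OF r, of n] by (simp add: mult_ac)
  qed
  moreover have "0 < C * B" using B C by simp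
  ultimately show ?thesis using that by blast
qed

lemma g1_eq: "g1 r \<zeta> = r\<^sup>2 / 6 + (-1) * (r\<^sup>2 / 6 * P2 \<zeta>)"
  by (simp add: g1_def P2_def field_simps)

lemma g1_space_E: "g1 \<in> space_E R"
proof (rule space_EI)
  show "cont_rect R g1" unfolding cont_rect_def g1_def case_prod_unfold by (intro continuous_intros)
qed (simp_all add: g1_def)

lemma linear_response:
  shows "S g1 \<in> space_E R" "eq_E R (lin (S g1)) g1"
  using inv g1_space_E by (simp_all add: bounded_inverse_E_def)

text \<open>
  The two Neumann series add up to a preimage of \<open>g1\<close>, which by injectivity is the response. Positivity
  of \<open>y\<close> comes from its first term \<open>r\<^sup>2 / 6\<close>, the others being nonnegative.
\<close>

theorem linear_response_structure:
  obtains v y where "\<And>r \<zeta>. r \<in> {0..R} \<Longrightarrow> \<zeta> \<in> {-1..1} \<Longrightarrow> S g1 r \<zeta> = v r - y r * P2 \<zeta>"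
    and "\<And>r. 0 < r \<Longrightarrow> r \<le> R \<Longrightarrow> 0 < y r"
proof -
  define v y where "v r = (\<Sum>n. radial_iter n r)" and "y r = (\<Sum>n. quad_iter n r)" for r
  obtain A where A: "0 < A" "\<And>n r. r \<in> {0..R} \<Longrightarrow> \<bar>radial_iter n r\<bar> \<le> R\<^sup>2 * ((A * R\<^sup>2) ^ n / fact n)"
    using radial_iter_bound by metis
  have sA: "summable (\<lambda>n. R\<^sup>2 * ((A * R\<^sup>2) ^ n / fact n))"
    using summable_exp[of "A * R\<^sup>2"] by (intro summable_mult) (simp add: field_simps)
  obtain C where C: "0 < C" "\<And>n r. r \<in> {0..R} \<Longrightarrow> 0 \<le> quad_iter n r \<and> quad_iter n r \<le> C * (3 / 5) ^ n"
    using quad_iter_bound by metis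
  have sC: "summable (\<lambda>n. C * (3 / 5 :: real) ^ n)"
    by (intro summable_mult summable_geometric) simp
  have sy: "summable (\<lambda>n. quad_iter n r)" if "r \<in> {0..R}" for r
    by (rule summable_comparison_test'[OF sC]) (use C(2)[OF that] in simp)
  let ?V = "\<lambda>r \<zeta>. \<Sum>n. (\<lambda>r \<zeta>. radial_iter n r) r \<zeta>"
  let ?Y = "\<lambda>r \<zeta>. \<Sum>n. (\<lambda>r \<zeta>. quad_iter n r * P2 \<zeta>) r \<zeta>"
  have V: "?V \<in> space_E R" "eq_E R (lin ?V) (\<lambda>r \<zeta>. radial_iter 0 r)"
    by (rule neumann_series[OF radial_iter_space_E radial_iter_step A(2) sA]; simp)+
  have Yb: "\<bar>quad_iter n r * P2 \<zeta>\<bar> \<le> C * (3 / 5) ^ n" if "r \<in> {0..R}" "\<zeta> \<in> {-1..1}" for n r \<zeta>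
  proof -
    have "\<bar>quad_iter n r\<bar> * \<bar>P2 \<zeta>\<bar> \<le> C * (3 / 5) ^ n * 1"
      using C that abs_P2_le by (intro mult_mono) auto
    then show ?thesis by (simp add: abs_mult)
  qed
  have Y: "?Y \<in> space_E R" "eq_E R (lin ?Y) (\<lambda>r \<zeta>. quad_iter 0 r * P2 \<zeta>)"
    by (rule neumann_series[OF quad_iter_space_E quad_iter_step Yb sC]; simp)+
  let ?U = "\<lambda>r \<zeta>. ?V r \<zeta> + (-1) * ?Y r \<zeta>"
  have U: "?U \<in> space_E R" by (rule space_E_combine[OF V(1) Y(1)])
  have "eq_E R (lin ?U) (lin (S g1))"
    unfolding eq_E_def
  proof (intro ballI)
    fix r \<zeta> assume rz: "r \<in> {0..R}" "\<zeta> \<in> {-1..1::real}"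
    have "lin ?U r \<zeta> = lin ?V r \<zeta> + (-1) * lin ?Y r \<zeta>"
      by (rule lin_combine[OF space_E_cont_rect[OF V(1)] space_E_cont_rect[OF Y(1)] rz])
    also have "lin ?V r \<zeta> = r\<^sup>2 / 6" using V(2)[unfolded eq_E_def, rule_format, OF rz] by simp
    also have "lin ?Y r \<zeta> = r\<^sup>2 / 6 * P2 \<zeta>" using Y(2)[unfolded eq_E_def, rule_format, OF rz] by simp
    also have "r\<^sup>2 / 6 + (-1) * (r\<^sup>2 / 6 * P2 \<zeta>) = g1 r \<zeta>" by (rule g1_eq[symmetric])
    also have "\<dots> = lin (S g1) r \<zeta>" using linear_response(2) rz by (simp add: eq_E_def)
    finally show "lin ?U r \<zeta> = lin (S g1) r \<zeta>" .
  qed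
  then have eq: "eq_E R ?U (S g1)" by (rule lin_injective[OF U linear_response(1)])
  show ?thesis
  proof (rule that)
    fix r \<zeta> assume rz: "r \<in> {0..R}" "\<zeta> \<in> {-1..1::real}"
    have "S g1 r \<zeta> = ?U r \<zeta>" using eq rz by (simp add: eq_E_def)
    also have "(\<Sum>n. quad_iter n r * P2 \<zeta>) = y r * P2 \<zeta>"
      unfolding y_def by (rule suminf_mult2[OF sy[OF rz(1)], symmetric])
    finally show "S g1 r \<zeta> = v r - y r * P2 \<zeta>" by (simp add: v_def)
  next
    fix r :: real assume r: "0 < r" "r \<le> R"
    have "0 < quad_iter 0 r" using r by simp
    then show "0 < y r" unfolding y_def
      using sy[of r] C(2)[of r] r by (intro suminf_pos2[of _ 0]) auto
  qed
qed

end

section \<open>Expansion of the distorted profile and of its boundary\<close>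

lemma powr_subadditive:
  fixes x y p :: real
  assumes "0 \<le> x" "0 \<le> y" "0 < p" "p \<le> 1"
  shows "(x + y) powr p \<le> x powr p + y powr p"
proof (cases "x + y = 0")
  case False
  then have s: "0 < x + y" using assms by simp
  have le: "t \<le> t powr p" if "0 \<le> t" "t \<le> 1" for t :: real
    using powr_mono'[of p 1 t] assms that by simp
  have "1 = x / (x + y) + y / (x + y)" using s by (simp add: add_divide_distrib[symmetric])
  also have "\<dots> \<le> (x / (x + y)) powr p + (y / (x + y)) powr p"
    using s assms by (intro add_mono le) auto
  also have "\<dots> = (x powr p + y powr p) / (x + y) powr p"
    using s assms by (simp add: powr_divide add_divide_distrib)
  finally show ?thesis using s by (simp add: field_simps)
qed (use assms in simp)

lemma positive_part_powr_holder:
  fixes a b p :: real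
  assumes "0 < p" "p \<le> 1"
  shows "\<bar>max a 0 powr p - max b 0 powr p\<bar> \<le> \<bar>a - b\<bar> powr p"
proof -
  have *: "\<bar>max a 0 powr p - max b 0 powr p\<bar> \<le> \<bar>a - b\<bar> powr p" if "b \<le> a" for a b :: real
  proof -
    have "max b 0 powr p \<le> max a 0 powr p" using assms that by (intro powr_mono2) auto
    moreover have "max a 0 powr p \<le> (max b 0 + (a - b)) powr p"
      using assms that by (intro powr_mono2) auto
    moreover have "(max b 0 + (a - b)) powr p \<le> max b 0 powr p + (a - b) powr p"
      using assms that by (intro powr_subadditive) auto
    ultimately show ?thesis using that by simp
  qed
  show ?thesis using *[of b a] *[of a b] by (cases "b \<le> a") (simp_all add: abs_minus_commute)
qed

text \<open>
  For \<open>1 < p \<le> 2\<close> the derivative is Hoelder continuous with exponent \<open>p - 1\<close>, and the mean value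
  theorem contributes the missing factor \<open>|w|\<close>. This is where the exponent \<open>\<nu>\<close> of the error terms
  originates.
\<close>

lemma positive_part_powr_taylor:
  fixes t w p :: real
  assumes "1 < p" "p \<le> 2"
  shows "\<bar>max (t + w) 0 powr p - max t 0 powr p - p * max t 0 powr (p - 1) * w\<bar> \<le> p * \<bar>w\<bar> powr p"
proof -
  let ?g = "\<lambda>s. max (t + s * w) 0 powr p - s * (p * max t 0 powr (p - 1) * w)"
  let ?g' = "\<lambda>s. p * max (t + s * w) 0 powr (p - 1) * w - p * max t 0 powr (p - 1) * w"
  have d: "(?g has_real_derivative ?g' s) (at s)" for s
  proof -
    have "((\<lambda>s. t + s * w) has_real_derivative w) (at s)" by (auto intro!: derivative_eq_intros)
    note DERIV_chain2[OF powr_pos_part_deriv[OF assms(1)] this]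
    moreover have "((\<lambda>s. s * (p * max t 0 powr (p - 1) * w)) has_real_derivative p * max t 0 powr (p - 1) * w) (at s)"
      by (auto intro!: derivative_eq_intros)
    ultimately show ?thesis by (rule DERIV_diff)
  qed
  have "\<bar>?g 1 - ?g 0\<bar> \<le> p * \<bar>w\<bar> powr p * \<bar>1 - 0\<bar>"
  proof (rule mvt_bound[where a=0 and b=1 and f'="?g'"])
    show "continuous_on {0..1} ?g"
      using d by (intro continuous_at_imp_continuous_on ballI DERIV_isCont)
    fix s :: real assume s: "0 < s" "s < 1"
    show "(?g has_real_derivative ?g' s) (at s)" by (rule d)
    have "?g' s = p * w * (max (t + s * w) 0 powr (p - 1) - max t 0 powr (p - 1))"
      by (simp add: algebra_simps)
    then have "\<bar>?g' s\<bar> = p * \<bar>w\<bar> * \<bar>max (t + s * w) 0 powr (p - 1) - max t 0 powr (p - 1)\<bar>"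
      using assms by (simp add: abs_mult)
    also have "\<dots> \<le> p * \<bar>w\<bar> * \<bar>(t + s * w) - t\<bar> powr (p - 1)"
      using assms by (intro mult_left_mono positive_part_powr_holder) auto
    also have "\<bar>(t + s * w) - t\<bar> powr (p - 1) \<le> \<bar>w\<bar> powr (p - 1)"
      using assms s by (intro powr_mono2) (auto simp: abs_mult mult_left_le_one_le)
    also have "p * \<bar>w\<bar> * \<bar>w\<bar> powr (p - 1) = p * \<bar>w\<bar> powr p"
      by (cases "w = 0") (simp_all add: powr_diff)
    finally show "\<bar>?g' s\<bar> \<le> p * \<bar>w\<bar> powr p" using assms by (simp add: mult_left_mono)
  qed auto
  then show ?thesis by (simp add: algebra_simps)
qed

lemma vacuum_boundary_zero:
  assumes u: "u \<in> space_E R" and X: "vacuum_boundary R u \<Xi>" and z: "\<zeta> \<in> {-1..1}"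
  shows "u (\<Xi> \<zeta>) \<zeta> = 0"
proof -
  have x: "0 < \<Xi> \<zeta>" "\<Xi> \<zeta> < R" and pos: "\<And>r. r \<in> {0..R} \<Longrightarrow> 0 < u r \<zeta> \<longleftrightarrow> r < \<Xi> \<zeta>"
    using X z by (auto simp: vacuum_boundary_def)
  have "continuous_on {0..\<Xi> \<zeta>} (\<lambda>r. u r \<zeta>)"
    using cont_rect_slice[OF space_E_cont_rect[OF u] z] x by (auto intro: continuous_on_subset)
  then have "((\<lambda>r. u r \<zeta>) \<longlongrightarrow> u (\<Xi> \<zeta>) \<zeta>) (at (\<Xi> \<zeta>) within {0..\<Xi> \<zeta>})"
    unfolding continuous_on by (rule bspec) (use x in simp)
  then have "((\<lambda>r. u r \<zeta>) \<longlongrightarrow> u (\<Xi> \<zeta>) \<zeta>) (at_left (\<Xi> \<zeta>))"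
    using x by (simp add: at_within_Icc_at_left)
  moreover have "\<forall>\<^sub>F r in at_left (\<Xi> \<zeta>). 0 \<le> u r \<zeta>"
    using eventually_at_left_real[OF x(1)] by eventually_elim (use pos x in \<open>force intro: less_imp_le\<close>)
  ultimately have "0 \<le> u (\<Xi> \<zeta>) \<zeta>" by (rule tendsto_lowerbound) simp
  moreover have "\<not> 0 < u (\<Xi> \<zeta>) \<zeta>" using pos[of "\<Xi> \<zeta>"] x by simp
  ultimately show ?thesis by simp
qed

context lane_emden_inverse
begin

lemma linear_response_Lipschitz:
  obtains \<Lambda> where "0 \<le> \<Lambda>" "\<And>r r' \<zeta>. r \<in> {0..R} \<Longrightarrow> r' \<in> {0..R} \<Longrightarrow> \<zeta> \<in> {-1..1} \<Longrightarrow>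
    \<bar>S g1 r \<zeta> - S g1 r' \<zeta>\<bar> \<le> \<Lambda> * \<bar>r - r'\<bar>"
proof -
  let ?f = "\<lambda>s \<eta>. stiffness s * S g1 s \<eta>"
  have f: "cont_rect R ?f"
    by (rule cont_rect_stiffness[OF space_E_cont_rect[OF linear_response(1)]])
  obtain M where M: "0 \<le> M" "\<And>r \<zeta>. r \<in> {0..R} \<Longrightarrow> \<zeta> \<in> {-1..1} \<Longrightarrow> \<bar>?f r \<zeta>\<bar> \<le> M"
    using cont_rect_bounded[OF f] by metis
  have "\<bar>S g1 r \<zeta> - S g1 r' \<zeta>\<bar> \<le> (R / 2 + 2 * R * M) * \<bar>r - r'\<bar>"
    if r: "r \<in> {0..R}" "r' \<in> {0..R}" and z: "\<zeta> \<in> {-1..1}" for r r' \<zeta>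
  proof -
    have h: "S g1 t \<zeta> = g1 t \<zeta> + (pot_K R ?f t \<zeta> - pot_K R ?f 0 0)" if "t \<in> {0..R}" for t
      using linear_response(2)[unfolded eq_E_def, rule_format, OF that z] by (simp add: DG_eq)
    have "\<bar>g1 r \<zeta> - g1 r' \<zeta>\<bar> \<le> R / 2 * \<bar>r - r'\<bar>"
    proof -
      have z1: "0 \<le> 1 - \<zeta>\<^sup>2" "1 - \<zeta>\<^sup>2 \<le> 1" using z by (simp_all add: abs_square_le_1 abs_le_iff)
      have "g1 r \<zeta> - g1 r' \<zeta> = 1 / 4 * (1 - \<zeta>\<^sup>2) * (r + r') * (r - r')"
        unfolding g1_def power2_eq_square by (simp add: field_simps)
      moreover have "\<bar>1 / 4 * (1 - \<zeta>\<^sup>2) * (r + r') * (r - r')\<bar> = 1 / 4 * (1 - \<zeta>\<^sup>2) * (r + r') * \<bar>r - r'\<bar>"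
        using z1 r by (simp add: abs_mult)
      ultimately have "\<bar>g1 r \<zeta> - g1 r' \<zeta>\<bar> = 1 / 4 * (1 - \<zeta>\<^sup>2) * (r + r') * \<bar>r - r'\<bar>"
        by (simp only:)
      also have "\<dots> \<le> 1 / 4 * 1 * (R + R) * \<bar>r - r'\<bar>"
        using z1 r by (intro mult_right_mono mult_mono) auto
      finally show ?thesis by simp
    qed
    moreover have "\<bar>pot_K R ?f r \<zeta> - pot_K R ?f r' \<zeta>\<bar> \<le> 2 * R * M * \<bar>r - r'\<bar>"
      using M(2) by (intro pot_K_Lipschitz[OF f r z])
    ultimately show ?thesis unfolding h[OF r(1)] h[OF r(2)] distrib_right by linarith
  qed
  moreover have "0 \<le> R / 2 + 2 * R * M" using M R_pos by simp
  ultimately show ?thesis using that by blast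
qed

text \<open>
  Subtracting the equations for \<open>u\<close> and \<open>\<theta>\<close> leaves the potential of the pointwise Taylor remainder.
\<close>

lemma linearization_remainder:
  assumes nu2: "\<nu> < 2" and u: "u \<in> space_E R" and eqn: "distorted_eqn \<nu> R \<beta> u"
  defines "w \<equiv> \<lambda>r \<zeta>. u r \<zeta> + (-1) * \<theta> r"
  shows "w \<in> space_E R"
    and "\<And>r \<zeta>. r \<in> {0..R} \<Longrightarrow> \<zeta> \<in> {-1..1} \<Longrightarrow>
      \<bar>lin w r \<zeta> - \<beta> * g1 r \<zeta>\<bar> \<le> 2 * (R ^ 3 / 3 + 2 * R) * (\<nu> * norm_E R w powr \<nu>)"
proof -
  show w: "w \<in> space_E R"
    unfolding w_def by (rule space_E_combine[OF u space_E_radial[OF theta_cont]])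
  fix r \<zeta> assume rz: "r \<in> {0..R}" "\<zeta> \<in> {-1..1::real}"
  have uw: "u s \<eta> = \<theta> s + w s \<eta>" for s \<eta> by (simp add: w_def)
  define f where "f s \<eta> = max (u s \<eta>) 0 powr \<nu>" for s \<eta>
  let ?sw = "\<lambda>s \<eta>. stiffness s * w s \<eta>"
  define q where "q s \<eta> = f s \<eta> - source s - ?sw s \<eta>" for s \<eta>
  have fc: "cont_rect R f"
    using space_E_cont_rect[OF u] nu unfolding cont_rect_def f_def case_prod_unfold
    by (intro continuous_on_powr' continuous_intros) auto
  have sc: "cont_rect R (\<lambda>s \<eta>. source s)"
    by (rule space_E_cont_rect[OF space_E_radial[OF source_cont]])
  have swc: "cont_rect R ?sw" by (rule cont_rect_stiffness[OF space_E_cont_rect[OF w]])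
  have qc: "cont_rect R q"
    using fc sc swc unfolding cont_rect_def q_def case_prod_unfold
    by (intro continuous_on_diff)
  have sswc: "cont_rect R (\<lambda>s \<eta>. source s + ?sw s \<eta>)"
    using sc swc unfolding cont_rect_def case_prod_unfold
    by (intro continuous_on_add)
  have qb: "\<bar>q s \<eta>\<bar> \<le> \<nu> * norm_E R w powr \<nu>" if "s \<in> {0..R}" "\<eta> \<in> {-1..1}" for s \<eta>
  proof -
    have "\<bar>q s \<eta>\<bar> \<le> \<nu> * \<bar>w s \<eta>\<bar> powr \<nu>"
      using positive_part_powr_taylor[of \<nu> "\<theta> s" "w s \<eta>"] nu nu2
      by (simp add: q_def f_def uw source_def stiffness_def)
    also have "\<dots> \<le> \<nu> * norm_E R w powr \<nu>"
      using nu abs_le_norm_E[OF space_E_cont_rect[OF w] that] by (intro mult_left_mono powr_mono2) auto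
    finally show ?thesis .
  qed
  have split: "pot_K R f t \<eta> = pot_K R q t \<eta> + (pot_K R (\<lambda>s \<eta>. source s) t \<eta> + pot_K R ?sw t \<eta>)"
    if "t \<in> {0..R}" "\<eta> \<in> {-1..1}" for t \<eta>
  proof -
    have "f = (\<lambda>s \<eta>. q s \<eta> + (source s + ?sw s \<eta>))" by (simp add: q_def fun_eq_iff)
    then have "pot_K R f t \<eta> = pot_K R (\<lambda>s \<eta>. q s \<eta> + (source s + ?sw s \<eta>)) t \<eta>" by simp
    also have "\<dots> = pot_K R q t \<eta> + pot_K R (\<lambda>s \<eta>. source s + ?sw s \<eta>) t \<eta>"
      by (rule pot_K_add[OF qc sswc that])
    also have "pot_K R (\<lambda>s \<eta>. source s + ?sw s \<eta>) t \<eta> = pot_K R (\<lambda>s \<eta>. source s) t \<eta> + pot_K R ?sw t \<eta>"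
      by (rule pot_K_add[OF sc swc that])
    finally show ?thesis .
  qed
  have G: "u r \<zeta> = \<beta> * g1 r \<zeta> + (1 + pot_K R f r \<zeta> - pot_K R f 0 0)"
    using eqn rz by (simp add: distorted_eqn_def eq_E_def op_G_def f_def[abs_def])
  have T: "\<theta> r = 1 + pot_K R (\<lambda>s \<eta>. source s) r \<zeta> - pot_K R (\<lambda>s \<eta>. source s) 0 0"
    using theta_fixed_point[OF rz] by (simp add: op_G_def source_def[abs_def])
  have "lin w r \<zeta> - \<beta> * g1 r \<zeta> = pot_K R q r \<zeta> - pot_K R q 0 0"
  proof -
    have 0: "(0::real) \<in> {0..R}" "(0::real) \<in> {-1..1}" using R_pos by auto
    have "w r \<zeta> = u r \<zeta> - \<theta> r" by (simp add: w_def)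
    then show ?thesis unfolding DG_eq using G T split[OF rz] split[OF 0] by linarith
  qed
  also have "\<bar>\<dots>\<bar> \<le> 2 * (R ^ 3 / 3 + 2 * R) * (\<nu> * norm_E R w powr \<nu>)"
    by (rule pot_K_difference_bound[OF qc rz qb])
  finally show "\<bar>lin w r \<zeta> - \<beta> * g1 r \<zeta>\<bar> \<le> 2 * (R ^ 3 / 3 + 2 * R) * (\<nu> * norm_E R w powr \<nu>)" .
qed

text \<open>
  With \<open>N\<close> the norm of \<open>\<Theta> - \<theta>\<close>, the bounded inverse gives \<open>|\<Theta> - \<theta> - \<beta> h| \<le> K * N powr \<nu>\<close>. As \<open>N\<close>
  tends to 0 and \<open>\<nu> > 1\<close>, the right hand side is eventually absorbed by \<open>N / 2\<close>, so \<open>N = O(\<beta>)\<close>, and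
  inserting this bound proves the expansion.
\<close>

theorem distorted_expansion:
  assumes nu2: "\<nu> < 2" and Theta: "distorted_lane_emden \<nu> R \<theta> \<beta>\<^sub>0 \<Theta>"
  obtains C where "0 \<le> C"
    "\<forall>\<^sub>F \<beta> in at_right 0. \<forall>r\<in>{0..R}. \<forall>\<zeta>\<in>{-1..1}. \<bar>\<Theta> \<beta> r \<zeta> - \<theta> r - \<beta> * S g1 r \<zeta>\<bar> \<le> C * \<beta> powr \<nu>"
proof -
  have b0: "0 < \<beta>\<^sub>0" using Theta by (simp add: distorted_lane_emden_def)
  obtain \<epsilon> where eps: "0 < \<epsilon>"
    and E: "\<And>\<beta>. \<beta> \<in> {0..\<beta>\<^sub>0} \<Longrightarrow> \<Theta> \<beta> \<in> space_E R"
    and eqn: "\<And>\<beta>. \<beta> \<in> {0..\<beta>\<^sub>0} \<Longrightarrow> distorted_eqn \<nu> R \<beta> (\<Theta> \<beta>)"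
    and uniq: "\<And>\<beta> u. \<beta> \<in> {0..\<beta>\<^sub>0} \<Longrightarrow> u \<in> space_E R \<Longrightarrow> dist_E R u (\<lambda>r \<zeta>. \<theta> r) < \<epsilon> \<Longrightarrow>
        distorted_eqn \<nu> R \<beta> u \<Longrightarrow> eq_E R u (\<Theta> \<beta>)"
    using Theta unfolding distorted_lane_emden_def by blast
  \<comment> \<open>The solution at \<open>\<beta> = 0\<close> is the Lane--Emden profile itself, so \<open>N\<close> below tends to 0.\<close>
  have T0: "eq_E R (\<lambda>r \<zeta>. \<theta> r) (\<Theta> 0)"
  proof (rule uniq)
    show "(\<lambda>r \<zeta>. \<theta> r) \<in> space_E R" by (rule space_E_radial[OF theta_cont])
    have "dist_E R (\<lambda>r \<zeta>. \<theta> r) (\<lambda>r \<zeta>. \<theta> r) \<le> 0"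
      unfolding dist_E_def using R_pos by (intro norm_E_le) auto
    then show "dist_E R (\<lambda>r \<zeta>. \<theta> r) (\<lambda>r \<zeta>. \<theta> r) < \<epsilon>" using eps by simp
    show "distorted_eqn \<nu> R 0 (\<lambda>r \<zeta>. \<theta> r)"
      using theta_fixed_point by (simp add: distorted_eqn_def eq_E_def)
  qed (use b0 in simp)
  define w where "w \<beta> = (\<lambda>r \<zeta>. \<Theta> \<beta> r \<zeta> + (-1) * \<theta> r)" for \<beta>
  define N where "N \<beta> = norm_E R (w \<beta>)" for \<beta>
  have wE: "w \<beta> \<in> space_E R" if "\<beta> \<in> {0..\<beta>\<^sub>0}" for \<beta>
    unfolding w_def by (rule linearization_remainder(1)[OF nu2 E[OF that] eqn[OF that]])
  have N0: "0 \<le> N \<beta>" if "\<beta> \<in> {0..\<beta>\<^sub>0}" for \<beta>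
    unfolding N_def using norm_E_nonneg[OF space_E_cont_rect[OF wE[OF that]]] R_pos by simp
  have N_lim: "(N \<longlongrightarrow> 0) (at_right 0)"
  proof -
    have "((\<lambda>b. dist_E R (\<Theta> b) (\<Theta> 0)) \<longlongrightarrow> 0) (at 0 within {0..\<beta>\<^sub>0})"
      using Theta b0 by (auto simp: distorted_lane_emden_def)
    moreover have "dist_E R (\<Theta> b) (\<Theta> 0) = N b" for b
      unfolding dist_E_def N_def norm_E_def w_def
      using T0 by (intro SUP_cong) (auto simp: eq_E_def)
    ultimately show ?thesis using b0 by (simp add: at_within_Icc_at_right)
  qed
  obtain C0 where C0: "0 \<le> C0" "\<And>u. u \<in> space_E R \<Longrightarrow> norm_E R u \<le> C0 * norm_E R (lin u)"
    using lin_bounded_below by metis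
  define K where "K = C0 * (2 * (R ^ 3 / 3 + 2 * R) * \<nu>)"
  have K: "0 \<le> K" using C0 R_pos nu by (simp add: K_def)
  define H where "H = norm_E R (S g1)"
  have H: "0 \<le> H" unfolding H_def
    using norm_E_nonneg[OF space_E_cont_rect[OF linear_response(1)]] R_pos by simp
  have diff: "\<bar>w \<beta> r \<zeta> - \<beta> * S g1 r \<zeta>\<bar> \<le> K * N \<beta> powr \<nu>"
    if b: "\<beta> \<in> {0..\<beta>\<^sub>0}" and rz: "r \<in> {0..R}" "\<zeta> \<in> {-1..1}" for \<beta> r \<zeta>
  proof -
    let ?d = "\<lambda>r \<zeta>. w \<beta> r \<zeta> + (- \<beta>) * S g1 r \<zeta>"
    have dE: "?d \<in> space_E R" by (rule space_E_combine[OF wE[OF b] linear_response(1)])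
    have "norm_E R (lin ?d) \<le> 2 * (R ^ 3 / 3 + 2 * R) * (\<nu> * N \<beta> powr \<nu>)"
    proof (rule norm_E_le)
      fix r \<zeta> assume rz: "r \<in> {0..R}" "\<zeta> \<in> {-1..1::real}"
      have "lin ?d r \<zeta> = lin (w \<beta>) r \<zeta> + (- \<beta>) * lin (S g1) r \<zeta>"
        by (rule lin_combine[OF space_E_cont_rect[OF wE[OF b]] space_E_cont_rect[OF linear_response(1)] rz])
      also have "lin (S g1) r \<zeta> = g1 r \<zeta>" using linear_response(2) rz by (simp add: eq_E_def)
      finally have "lin ?d r \<zeta> = lin (w \<beta>) r \<zeta> - \<beta> * g1 r \<zeta>" by simp
      then show "\<bar>lin ?d r \<zeta>\<bar> \<le> 2 * (R ^ 3 / 3 + 2 * R) * (\<nu> * N \<beta> powr \<nu>)"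
        using linearization_remainder(2)[OF nu2 E[OF b] eqn[OF b] rz] unfolding N_def w_def by (simp only:)
    qed (use R_pos in simp)
    then have "C0 * norm_E R (lin ?d) \<le> C0 * (2 * (R ^ 3 / 3 + 2 * R) * (\<nu> * N \<beta> powr \<nu>))"
      using C0(1) by (rule mult_left_mono)
    also have "\<dots> = K * N \<beta> powr \<nu>" by (simp add: K_def)
    finally have "norm_E R ?d \<le> K * N \<beta> powr \<nu>" using C0(2)[OF dE] by linarith
    then show ?thesis using abs_le_norm_E[OF space_E_cont_rect[OF dE] rz] by simp
  qed
  have small: "\<forall>\<^sub>F \<beta> in at_right 0. K * N \<beta> powr (\<nu> - 1) < 1 / 2"
  proof -
    have "\<forall>\<^sub>F \<beta> in at_right 0. \<beta> \<in> {0<..<\<beta>\<^sub>0}" using b0 eventually_at_right_real by blast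
    then have "\<forall>\<^sub>F \<beta> in at_right 0. 0 \<le> N \<beta>" by eventually_elim (use N0 in auto)
    then have "((\<lambda>\<beta>. N \<beta> powr (\<nu> - 1)) \<longlongrightarrow> 0 powr (\<nu> - 1)) (at_right 0)"
      using nu N_lim by (intro tendsto_powr2 tendsto_const) auto
    then have "((\<lambda>\<beta>. K * N \<beta> powr (\<nu> - 1)) \<longlongrightarrow> K * 0) (at_right 0)"
      by (intro tendsto_mult tendsto_const) simp
    then show ?thesis by (rule order_tendstoD) simp
  qed
  have "\<forall>\<^sub>F \<beta> in at_right 0. \<forall>r\<in>{0..R}. \<forall>\<zeta>\<in>{-1..1}.
      \<bar>\<Theta> \<beta> r \<zeta> - \<theta> r - \<beta> * S g1 r \<zeta>\<bar> \<le> K * (2 * H) powr \<nu> * \<beta> powr \<nu>"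
    using small eventually_at_right_real[OF b0]
  proof eventually_elim
    case (elim \<beta>)
    then have b: "\<beta> \<in> {0..\<beta>\<^sub>0}" "0 < \<beta>" by auto
    have "N \<beta> \<le> \<beta> * H + K * N \<beta> powr \<nu>"
      unfolding N_def
    proof (rule norm_E_le)
      fix r \<zeta> assume rz: "r \<in> {0..R}" "\<zeta> \<in> {-1..1::real}"
      have "\<bar>\<beta> * S g1 r \<zeta>\<bar> \<le> \<beta> * H"
        unfolding H_def abs_mult using b abs_le_norm_E[OF space_E_cont_rect[OF linear_response(1)] rz]
        by (simp add: mult_left_mono)
      then show "\<bar>w \<beta> r \<zeta>\<bar> \<le> \<beta> * H + K * norm_E R (w \<beta>) powr \<nu>"
        using diff[OF b(1) rz] unfolding N_def by linarith
    qed (use R_pos in simp)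
    moreover have "K * N \<beta> powr \<nu> \<le> 1 / 2 * N \<beta>"
    proof (cases "N \<beta> = 0")
      case False
      then have "0 < N \<beta>" using N0[OF b(1)] by simp
      then have "N \<beta> powr \<nu> = N \<beta> powr (\<nu> - 1) * N \<beta>" by (simp add: powr_diff)
      then have "K * N \<beta> powr \<nu> = K * N \<beta> powr (\<nu> - 1) * N \<beta>" by simp
      also have "\<dots> \<le> 1 / 2 * N \<beta>" using elim(1) \<open>0 < N \<beta>\<close> by (intro mult_right_mono) auto
      finally show ?thesis .
    qed simp
    ultimately have "N \<beta> \<le> 2 * (\<beta> * H)" by linarith
    then have "N \<beta> \<le> 2 * H * \<beta>" by (simp add: mult_ac)
    then have "N \<beta> powr \<nu> \<le> (2 * H * \<beta>) powr \<nu>" using N0[OF b(1)] nu by (intro powr_mono2) auto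
    also have "\<dots> = (2 * H) powr \<nu> * \<beta> powr \<nu>" using H b by (simp add: powr_mult)
    finally have N: "K * N \<beta> powr \<nu> \<le> K * ((2 * H) powr \<nu> * \<beta> powr \<nu>)" using K by (rule mult_left_mono)
    show ?case
    proof (intro ballI)
      fix r \<zeta> assume rz: "r \<in> {0..R}" "\<zeta> \<in> {-1..1::real}"
      show "\<bar>\<Theta> \<beta> r \<zeta> - \<theta> r - \<beta> * S g1 r \<zeta>\<bar> \<le> K * (2 * H) powr \<nu> * \<beta> powr \<nu>"
        using diff[OF b(1) rz] N by (simp add: w_def mult.assoc)
    qed
  qed
  then show ?thesis using K by (intro that[of "K * (2 * H) powr \<nu>"]) auto
qed

text \<open>
  A first pass with \<open>theta_coercive\<close> yields \<open>\<Xi> - \<xi> = O(\<beta>)\<close>. With it the quadratic Taylor term and the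
  change of \<open>\<beta> h\<close> between \<open>\<Xi>\<close> and \<open>\<xi>\<close> are \<open>O(\<beta>\<^sup>2)\<close>, hence \<open>O(\<beta> powr \<nu>)\<close> as \<open>\<nu> < 2\<close>.
\<close>

theorem boundary_expansion:
  assumes nu2: "\<nu> < 2" and Theta: "distorted_lane_emden \<nu> R \<theta> \<beta>\<^sub>0 \<Theta>"
    and Xi: "\<And>\<beta>. \<beta> \<in> {0..\<beta>\<^sub>0} \<Longrightarrow> vacuum_boundary R (\<Theta> \<beta>) (\<Xi> \<beta>)"
  obtains C where "0 \<le> C"
    "\<forall>\<^sub>F \<beta> in at_right 0. \<forall>\<zeta>\<in>{-1..1}. \<bar>\<Xi> \<beta> \<zeta> - (\<xi> + \<xi>\<^sup>2 / mu * S g1 \<xi> \<zeta> * \<beta>)\<bar> \<le> C * \<beta> powr \<nu>"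
proof -
  have b0: "0 < \<beta>\<^sub>0" and E: "\<And>\<beta>. \<beta> \<in> {0..\<beta>\<^sub>0} \<Longrightarrow> \<Theta> \<beta> \<in> space_E R"
    using Theta by (auto simp: distorted_lane_emden_def)
  obtain C where C: "0 \<le> C" "\<forall>\<^sub>F \<beta> in at_right 0. \<forall>r\<in>{0..R}. \<forall>\<zeta>\<in>{-1..1}.
      \<bar>\<Theta> \<beta> r \<zeta> - \<theta> r - \<beta> * S g1 r \<zeta>\<bar> \<le> C * \<beta> powr \<nu>"
    by (rule distorted_expansion[OF nu2 Theta])
  obtain c where c: "0 < c" "\<And>r. r \<in> {0..R} \<Longrightarrow> c * \<bar>r - \<xi>\<bar> \<le> \<bar>\<theta> r\<bar>"
    using theta_coercive by metis
  obtain T where T: "0 \<le> T" "\<And>r. r \<in> {\<xi> / 2..R} \<Longrightarrow> \<bar>\<theta> r + mu / \<xi>\<^sup>2 * (r - \<xi>)\<bar> \<le> T * (r - \<xi>)\<^sup>2"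
    using theta_taylor by metis
  obtain \<Lambda> where L: "0 \<le> \<Lambda>" "\<And>r r' \<zeta>. r \<in> {0..R} \<Longrightarrow> r' \<in> {0..R} \<Longrightarrow> \<zeta> \<in> {-1..1} \<Longrightarrow>
      \<bar>S g1 r \<zeta> - S g1 r' \<zeta>\<bar> \<le> \<Lambda> * \<bar>r - r'\<bar>"
    using linear_response_Lipschitz by metis
  define H where "H = norm_E R (S g1)"
  have H: "0 \<le> H" "\<And>r \<zeta>. r \<in> {0..R} \<Longrightarrow> \<zeta> \<in> {-1..1} \<Longrightarrow> \<bar>S g1 r \<zeta>\<bar> \<le> H"
    unfolding H_def
    using norm_E_nonneg[OF space_E_cont_rect[OF linear_response(1)]] R_pos
      abs_le_norm_E[OF space_E_cont_rect[OF linear_response(1)]] by auto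
  define K where "K = (C + H) / c"
  have K: "0 \<le> K" using C H c by (simp add: K_def)
  define D where "D = T * K\<^sup>2 + C + \<Lambda> * K"
  have D: "0 \<le> D" using T K C L by (simp add: D_def)
  \<comment> \<open>The last bound keeps the boundary radius above \<open>\<xi> / 2\<close>, where the Taylor estimate holds.\<close>
  define b where "b = min \<beta>\<^sub>0 (min 1 (\<xi> / (2 * (K + 1))))"
  have b: "0 < b" "b \<le> \<beta>\<^sub>0" "b \<le> 1" "b \<le> \<xi> / (2 * (K + 1))" using b0 xi_pos K by (auto simp: b_def)
  have "\<forall>\<^sub>F \<beta> in at_right 0. \<forall>\<zeta>\<in>{-1..1}.
      \<bar>\<Xi> \<beta> \<zeta> - (\<xi> + \<xi>\<^sup>2 / mu * S g1 \<xi> \<zeta> * \<beta>)\<bar> \<le> \<xi>\<^sup>2 / mu * D * \<beta> powr \<nu>"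
    using C(2) eventually_at_right_real[OF b(1)]
  proof eventually_elim
    case (elim \<beta>)
    have be: "0 < \<beta>" "\<beta> < 1" "\<beta> \<in> {0..\<beta>\<^sub>0}" using elim b by auto
    have bn: "\<beta>\<^sup>2 \<le> \<beta> powr \<nu>" "\<beta> powr \<nu> \<le> \<beta>"
      using powr_mono'[of \<nu> 2 \<beta>] powr_mono'[of 1 \<nu> \<beta>] be nu nu2 by auto
    show ?case
    proof
      fix \<zeta> assume z: "\<zeta> \<in> {-1..1::real}"
      define x where "x = \<Xi> \<beta> \<zeta>"
      have x: "x \<in> {0..R}" using Xi[OF be(3)] z by (auto simp: vacuum_boundary_def x_def less_imp_le)
      have "\<Theta> \<beta> x \<zeta> = 0" unfolding x_def by (rule vacuum_boundary_zero[OF E Xi z]) (use be in auto)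
      then have e1: "\<bar>\<theta> x + \<beta> * S g1 x \<zeta>\<bar> \<le> C * \<beta> powr \<nu>"
        using elim(1)[rule_format, OF x z] by linarith
      have "\<bar>\<beta> * S g1 x \<zeta>\<bar> \<le> \<beta> * H" using H(2)[OF x z] be by (simp add: abs_mult)
      moreover have "C * \<beta> powr \<nu> \<le> C * \<beta>" using bn C by (intro mult_left_mono) auto
      ultimately have "\<bar>\<theta> x\<bar> \<le> (C + H) * \<beta>" using e1 by (simp add: algebra_simps)
      then have "c * \<bar>x - \<xi>\<bar> \<le> (C + H) * \<beta>" using c(2)[OF x] by linarith
      then have xK: "\<bar>x - \<xi>\<bar> \<le> K * \<beta>" using c(1) by (simp add: K_def field_simps)
      have "K * \<beta> \<le> (K + 1) * b" using elim(2) K by (intro mult_mono) auto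
      also have "\<dots> \<le> (K + 1) * (\<xi> / (2 * (K + 1)))" using b K by (intro mult_left_mono) auto
      also have "\<dots> = \<xi> / 2"
      proof -
        have "q * (\<xi> / (2 * q)) = \<xi> / 2" if "q \<noteq> 0" for q using that by simp
        moreover have "K + 1 \<noteq> 0" using K by linarith
        ultimately show ?thesis .
      qed
      finally have "x \<in> {\<xi> / 2..R}" using xK x by auto
      then have "\<bar>\<theta> x + mu / \<xi>\<^sup>2 * (x - \<xi>)\<bar> \<le> T * (x - \<xi>)\<^sup>2" by (rule T(2))
      also have "\<dots> \<le> T * (K * \<beta>)\<^sup>2"
        using T(1) xK K be by (intro mult_left_mono) (auto simp: abs_le_square_iff[symmetric] abs_mult)
      also have "\<dots> \<le> T * K\<^sup>2 * \<beta> powr \<nu>"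
        using T(1) bn by (simp add: power_mult_distrib mult_left_mono mult.assoc)
      finally have e2: "\<bar>\<theta> x + mu / \<xi>\<^sup>2 * (x - \<xi>)\<bar> \<le> T * K\<^sup>2 * \<beta> powr \<nu>" .
      have "\<bar>S g1 x \<zeta> - S g1 \<xi> \<zeta>\<bar> \<le> \<Lambda> * (K * \<beta>)"
        using L(2)[OF x _ z, of \<xi>] mult_left_mono[OF xK L(1)] xi_pos R by simp
      then have "\<beta> * \<bar>S g1 x \<zeta> - S g1 \<xi> \<zeta>\<bar> \<le> \<beta> * (\<Lambda> * (K * \<beta>))"
        using be by (intro mult_left_mono) auto
      also have "\<dots> = \<Lambda> * K * \<beta>\<^sup>2" by (simp add: power2_eq_square)
      also have "\<dots> \<le> \<Lambda> * K * \<beta> powr \<nu>" using bn L K by (intro mult_left_mono) auto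
      finally have e3: "\<bar>\<beta> * S g1 x \<zeta> - \<beta> * S g1 \<xi> \<zeta>\<bar> \<le> \<Lambda> * K * \<beta> powr \<nu>"
        using be by (simp add: abs_mult flip: right_diff_distrib)
      have "\<bar>mu / \<xi>\<^sup>2 * (x - \<xi>) - \<beta> * S g1 \<xi> \<zeta>\<bar> \<le> D * \<beta> powr \<nu>"
        using e1 e2 e3 unfolding D_def distrib_right by linarith
      then have "\<xi>\<^sup>2 / mu * \<bar>mu / \<xi>\<^sup>2 * (x - \<xi>) - \<beta> * S g1 \<xi> \<zeta>\<bar> \<le> \<xi>\<^sup>2 / mu * (D * \<beta> powr \<nu>)"
        using mu_pos by (intro mult_left_mono) auto
      also have "\<xi>\<^sup>2 / mu * \<bar>mu / \<xi>\<^sup>2 * (x - \<xi>) - \<beta> * S g1 \<xi> \<zeta>\<bar> = \<bar>\<xi>\<^sup>2 / mu * (mu / \<xi>\<^sup>2 * (x - \<xi>) - \<beta> * S g1 \<xi> \<zeta>)\<bar>"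
        using mu_pos by (simp add: abs_mult)
      also have "\<xi>\<^sup>2 / mu * (mu / \<xi>\<^sup>2 * (x - \<xi>) - \<beta> * S g1 \<xi> \<zeta>) = x - (\<xi> + \<xi>\<^sup>2 / mu * S g1 \<xi> \<zeta> * \<beta>)"
        using mu_pos xi_pos by (simp add: field_simps)
      finally show "\<bar>\<Xi> \<beta> \<zeta> - (\<xi> + \<xi>\<^sup>2 / mu * S g1 \<xi> \<zeta> * \<beta>)\<bar> \<le> \<xi>\<^sup>2 / mu * D * \<beta> powr \<nu>"
        by (simp add: x_def mult.assoc)
    qed
  qed
  then show ?thesis using D mu_pos by (intro that[of "\<xi>\<^sup>2 / mu * D"]) auto
qed

end

theorem mainTheorem7:
  fixes \<nu> R \<xi>\<^sub>1 \<mu>\<^sub>1 \<beta>\<^sub>0 :: real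
    and \<theta> :: "real \<Rightarrow> real"
    and S :: "(real \<Rightarrow> real \<Rightarrow> real) \<Rightarrow> (real \<Rightarrow> real \<Rightarrow> real)"
    and h :: "real \<Rightarrow> real \<Rightarrow> real"
    and \<Theta> :: "real \<Rightarrow> real \<Rightarrow> real \<Rightarrow> real"
    and \<Xi>\<^sub>1 :: "real \<Rightarrow> real \<Rightarrow> real"
  assumes nu: "1 < \<nu>" "\<nu> < 2"
    and theta: "lane_emden \<nu> \<theta> \<xi>\<^sub>1"
    and mu: "\<mu>\<^sub>1 = lane_emden_mass \<nu> \<theta> \<xi>\<^sub>1"
    and R: "\<xi>\<^sub>1 < R"
    and inv: "bounded_inverse_E R (\<lambda>u r \<zeta>. u r \<zeta> - op_DG \<nu> R (\<lambda>r \<zeta>. \<theta> r) u r \<zeta>) S"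
    and h: "h = S g1"
    and Theta: "distorted_lane_emden \<nu> R \<theta> \<beta>\<^sub>0 \<Theta>"
    and Xi: "\<And>\<beta>. \<beta> \<in> {0..\<beta>\<^sub>0} \<Longrightarrow> vacuum_boundary R (\<Theta> \<beta>) (\<Xi>\<^sub>1 \<beta>)"
  shows "(\<exists>C. \<forall>\<^sub>F \<beta> in at_right 0. \<forall>\<zeta>\<in>{-1..1}.
            \<bar>\<Xi>\<^sub>1 \<beta> \<zeta> - (\<xi>\<^sub>1 + \<xi>\<^sub>1\<^sup>2 / \<mu>\<^sub>1 * h \<xi>\<^sub>1 \<zeta> * \<beta>)\<bar> \<le> C * \<beta> powr \<nu>) \<and>
         (\<forall>s\<in>{-1, 1}.
            (\<lambda>\<beta>. (\<Xi>\<^sub>1 \<beta> 0 - \<Xi>\<^sub>1 \<beta> s) / \<xi>\<^sub>1 - (- (3 / 2) * (\<xi>\<^sub>1 / \<mu>\<^sub>1) * P2_component h \<xi>\<^sub>1 * \<beta>))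
              \<in> O[at_right 0](\<lambda>\<beta>. \<beta> powr \<nu>) \<and>
            (\<forall>\<^sub>F \<beta> in at_right 0. 0 < (\<Xi>\<^sub>1 \<beta> 0 - \<Xi>\<^sub>1 \<beta> s) / \<xi>\<^sub>1))"
proof -
  note nu2 = nu(2)
  interpret lane_emden_inverse \<nu> R \<xi>\<^sub>1 \<theta> S
    by unfold_locales (use nu theta R inv in auto)
  have mu': "mu = \<mu>\<^sub>1" by (simp add: mu_def mu)
  obtain C where C: "0 \<le> C"
    "\<forall>\<^sub>F \<beta> in at_right 0. \<forall>\<zeta>\<in>{-1..1}. \<bar>\<Xi>\<^sub>1 \<beta> \<zeta> - (\<xi>\<^sub>1 + \<xi>\<^sub>1\<^sup>2 / \<mu>\<^sub>1 * h \<xi>\<^sub>1 \<zeta> * \<beta>)\<bar> \<le> C * \<beta> powr \<nu>"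
    by (rule boundary_expansion[OF nu2 Theta Xi, unfolded mu' h[symmetric]])
  obtain v y where str: "\<And>r \<zeta>. r \<in> {0..R} \<Longrightarrow> \<zeta> \<in> {-1..1} \<Longrightarrow> h r \<zeta> = v r - y r * P2 \<zeta>"
    and y: "\<And>r. 0 < r \<Longrightarrow> r \<le> R \<Longrightarrow> 0 < y r"
    using linear_response_structure unfolding h by metis
  have xi: "0 < \<xi>\<^sub>1" "\<xi>\<^sub>1 \<in> {0..R}" using xi_pos R by auto
  have comp: "P2_component h \<xi>\<^sub>1 = - y \<xi>\<^sub>1"
    by (rule P2_component_zonal) (rule str[OF xi(2)])
  define k where "k = 3 / 2 * (\<xi>\<^sub>1 / \<mu>\<^sub>1) * y \<xi>\<^sub>1"
  have k: "0 < k" using xi mu_pos y[of \<xi>\<^sub>1] by (simp add: k_def mu')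
  have mu0: "\<mu>\<^sub>1 \<noteq> 0" using mu_pos mu' by simp
  have key: "\<forall>\<^sub>F \<beta> in at_right 0. \<bar>(\<Xi>\<^sub>1 \<beta> 0 - \<Xi>\<^sub>1 \<beta> s) / \<xi>\<^sub>1 - k * \<beta>\<bar> \<le> 2 * C / \<xi>\<^sub>1 * \<beta> powr \<nu>"
    if s: "s \<in> {-1, 1}" for s
    using C(2)
  proof eventually_elim
    case (elim \<beta>)
    have s': "s \<in> {-1..1}" "P2 s = 1" "P2 0 = - 1 / 2" using s by (auto simp: P2_def)
    let ?e = "\<lambda>\<zeta>. \<Xi>\<^sub>1 \<beta> \<zeta> - (\<xi>\<^sub>1 + \<xi>\<^sub>1\<^sup>2 / \<mu>\<^sub>1 * h \<xi>\<^sub>1 \<zeta> * \<beta>)"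
    have h0: "h \<xi>\<^sub>1 0 = v \<xi>\<^sub>1 + y \<xi>\<^sub>1 / 2" and hs: "h \<xi>\<^sub>1 s = v \<xi>\<^sub>1 - y \<xi>\<^sub>1"
      using str[OF xi(2), of 0] str[OF xi(2) s'(1)] s' by auto
    have "(\<Xi>\<^sub>1 \<beta> 0 - \<Xi>\<^sub>1 \<beta> s) / \<xi>\<^sub>1 - k * \<beta> = (?e 0 - ?e s) / \<xi>\<^sub>1"
      unfolding h0 hs k_def using xi(1) mu0 by (simp add: field_simps power2_eq_square)
    also have "\<bar>\<dots>\<bar> = \<bar>?e 0 - ?e s\<bar> / \<xi>\<^sub>1" using xi(1) by (simp add: abs_divide)
    also have "\<dots> \<le> (2 * C * \<beta> powr \<nu>) / \<xi>\<^sub>1"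
    proof (rule divide_right_mono)
      have "\<bar>?e 0 - ?e s\<bar> \<le> \<bar>?e 0\<bar> + \<bar>?e s\<bar>" by (rule abs_triangle_ineq4)
      also have "\<dots> \<le> C * \<beta> powr \<nu> + C * \<beta> powr \<nu>"
        by (intro add_mono elim[rule_format]) (use s' in auto)
      finally show "\<bar>?e 0 - ?e s\<bar> \<le> 2 * C * \<beta> powr \<nu>" by simp
    qed (use xi(1) in simp)
    finally show ?case by simp
  qed
  show ?thesis
  proof (intro conjI ballI)
    show "\<exists>C. \<forall>\<^sub>F \<beta> in at_right 0. \<forall>\<zeta>\<in>{-1..1}.
        \<bar>\<Xi>\<^sub>1 \<beta> \<zeta> - (\<xi>\<^sub>1 + \<xi>\<^sub>1\<^sup>2 / \<mu>\<^sub>1 * h \<xi>\<^sub>1 \<zeta> * \<beta>)\<bar> \<le> C * \<beta> powr \<nu>"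
      using C(2) by blast
  next
    fix s :: real assume s: "s \<in> {-1, 1}"
    have keq: "- (3 / 2) * (\<xi>\<^sub>1 / \<mu>\<^sub>1) * P2_component h \<xi>\<^sub>1 * \<beta> = k * \<beta>" for \<beta>
      by (simp add: comp k_def)
    show "(\<lambda>\<beta>. (\<Xi>\<^sub>1 \<beta> 0 - \<Xi>\<^sub>1 \<beta> s) / \<xi>\<^sub>1 - (- (3 / 2) * (\<xi>\<^sub>1 / \<mu>\<^sub>1) * P2_component h \<xi>\<^sub>1 * \<beta>))
        \<in> O[at_right 0](\<lambda>\<beta>. \<beta> powr \<nu>)"
      unfolding keq by (rule bigoI[of _ "2 * C / \<xi>\<^sub>1"]) (use key[OF s] in simp)
    have "((\<lambda>\<beta>::real. 2 * C / \<xi>\<^sub>1 * \<beta> powr (\<nu> - 1)) \<longlongrightarrow> 2 * C / \<xi>\<^sub>1 * 0 powr (\<nu> - 1)) (at_right 0)"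
      using nu by (intro tendsto_mult tendsto_const tendsto_powr2 tendsto_ident_at)
        (auto simp: eventually_at_filter)
    then have "\<forall>\<^sub>F \<beta> in at_right 0. 2 * C / \<xi>\<^sub>1 * \<beta> powr (\<nu> - 1) < k"
      by (rule order_tendstoD) (use k in simp)
    moreover have "\<forall>\<^sub>F \<beta> :: real in at_right 0. 0 < \<beta>" by (simp add: eventually_at_filter)
    ultimately show "\<forall>\<^sub>F \<beta> in at_right 0. 0 < (\<Xi>\<^sub>1 \<beta> 0 - \<Xi>\<^sub>1 \<beta> s) / \<xi>\<^sub>1"
      using key[OF s]
    proof eventually_elim
      case (elim \<beta>)
      have "2 * C / \<xi>\<^sub>1 * \<beta> powr \<nu> = 2 * C / \<xi>\<^sub>1 * \<beta> powr (\<nu> - 1) * \<beta>"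
        using elim(2) by (simp add: powr_diff)
      also have "\<dots> < k * \<beta>" using elim by (intro mult_strict_right_mono) auto
      finally show ?case using elim(3) by linarith
    qed
  qed
qed

end
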